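(* Let $m\ge 2$ be an integer, let $n_1,\dots,n_m$ be positive integers, let $N=\prod_{i=1}^m n_i$, let $p$ be a real number with $1\le p<\infty$ and $p\neq 2$, and let $\phi: M_N\to M_N$ be a (complex-)linear map. The following are equivalent. (a) $\|\phi(A_1\otimes\cdots\otimes A_m)\|_p=\|A_1\otimes\cdots\otimes A_m\|_p$ for all $A_i\in M_{n_i}$, $i=1,\dots,m$. (b) There are unitary matrices $U,V\in M_N$, and maps $\varphi_s: M_{n_s}\to M_{n_s}$ for $s=1,\dots,m$, each of which is either the identity map $X\mapsto X$ or the transposition map $X\mapsto X^t$, such that $$\phi(A_1\otimes\cdots\otimes A_m)=U(\varphi_1(A_1)\otimes\cdots\otimes\varphi_m(A_m))V\quad\text{for all } A_i\in M_{n_i},\ i=1,\dots,m.$$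
   Context: $M_n$ denotes the set of $n\times n$ complex matrices. $A_1\otimes\cdots\otimes A_m\in M_N$ is the tensor (Kronecker) product; $M_{n_1}\otimes\cdots\otimes M_{n_m}$ is identified with $M_N$, $N=n_1\cdots n_m$. For $X\in M_N$ with singular values $s_1(X)\ge\cdots\ge s_N(X)$ and $p\ge 1$, the Schatten $p$-norm is $\|X\|_p=\left(\sum_{i=1}^N s_i(X)^p\right)^{1/p}$. $X^t$ is the transpose of $X$ (without conjugation). *)

theory Defs
  imports
    "HOL-Computational_Algebra.Polynomial"
    "Jordan_Normal_Form.Char_Poly"
    "Jordan_Normal_Form.Schur_Decomposition"
begin

definition kronecker :: "'a::times mat \<Rightarrow> 'a mat \<Rightarrow> 'a mat" where
  "kronecker A B = mat (dim_row A * dim_row B) (dim_col A * dim_col B)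
     (\<lambda>(i, j). A $$ (i div dim_row B, j div dim_col B) * B $$ (i mod dim_row B, j mod dim_col B))"

text \<open>The product \<open>A 1 \<otimes> \<dots> \<otimes> A m\<close>, bracketed to the left; the indices start at 1. The
  empty product is the \<open>1 \<times> 1\<close> identity, which is a unit for the Kronecker product.\<close>

fun kronecker_fam :: "(nat \<Rightarrow> 'a::semiring_1 mat) \<Rightarrow> nat \<Rightarrow> 'a mat" where
  "kronecker_fam A 0 = 1\<^sub>m 1"
| "kronecker_fam A (Suc m) = kronecker (kronecker_fam A m) (A (Suc m))"

text \<open>The non-negative square roots of the eigenvalues of \<open>X\<^sup>* X\<close>, repeated according to
  algebraic multiplicity, in non-increasing order. These eigenvalues are real and non-negative,
  so \<open>Re\<close> only changes the type.\<close>

definition singular_values :: "complex mat \<Rightarrow> real list" where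
  "singular_values X =
     rev (sorted_list_of_multiset
       (image_mset (\<lambda>e. sqrt (Re e)) (proots (char_poly (mat_adjoint X * X)))))"

definition schatten_norm :: "real \<Rightarrow> complex mat \<Rightarrow> real" where
  "schatten_norm p X = (\<Sum>s\<leftarrow>singular_values X. s powr p) powr (1 / p)"

definition unitary_mat :: "nat \<Rightarrow> complex mat \<Rightarrow> bool" where
  "unitary_mat n U \<longleftrightarrow>
     U \<in> carrier_mat n n \<and> mat_adjoint U * U = 1\<^sub>m n \<and> U * mat_adjoint U = 1\<^sub>m n"

definition linear_on_mats :: "nat \<Rightarrow> (complex mat \<Rightarrow> complex mat) \<Rightarrow> bool" where
  "linear_on_mats n \<phi> \<longleftrightarrow>
     (\<forall>X\<in>carrier_mat n n. \<phi> X \<in> carrier_mat n n) \<and>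
     (\<forall>X\<in>carrier_mat n n. \<forall>Y\<in>carrier_mat n n. \<phi> (X + Y) = \<phi> X + \<phi> Y) \<and>
     (\<forall>c. \<forall>X\<in>carrier_mat n n. \<phi> (c \<cdot>\<^sub>m X) = c \<cdot>\<^sub>m \<phi> X)"

end

theory Submission
  imports Defs
begin

text \<open>Let \<open>\<phi>\<close> preserve the norm of product tensors. Images of the diagonal matrix units have norm \<open>1\<close>, images
  of tensors of diagonal unitaries have norm \<open>N\<^bsup>1/p\<^esup>\<close>; averaging over characters compares their Frobenius norms,
  and as \<open>p \<noteq> 2\<close> the power mean inequalities on singular values become equalities. So the images of the
  diagonal units are \<open>u\<^sub>b \<otimes> v\<^sub>b\<close> with \<open>u\<close> and \<open>v\<close> orthonormal. The same holds after composing with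
  product unitaries, hence every rank one product tensor has a nonzero rank one image. A multilinear map
  with this property has in each of its \<open>2m\<close> vector arguments a constant type: moving that argument keeps
  the left or the right factor of the image. Orthonormality gives opposite types to the row and the column
  argument of each tensor factor, which decides between identity and transposition.

  Conversely, the characteristic polynomial of \<open>(\<Otimes>A\<^sub>s)\<^sup>*(\<Otimes>A\<^sub>s)\<close> depends only on those of the \<open>A\<^sub>s\<^sup>*A\<^sub>s\<close>, which
  transposing \<open>A\<^sub>s\<close> does not change.\<close>

subsection \<open>Singular values and Frobenius norms\<close>

text \<open>The norm hypothesis concerns product tensors only, so no description of the isometries
  of the whole matrix space applies, and orthogonality relations are visible only in the Frobenius
  norm. The two test families therefore sit at opposite extremes: \<open>\<Sum> s powr p\<close> is
  1 for the one and the number of singular values for the other, so the comparisons with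
  \<open>\<Sum> s\<^sup>2\<close> point in opposite directions. Equality leaves only the singular
  values 0 and 1; this is exploited without a singular value decomposition, through fourth powers,
  that is, through the Frobenius norm of the Gram matrix. The obstacle for the types is that a move
  in one argument might keep the left factor for some values of the other arguments and the right
  factor for others. Knowing the types, the images of the matrix units are still fixed only up to
  phases; these have to split into a row phase and a column phase before they can be absorbed into
  \<open>U\<close> and \<open>V\<close>, and this needs one more rank one image.\<close>

definition mtrace :: "nat \<Rightarrow> 'a::comm_monoid_add mat \<Rightarrow> 'a" where
  "mtrace n A = (\<Sum>i<n. A $$ (i, i))"

lemma mult_mat_entry:
  assumes "A \<in> carrier_mat m k" "B \<in> carrier_mat k n" "i < m" "j < n"
  shows "(A * B) $$ (i, j) = (\<Sum>l<k. A $$ (i, l) * B $$ (l, j))"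
  using assms by (auto simp: scalar_prod_def atLeast0LessThan intro!: sum.cong)

lemma mtrace_mult_commute:
  fixes A B :: "'a::comm_semiring_0 mat"
  assumes "A \<in> carrier_mat n k" "B \<in> carrier_mat k n"
  shows "mtrace n (A * B) = mtrace k (B * A)"
proof -
  have "mtrace n (A * B) = (\<Sum>i<n. \<Sum>l<k. A $$ (i, l) * B $$ (l, i))"
    unfolding mtrace_def by (intro sum.cong refl mult_mat_entry[OF assms]) auto
  also have "\<dots> = (\<Sum>l<k. \<Sum>i<n. B $$ (l, i) * A $$ (i, l))"
    by (subst sum.swap) (simp add: mult.commute)
  also have "\<dots> = mtrace k (B * A)"
    unfolding mtrace_def by (intro sum.cong refl mult_mat_entry[OF assms(2,1), symmetric]) auto
  finally show ?thesis .
qed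

lemma mtrace_similar:
  fixes A B :: "'a::comm_ring_1 mat"
  assumes "A \<in> carrier_mat n n" "similar_mat_wit A B P Q"
  shows "mtrace n A = mtrace n B"
proof -
  note w = similar_mat_witD2[OF assms]
  have "mtrace n A = mtrace n (P * (B * Q))" using w by (simp add: assoc_mult_mat)
  also have "\<dots> = mtrace n ((B * Q) * P)" by (rule mtrace_mult_commute) (use w in auto)
  also have "(B * Q) * P = B * (Q * P)" using w by (simp add: assoc_mult_mat[of B n n Q n P n])
  also have "\<dots> = B" using w by simp
  finally show ?thesis .
qed

lemma sum_list_diag_mat:
  assumes "B \<in> carrier_mat n n"
  shows "(\<Sum>x\<leftarrow>diag_mat B. f x) = (\<Sum>i<n. f (B $$ (i, i)))"
  using assms by (simp add: diag_mat_def interv_sum_list_conv_sum_set_nat atLeast0LessThan comp_def)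

text \<open>A Schur decomposition puts the given roots on the diagonal of a similar triangular
  matrix, and similarity preserves both traces. This links singular values, defined through roots of
  a polynomial, to matrix entries.\<close>

lemma traces_eq_power_sums_roots:
  fixes A :: "complex mat"
  assumes A: "A \<in> carrier_mat n n" and es: "char_poly A = (\<Prod>e\<leftarrow>es. [:- e, 1:])"
  shows "mtrace n A = sum_list es" "mtrace n (A * A) = (\<Sum>e\<leftarrow>es. e\<^sup>2)"
proof -
  obtain B P Q where "schur_decomposition A es = (B, P, Q)"
    by (cases "schur_decomposition A es") auto
  from schur_decomposition[OF A es this]
  have w: "similar_mat_wit A B P Q" and ut: "upper_triangular B" and dg: "diag_mat B = es" by auto
  note wd = similar_mat_witD2[OF A w]
  have B: "B \<in> carrier_mat n n" using wd by simp
  show "mtrace n A = sum_list es"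
    using mtrace_similar[OF A w] sum_list_diag_mat[OF B, of "\<lambda>x. x"] dg by (simp add: mtrace_def)
  have "similar_mat_wit (A ^\<^sub>m 2) (B ^\<^sub>m 2) P Q" by (rule similar_mat_wit_pow[OF w])
  hence w2: "similar_mat_wit (A * A) (B * B) P Q" using A B by (simp add: numeral_2_eq_2)
  have "mtrace n (A * A) = mtrace n (B * B)" by (rule mtrace_similar[OF _ w2]) (use A in simp)
  also have "\<dots> = (\<Sum>i<n. (B $$ (i, i))\<^sup>2)"
    unfolding mtrace_def
  proof (rule sum.cong[OF refl])
    fix i assume i: "i \<in> {..<n}"
    have "(B * B) $$ (i, i) = (\<Sum>l<n. B $$ (i, l) * B $$ (l, i))"
      using i by (intro mult_mat_entry[OF B B]) auto
    \<comment> \<open>For \<open>l\<close> other than \<open>i\<close>, one of the entries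
      \<open>(i, l)\<close> and \<open>(l, i)\<close> lies below the diagonal.\<close>
    also have "\<dots> = (\<Sum>l<n. if l = i then (B $$ (i, i))\<^sup>2 else 0)"
    proof (rule sum.cong[OF refl])
      fix l assume "l \<in> {..<n}"
      thus "B $$ (i, l) * B $$ (l, i) = (if l = i then (B $$ (i, i))\<^sup>2 else 0)"
        using upper_triangularD[OF ut, of l i] upper_triangularD[OF ut, of i l] i B
        by (cases l i rule: linorder_cases) (auto simp: power2_eq_square)
    qed
    also have "\<dots> = (B $$ (i, i))\<^sup>2" using i by simp
    finally show "(B * B) $$ (i, i) = (B $$ (i, i))\<^sup>2" .
  qed
  also have "\<dots> = (\<Sum>e\<leftarrow>es. e\<^sup>2)" using sum_list_diag_mat[OF B, of power2] dg by (simp add: dg)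
  finally show "mtrace n (A * A) = (\<Sum>e\<leftarrow>es. e\<^sup>2)" .
qed

section \<open>Adjoints, Gram matrices and singular values\<close>

lemma mat_adjoint_carrier [simp]: "A \<in> carrier_mat m n \<Longrightarrow> mat_adjoint A \<in> carrier_mat n m"
  unfolding mat_adjoint_def by auto

lemma mat_adjoint_dim [simp]: "dim_row (mat_adjoint A) = dim_col A" "dim_col (mat_adjoint A) = dim_row A"
  unfolding mat_adjoint_def by auto

lemma gram_carrier [simp]: "X \<in> carrier_mat m n \<Longrightarrow> mat_adjoint X * X \<in> carrier_mat n n"
  by (intro carrier_matI) auto

lemma mat_adjoint_entry:
  fixes A :: "complex mat"
  assumes "A \<in> carrier_mat m n" "i < n" "j < m"
  shows "mat_adjoint A $$ (i, j) = cnj (A $$ (j, i))"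
  using assms unfolding mat_adjoint_def by (auto simp: mat_of_rows_def)

lemma gram_entry:
  fixes X :: "complex mat"
  assumes "X \<in> carrier_mat m n" "i < n" "j < n"
  shows "(mat_adjoint X * X) $$ (i, j) = (\<Sum>c<m. cnj (X $$ (c, i)) * X $$ (c, j))"
  using assms by (subst mult_mat_entry[of _ n m _ n]) (auto intro!: sum.cong simp: mat_adjoint_entry)

lemma mat_adjoint_mult:
  fixes A B :: "complex mat"
  assumes A: "A \<in> carrier_mat m k" and B: "B \<in> carrier_mat k n"
  shows "mat_adjoint (A * B) = mat_adjoint B * mat_adjoint A"
proof (rule eq_matI)
  have C: "A * B \<in> carrier_mat m n" using assms by simp
  fix i j assume "i < dim_row (mat_adjoint B * mat_adjoint A)" "j < dim_col (mat_adjoint B * mat_adjoint A)"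
  hence ij: "i < n" "j < m" using assms by auto
  show "mat_adjoint (A * B) $$ (i, j) = (mat_adjoint B * mat_adjoint A) $$ (i, j)"
    unfolding mat_adjoint_entry[OF C ij] mult_mat_entry[OF A B ij(2,1)]
      mult_mat_entry[OF mat_adjoint_carrier[OF B] mat_adjoint_carrier[OF A] ij]
    using ij by (auto simp: mat_adjoint_entry[OF A] mat_adjoint_entry[OF B] mult.commute intro!: sum.cong)
qed (use assms in auto)

lemma mat_adjoint_adjoint:
  fixes A :: "complex mat"
  shows "mat_adjoint (mat_adjoint A) = A"
  by (intro eq_matI) (auto simp: mat_adjoint_entry[of _ "dim_row A" "dim_col A"]
      mat_adjoint_entry[of _ "dim_col A" "dim_row A"])

text \<open>An eigenvalue \<open>e\<close> of \<open>X\<^sup>* X\<close> with eigenvector \<open>v\<close> satisfies \<open>e |v|\<^sup>2 = |X v|\<^sup>2\<close>.\<close>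

lemma gram_eigenvalue_nonneg:
  fixes X :: "complex mat"
  assumes X: "X \<in> carrier_mat m n" and e: "eigenvalue (mat_adjoint X * X) e"
  shows "e = complex_of_real (Re e)" "Re e \<ge> 0"
proof -
  let ?P = "mat_adjoint X * X"
  have P: "?P \<in> carrier_mat n n" using X by auto
  obtain v where v: "v \<in> carrier_vec n" "v \<noteq> 0\<^sub>v n" "?P *\<^sub>v v = e \<cdot>\<^sub>v v"
    using e P unfolding eigenvalue_def eigenvector_def by auto
  have row: "(\<Sum>j<n. ?P $$ (i, j) * v $ j) = e * v $ i" if i: "i < n" for i
  proof -
    have "(?P *\<^sub>v v) $ i = (\<Sum>j<n. ?P $$ (i, j) * v $ j)"
      using i v(1) P by (auto simp: scalar_prod_def atLeast0LessThan intro!: sum.cong)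
    thus ?thesis using v i by simp
  qed
  \<comment> \<open>This is \<open>X v\<close>; the chain below evaluates the form of the Gram
    matrix at \<open>v\<close> once as the squared length of \<open>X v\<close> and once through the
    eigenvalue equation.\<close>
  define w where "w c = (\<Sum>j<n. X $$ (c, j) * v $ j)" for c
  have "(\<Sum>c<m. complex_of_real ((cmod (w c))\<^sup>2)) = (\<Sum>c<m. cnj (w c) * w c)"
    by (intro sum.cong refl) (metis complex_norm_square mult.commute)
  also have "\<dots> = (\<Sum>c<m. \<Sum>i<n. \<Sum>j<n. cnj (v $ i) * (cnj (X $$ (c, i)) * X $$ (c, j)) * v $ j)"
    unfolding w_def cnj_sum sum_product by (simp add: mult.assoc mult.left_commute)
  also have "\<dots> = (\<Sum>i<n. \<Sum>j<n. \<Sum>c<m. cnj (v $ i) * (cnj (X $$ (c, i)) * X $$ (c, j)) * v $ j)"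
    by (subst sum.swap, rule sum.cong[OF refl], rule sum.swap)
  also have "\<dots> = (\<Sum>i<n. cnj (v $ i) * (\<Sum>j<n. ?P $$ (i, j) * v $ j))"
    by (intro sum.cong refl) (simp add: gram_entry[OF X] sum_distrib_left sum_distrib_right mult.assoc del: index_mult_mat)
  also have "\<dots> = (\<Sum>i<n. e * complex_of_real ((cmod (v $ i))\<^sup>2))"
  proof (intro sum.cong refl)
    fix i assume "i \<in> {..<n}"
    hence "cnj (v $ i) * (\<Sum>j<n. ?P $$ (i, j) * v $ j) = e * (v $ i * cnj (v $ i))"
      using row[of i] by simp
    thus "cnj (v $ i) * (\<Sum>j<n. ?P $$ (i, j) * v $ j) = e * complex_of_real ((cmod (v $ i))\<^sup>2)"
      using complex_norm_square[of "v $ i"] by simp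
  qed
  also have "\<dots> = e * complex_of_real (\<Sum>i<n. (cmod (v $ i))\<^sup>2)"
    by (simp add: sum_distrib_left)
  finally have eq: "complex_of_real (\<Sum>c<m. (cmod (w c))\<^sup>2) = e * complex_of_real (\<Sum>i<n. (cmod (v $ i))\<^sup>2)"
    by simp
  have "\<exists>i<n. v $ i \<noteq> 0" using v(1,2) by (metis carrier_vecD eq_vecI index_zero_vec(1) index_zero_vec(2))
  hence pos: "(\<Sum>i<n. (cmod (v $ i))\<^sup>2) > 0"
    by (auto intro!: sum_pos2)
  have "e = complex_of_real ((\<Sum>c<m. (cmod (w c))\<^sup>2) / (\<Sum>i<n. (cmod (v $ i))\<^sup>2))"
    using eq pos unfolding of_real_divide by (metis less_irrefl nonzero_eq_divide_eq of_real_eq_0_iff)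
  moreover have "(\<Sum>c<m. (cmod (w c))\<^sup>2) / (\<Sum>i<n. (cmod (v $ i))\<^sup>2) \<ge> 0"
    using pos by (simp add: sum_nonneg)
  ultimately show "e = complex_of_real (Re e)" "Re e \<ge> 0" by (metis Re_complex_of_real)+
qed

definition frob_sq :: "nat \<Rightarrow> complex mat \<Rightarrow> real" where
  "frob_sq n X = (\<Sum>c<n. \<Sum>d<n. (cmod (X $$ (c, d)))\<^sup>2)"

lemma proots_linear_factors:
  fixes es :: "complex list"
  shows "proots (\<Prod>e\<leftarrow>es. [:- e, 1:]) = mset es"
proof (induction es)
  case (Cons e es)
  have "(\<Prod>e\<leftarrow>es. [:- e, 1:]) \<noteq> 0" unfolding prod_list_zero_iff by auto
  hence "proots ([:- e, 1:] * (\<Prod>e\<leftarrow>es. [:- e, 1:])) = {#e#} + mset es"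
    by (subst proots_mult) (auto simp: Cons.IH simp del: mult_pCons_left)
  thus ?case by simp
qed simp

lemma mset_singular_values:
  assumes "char_poly (mat_adjoint X * X) = (\<Prod>e\<leftarrow>es. [:- e, 1:])"
  shows "mset (singular_values X) = mset (map (\<lambda>e. sqrt (Re e)) es)"
  unfolding singular_values_def assms proots_linear_factors by simp

text \<open>The roots \<open>e\<close> of the Gram matrix \<open>P\<close> are the squares of the
  singular values. Their sum is the trace of \<open>P\<close>, the squared Frobenius norm of
  \<open>X\<close>; the sum of their squares is the trace of \<open>P * P\<close>, the squared
  Frobenius norm of \<open>P\<close> since \<open>P\<close> is Hermitian.\<close>

lemma singular_values_gram:
  fixes X :: "complex mat"
  assumes X: "X \<in> carrier_mat n n"
  shows "length (singular_values X) = n" "s \<in> set (singular_values X) \<Longrightarrow> s \<ge> 0"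
    "(\<Sum>s\<leftarrow>singular_values X. s\<^sup>2) = frob_sq n X"
    "(\<Sum>s\<leftarrow>singular_values X. s ^ 4) = frob_sq n (mat_adjoint X * X)"
proof -
  let ?P = "mat_adjoint X * X"
  have P: "?P \<in> carrier_mat n n" using X by auto
  obtain es where es: "char_poly ?P = (\<Prod>e\<leftarrow>es. [:- e, 1:])" "length es = n"
    using char_poly_factorized[OF P] by auto
  note ms = mset_singular_values[OF es(1)]
  have e: "e = complex_of_real (Re e) \<and> Re e \<ge> 0" if "e \<in> set es" for e
  proof -
    have "poly (char_poly ?P) e = 0"
      using that unfolding es(1) by (induction es) auto
    hence "eigenvalue ?P e" using eigenvalue_root_char_poly[OF P] by simp
    thus ?thesis using gram_eigenvalue_nonneg[OF X] by blast
  qed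
  show "length (singular_values X) = n"
    using mset_eq_length[OF ms] es(2) by simp
  show "s \<ge> 0" if "s \<in> set (singular_values X)"
    using that mset_eq_setD[OF ms] e by auto
  \<comment> \<open>The singular values are sorted and \<open>es\<close> is not, so sums are
    compared through multisets.\<close>
  have sl: "(\<Sum>s\<leftarrow>singular_values X. f s) = (\<Sum>e\<leftarrow>es. f (sqrt (Re e)))" for f :: "real \<Rightarrow> real"
  proof -
    have "(\<Sum>s\<leftarrow>singular_values X. f s) = sum_mset (image_mset f (mset (singular_values X)))"
      by (metis mset_map sum_mset_sum_list)
    also have "\<dots> = (\<Sum>e\<leftarrow>es. f (sqrt (Re e)))"
      unfolding ms by (metis (no_types, lifting) comp_apply list.map_comp map_cong mset_map sum_mset_sum_list)
    finally show ?thesis .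
  qed
  have of_real_sum_list: "complex_of_real (sum_list (map f es)) = (\<Sum>e\<leftarrow>es. complex_of_real (f e))" for f
    by (induction es) auto
  have "complex_of_real (\<Sum>e\<leftarrow>es. Re e) = (\<Sum>e\<leftarrow>es. e)"
    unfolding of_real_sum_list by (intro arg_cong[of _ _ sum_list] map_cong refl) (use e in metis)
  also have "\<dots> = mtrace n ?P" using traces_eq_power_sums_roots(1)[OF P es(1)] by simp
  also have "\<dots> = complex_of_real (frob_sq n X)"
    unfolding mtrace_def frob_sq_def
    by (subst sum.swap) (auto simp: gram_entry[OF X] complex_norm_square mult.commute simp del: index_mult_mat of_real_power intro!: sum.cong)
  finally have 1: "(\<Sum>e\<leftarrow>es. Re e) = frob_sq n X" using of_real_eq_iff by blast
  have "(\<Sum>s\<leftarrow>singular_values X. s\<^sup>2) = (\<Sum>e\<leftarrow>es. Re e)"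
    unfolding sl using e by (intro arg_cong[of _ _ sum_list] map_cong refl) auto
  thus "(\<Sum>s\<leftarrow>singular_values X. s\<^sup>2) = frob_sq n X" using 1 by simp
  have "complex_of_real (\<Sum>e\<leftarrow>es. (Re e)\<^sup>2) = (\<Sum>e\<leftarrow>es. e\<^sup>2)"
    unfolding of_real_sum_list by (intro arg_cong[of _ _ sum_list] map_cong refl) (use e in \<open>metis of_real_power\<close>)
  also have "\<dots> = mtrace n (?P * ?P)" using traces_eq_power_sums_roots(2)[OF P es(1)] by simp
  also have "\<dots> = (\<Sum>i<n. \<Sum>j<n. ?P $$ (i, j) * ?P $$ (j, i))"
    unfolding mtrace_def by (intro sum.cong refl mult_mat_entry[OF P P]) auto
  also have "\<dots> = (\<Sum>i<n. \<Sum>j<n. complex_of_real ((cmod (?P $$ (i, j)))\<^sup>2))"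
  proof (intro sum.cong refl)
    fix i j assume ij: "i \<in> {..<n}" "j \<in> {..<n}"
    have "?P $$ (j, i) = cnj (?P $$ (i, j))"
      using ij by (simp add: gram_entry[OF X] mult.commute del: index_mult_mat)
    thus "?P $$ (i, j) * ?P $$ (j, i) = complex_of_real ((cmod (?P $$ (i, j)))\<^sup>2)"
      using complex_norm_square by simp
  qed
  also have "\<dots> = complex_of_real (frob_sq n ?P)" unfolding frob_sq_def by simp
  finally have 2: "(\<Sum>e\<leftarrow>es. (Re e)\<^sup>2) = frob_sq n ?P" using of_real_eq_iff by blast
  have "(\<Sum>s\<leftarrow>singular_values X. s ^ 4) = (\<Sum>e\<leftarrow>es. (Re e)\<^sup>2)"
    unfolding sl
  proof (intro arg_cong[of _ _ sum_list] map_cong refl)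
    fix x assume "x \<in> set es"
    hence "(sqrt (Re x))\<^sup>2 = Re x" using e by auto
    moreover have "(sqrt (Re x)) ^ 4 = ((sqrt (Re x))\<^sup>2)\<^sup>2" by (simp add: power_mult[symmetric])
    ultimately show "(sqrt (Re x)) ^ 4 = (Re x)\<^sup>2" by simp
  qed
  thus "(\<Sum>s\<leftarrow>singular_values X. s ^ 4) = frob_sq n ?P" using 2 by simp
qed

section \<open>Power mean inequalities with their equality cases\<close>

lemma bernoulli_powr_gt:
  fixes x r :: real
  assumes "0 \<le> x" "1 < r" "x \<noteq> 1"
  shows "x powr r > 1 + r * (x - 1)"
proof (cases "x = 0")
  case False
  hence x: "x > 0" using assms by simp
  have der: "((\<lambda>t. t powr r) has_real_derivative r * t powr (r - 1)) (at t)" if "t > 0" for t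
    using that by (auto intro!: derivative_eq_intros)
  show ?thesis
  proof (cases "x > 1")
    case True
    \<comment> \<open>The mean value theorem gives a point strictly between 1 and \<open>x\<close>,
      so its power \<open>r - 1\<close> is strictly on one side of 1; the equality case later
      depends on this strictness.\<close>
    obtain z where z: "1 < z" "z < x" "x powr r - 1 powr r = (x - 1) * (r * z powr (r - 1))"
      using MVT2[OF True, of "\<lambda>t. t powr r" "\<lambda>t. r * t powr (r - 1)"] der by auto
    have "z powr (r - 1) > 1" using z assms by simp
    hence "(x - 1) * (r * z powr (r - 1)) > (x - 1) * (r * 1)"
      using True assms by (intro mult_strict_left_mono) auto
    thus ?thesis using z by (simp add: mult.commute)
  next
    case False
    hence lt: "x < 1" using assms by simp
    obtain z where z: "x < z" "z < 1" "1 powr r - x powr r = (1 - x) * (r * z powr (r - 1))"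
      using MVT2[OF lt, of "\<lambda>t. t powr r" "\<lambda>t. r * t powr (r - 1)"] der x by auto
    have "z powr (r - 1) < 1 powr (r - 1)" using z x assms by (intro powr_less_mono2) auto
    hence "(1 - x) * (r * z powr (r - 1)) < (1 - x) * (r * 1)"
      using lt assms by (intro mult_strict_left_mono) auto
    thus ?thesis using z by (simp add: algebra_simps)
  qed
qed (use assms in auto)

text \<open>The previous inequality for the base \<open>x powr r\<close> and the exponent
  \<open>1 / r\<close>.\<close>

lemma bernoulli_powr_less:
  fixes x r :: real
  assumes "0 \<le> x" "0 < r" "r < 1" "x \<noteq> 1"
  shows "x powr r < 1 + r * (x - 1)"
proof -
  have "1 + (1 / r) * (x powr r - 1) < (x powr r) powr (1 / r)" if "x \<noteq> 0"
    using that assms by (intro bernoulli_powr_gt) (auto simp: powr_eq_one_iff_gen)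
  moreover have "(x powr r) powr (1 / r) = x" using assms by (simp add: powr_powr)
  ultimately show ?thesis using assms by (cases "x = 0") (auto simp: field_simps)
qed

text \<open>Both lemmas compare \<open>\<Sum> s\<^sup>p\<close> with \<open>\<Sum> s\<^sup>2\<close>; multiplying by \<open>p - 2\<close> treats
  \<open>p > 2\<close> and \<open>p < 2\<close> at once.\<close>

lemma powr_sum_one_vs_square_sum:
  fixes p :: real and ss :: "real list"
  assumes p: "1 \<le> p" "p \<noteq> 2" and nn: "\<And>s. s \<in> set ss \<Longrightarrow> s \<ge> 0"
    and one: "(\<Sum>s\<leftarrow>ss. s powr p) = 1"
  shows "(p - 2) * ((\<Sum>s\<leftarrow>ss. s\<^sup>2) - 1) \<ge> 0"
    "(\<Sum>s\<leftarrow>ss. s\<^sup>2) = 1 \<Longrightarrow> (\<Sum>s\<leftarrow>ss. s ^ 4) = 1"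
proof -
  have le1: "s powr p \<le> 1" "s \<le> 1" if "s \<in> set ss" for s
  proof -
    show a: "s powr p \<le> 1" using that one by (subst one[symmetric], intro member_le_sum_list) auto
    show "s \<le> 1"
    proof (rule ccontr)
      assume "\<not> s \<le> 1"
      hence "1 powr p < s powr p" using p by (intro powr_less_mono2) auto
      thus False using a by simp
    qed
  qed
  have sgn: "(p - 2) * (s\<^sup>2 - s powr p) \<ge> 0" and str: "s\<^sup>2 = s powr p \<Longrightarrow> s = 0 \<or> s = 1"
    if s: "s \<in> set ss" for s
  proof -
    consider "s = 0" | "s = 1" | "0 < s" "s < 1" using nn[OF s] le1[OF s] by linarith
    note cs = this
    \<comment> \<open>For \<open>s\<close> strictly between 0 and 1 the power decreases strictly in
      the exponent, so \<open>s\<^sup>2 - s powr p\<close> has the sign of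
      \<open>p - 2\<close>.\<close>
    have "(p - 2) * (s\<^sup>2 - s powr p) > 0" if "0 < s" "s < 1"
    proof (cases "p > 2")
      case True
      hence "s powr p < s powr 2" using that by (intro powr_less_mono') auto
      thus ?thesis using that True by (simp add: powr_numeral)
    next
      case False
      hence "s powr 2 < s powr p" using that p by (intro powr_less_mono') auto
      thus ?thesis using that False p by (auto simp: powr_numeral intro!: mult_neg_neg)
    qed
    note pos = this
    show "(p - 2) * (s\<^sup>2 - s powr p) \<ge> 0"
      using pos by (cases rule: cs) (auto intro: less_imp_le)
    show "s = 0 \<or> s = 1" if "s\<^sup>2 = s powr p"
      using pos that by (cases rule: cs) auto
  qed
  have sm: "(p - 2) * ((\<Sum>s\<leftarrow>ss. s\<^sup>2) - (\<Sum>s\<leftarrow>ss. s powr p)) = (\<Sum>s\<leftarrow>ss. (p - 2) * (s\<^sup>2 - s powr p))"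
    by (simp add: sum_list_const_mult sum_list_subtractf)
  show "(p - 2) * ((\<Sum>s\<leftarrow>ss. s\<^sup>2) - 1) \<ge> 0"
    using sm sgn unfolding one by (auto intro!: sum_list_nonneg)
  assume "(\<Sum>s\<leftarrow>ss. s\<^sup>2) = 1"
  hence "(\<Sum>s\<leftarrow>ss. (p - 2) * (s\<^sup>2 - s powr p)) = 0" using sm one by simp
  hence "\<forall>x\<in>set (map (\<lambda>s. (p - 2) * (s\<^sup>2 - s powr p)) ss). x = 0"
    using sgn by (subst (asm) sum_list_nonneg_eq_0_iff) auto
  hence "\<And>s. s \<in> set ss \<Longrightarrow> s\<^sup>2 = s powr p" using p by auto
  with str have "\<And>s. s \<in> set ss \<Longrightarrow> s = 0 \<or> s = 1" by auto
  hence "\<And>s. s \<in> set ss \<Longrightarrow> s ^ 4 = s\<^sup>2" by fastforce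
  hence "(\<Sum>s\<leftarrow>ss. s ^ 4) = (\<Sum>s\<leftarrow>ss. s\<^sup>2)" by (intro arg_cong[of _ _ sum_list] map_cong) auto
  thus "(\<Sum>s\<leftarrow>ss. s ^ 4) = 1" using \<open>(\<Sum>s\<leftarrow>ss. s\<^sup>2) = 1\<close> by simp
qed

lemma powr_sum_length_vs_square_sum:
  fixes p :: real and ss :: "real list"
  assumes p: "1 \<le> p" "p \<noteq> 2" and nn: "\<And>s. s \<in> set ss \<Longrightarrow> s \<ge> 0"
    and len: "(\<Sum>s\<leftarrow>ss. s powr p) = length ss"
  shows "(p - 2) * (length ss - (\<Sum>s\<leftarrow>ss. s\<^sup>2)) \<ge> 0"
    "(\<Sum>s\<leftarrow>ss. s\<^sup>2) = length ss \<Longrightarrow> s \<in> set ss \<Longrightarrow> s = 1"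
proof -
  \<comment> \<open>Up to the factor \<open>p - 2\<close>, the gap between
    \<open>(s\<^sup>2) powr (p / 2)\<close> and its tangent at \<open>s\<^sup>2 = 1\<close>. Summed
    over the list, the power terms cancel by \<open>len\<close> and only the deviation of
    \<open>\<Sum> s\<^sup>2\<close> from the length remains.\<close>
  define g where "g s = (p - 2) * ((s powr p - 1) - (p / 2) * (s\<^sup>2 - 1))" for s
  have gpos: "g s > 0" if "s \<in> set ss" "s \<noteq> 1" for s
  proof -
    have s: "s \<ge> 0" using nn that by auto
    have eq: "(s\<^sup>2) powr (p / 2) = s powr p"
      using s powr_powr[of s 2 "p / 2"] by (cases "s = 0") (simp_all add: powr_numeral)
    have ne: "s\<^sup>2 \<noteq> 1" using s that(2) by (simp add: power2_eq_1_iff)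
    show ?thesis
    proof (cases "p > 2")
      case True
      have "(s\<^sup>2) powr (p / 2) > 1 + p / 2 * (s\<^sup>2 - 1)" using True ne by (intro bernoulli_powr_gt) auto
      thus ?thesis unfolding g_def using True eq by simp
    next
      case False
      have "(s\<^sup>2) powr (p / 2) < 1 + p / 2 * (s\<^sup>2 - 1)" using False p ne by (intro bernoulli_powr_less) auto
      thus ?thesis unfolding g_def using False p eq by (auto intro!: mult_neg_neg)
    qed
  qed
  have g: "g s \<ge> 0" if "s \<in> set ss" for s
    using gpos[OF that] by (cases "s = 1") (auto simp: g_def)
  have sm: "(\<Sum>s\<leftarrow>ss. g s) = (p - 2) * (((\<Sum>s\<leftarrow>ss. s powr p) - length ss) - (p / 2) * ((\<Sum>s\<leftarrow>ss. s\<^sup>2) - length ss))"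
  proof (induction ss)
    case (Cons a ss)
    have "sum_list (map g (a # ss)) = g a + (p - 2) * (((\<Sum>s\<leftarrow>ss. s powr p) - length ss)
        - (p / 2) * ((\<Sum>s\<leftarrow>ss. s\<^sup>2) - length ss))"
      by (simp only: list.map sum_list.Cons Cons.IH)
    also have "\<dots> = (p - 2) * (((\<Sum>s\<leftarrow>a # ss. s powr p) - length (a # ss))
        - (p / 2) * ((\<Sum>s\<leftarrow>a # ss. s\<^sup>2) - length (a # ss)))"
      by (simp add: g_def field_simps)
    finally show ?case .
  qed simp
  also have "\<dots> = (p / 2) * ((p - 2) * (length ss - (\<Sum>s\<leftarrow>ss. s\<^sup>2)))"
    unfolding len by (simp add: field_simps)
  finally have sm': "(\<Sum>s\<leftarrow>ss. g s) = (p / 2) * ((p - 2) * (length ss - (\<Sum>s\<leftarrow>ss. s\<^sup>2)))" .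
  have "(\<Sum>s\<leftarrow>ss. g s) \<ge> 0" using g by (auto intro!: sum_list_nonneg)
  thus "(p - 2) * (length ss - (\<Sum>s\<leftarrow>ss. s\<^sup>2)) \<ge> 0"
    using p zero_le_mult_iff[of "p / 2" "(p - 2) * (length ss - (\<Sum>s\<leftarrow>ss. s\<^sup>2))"] unfolding sm' by linarith
  assume "(\<Sum>s\<leftarrow>ss. s\<^sup>2) = length ss" "s \<in> set ss"
  hence "(\<Sum>s\<leftarrow>ss. g s) = 0" using sm' by simp
  hence "\<forall>x\<in>set (map g ss). x = 0"
    using g by (subst (asm) sum_list_nonneg_eq_0_iff) auto
  thus "s = 1" using gpos[of s] \<open>s \<in> set ss\<close> by force
qed

text \<open>Expanding the squared modulus of a minor gives two product terms, each summing to the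
  square of \<open>frob_sq n X\<close>, and a cross term. In terms of singular values the right side
  is \<open>2 * ((\<Sum> s\<^sup>2)\<^sup>2 - \<Sum> s ^ 4)\<close>, so the lemma measures the
  distance from rank one by two power sums.\<close>

lemma minors_square_sum:
  fixes X :: "complex mat"
  assumes X: "X \<in> carrier_mat n n"
  shows "(\<Sum>c<n. \<Sum>d<n. \<Sum>c'<n. \<Sum>d'<n.
      (cmod (X $$ (c, d) * X $$ (c', d') - X $$ (c', d) * X $$ (c, d')))\<^sup>2)
    = 2 * ((frob_sq n X)\<^sup>2 - frob_sq n (mat_adjoint X * X))"
proof -
  let ?x = "\<lambda>c d. X $$ (c, d)"
  let ?P = "mat_adjoint X * X"
  have ex: "(cmod (a - b))\<^sup>2 = (cmod a)\<^sup>2 + (cmod b)\<^sup>2 - 2 * Re (a * cnj b)" for a b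
    unfolding cmod_power2 by (simp add: power2_eq_square algebra_simps)
  have re: "r = Re z" if "complex_of_real r = cnj z" for r z
    using arg_cong[OF that, of Re] by simp
  have 1: "(\<Sum>c<n. \<Sum>d<n. \<Sum>c'<n. \<Sum>d'<n. (cmod (?x c d * ?x c' d'))\<^sup>2) = (frob_sq n X)\<^sup>2"
  proof -
    have "(\<Sum>c<n. \<Sum>d<n. \<Sum>c'<n. \<Sum>d'<n. (cmod (?x c d * ?x c' d'))\<^sup>2)
        = (\<Sum>c<n. \<Sum>d<n. (cmod (?x c d))\<^sup>2 * frob_sq n X)"
      by (simp add: frob_sq_def norm_mult power_mult_distrib sum_distrib_left)
    also have "\<dots> = frob_sq n X * frob_sq n X"
      unfolding sum_distrib_right[symmetric] by (simp only: frob_sq_def)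
    finally show ?thesis by (simp add: power2_eq_square)
  qed
  have 2: "(\<Sum>c<n. \<Sum>d<n. \<Sum>c'<n. \<Sum>d'<n. (cmod (?x c' d * ?x c d'))\<^sup>2)
      = (\<Sum>c<n. \<Sum>d<n. \<Sum>c'<n. \<Sum>d'<n. (cmod (?x c d * ?x c' d'))\<^sup>2)"
  proof -
    have "(\<Sum>c<n. \<Sum>d<n. \<Sum>c'<n. \<Sum>d'<n. (cmod (?x c' d * ?x c d'))\<^sup>2)
        = (\<Sum>c<n. \<Sum>c'<n. \<Sum>d<n. \<Sum>d'<n. (cmod (?x c' d * ?x c d'))\<^sup>2)"
      by (rule sum.cong[OF refl]) (rule sum.swap)
    also have "\<dots> = (\<Sum>c'<n. \<Sum>c<n. \<Sum>d<n. \<Sum>d'<n. (cmod (?x c' d * ?x c d'))\<^sup>2)"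
      by (rule sum.swap)
    also have "\<dots> = (\<Sum>c'<n. \<Sum>d<n. \<Sum>c<n. \<Sum>d'<n. (cmod (?x c' d * ?x c d'))\<^sup>2)"
      by (rule sum.cong[OF refl]) (rule sum.swap)
    finally show ?thesis .
  qed
  \<comment> \<open>For fixed columns \<open>d\<close> and \<open>d'\<close>, the cross terms summed
    over both rows form the squared modulus of the entry \<open>(d, d')\<close> of the Gram
    matrix.\<close>
  have "complex_of_real (frob_sq n ?P) = (\<Sum>d<n. \<Sum>d'<n. ?P $$ (d, d') * cnj (?P $$ (d, d')))"
    unfolding frob_sq_def by (simp add: complex_norm_square del: of_real_power)
  also have "\<dots> = (\<Sum>d<n. \<Sum>d'<n. \<Sum>c<n. \<Sum>c'<n. cnj (?x c d) * ?x c d' * (?x c' d * cnj (?x c' d')))"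
    by (intro sum.cong refl) (simp add: gram_entry[OF X] sum_product del: index_mult_mat)
  also have "\<dots> = (\<Sum>d<n. \<Sum>c<n. \<Sum>d'<n. \<Sum>c'<n. cnj (?x c d) * ?x c d' * (?x c' d * cnj (?x c' d')))"
    by (rule sum.cong[OF refl]) (rule sum.swap)
  also have "\<dots> = (\<Sum>c<n. \<Sum>d<n. \<Sum>d'<n. \<Sum>c'<n. cnj (?x c d) * ?x c d' * (?x c' d * cnj (?x c' d')))"
    by (rule sum.swap)
  also have "\<dots> = (\<Sum>c<n. \<Sum>d<n. \<Sum>c'<n. \<Sum>d'<n. cnj (?x c d) * ?x c d' * (?x c' d * cnj (?x c' d')))"
    by (rule sum.cong[OF refl], rule sum.cong[OF refl], rule sum.swap)
  also have "\<dots> = (\<Sum>c<n. \<Sum>d<n. \<Sum>c'<n. \<Sum>d'<n. cnj ((?x c d * ?x c' d') * cnj (?x c' d * ?x c d')))"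
    by (intro sum.cong refl) (simp add: mult_ac)
  also have "\<dots> = cnj (\<Sum>c<n. \<Sum>d<n. \<Sum>c'<n. \<Sum>d'<n. (?x c d * ?x c' d') * cnj (?x c' d * ?x c d'))"
    by simp
  finally have "frob_sq n ?P = Re (\<Sum>c<n. \<Sum>d<n. \<Sum>c'<n. \<Sum>d'<n. (?x c d * ?x c' d') * cnj (?x c' d * ?x c d'))"
    by (rule re)
  hence 3: "(\<Sum>c<n. \<Sum>d<n. \<Sum>c'<n. \<Sum>d'<n. 2 * Re ((?x c d * ?x c' d') * cnj (?x c' d * ?x c d'))) = 2 * frob_sq n ?P"
    by (simp only: Re_sum sum_distrib_left)
  show ?thesis
    by (simp only: ex sum.distrib sum_subtractf 3 2 1) (simp only: mult_2 algebra_simps)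
qed

text \<open>Both power sums being 1, the identity above makes all 2 by 2 minors vanish, and a
  nonzero entry as pivot then factors the matrix.\<close>

lemma rank_one_if_gram_extremal:
  fixes X :: "complex mat"
  assumes X: "X \<in> carrier_mat n n" and f: "frob_sq n X = 1" "frob_sq n (mat_adjoint X * X) = 1"
  shows "\<exists>u v. (\<forall>c<n. \<forall>d<n. X $$ (c, d) = u c * v d) \<and>
    (\<Sum>c<n. (cmod (u c))\<^sup>2) = 1 \<and> (\<Sum>d<n. (cmod (v d))\<^sup>2) = 1"
proof -
  let ?x = "\<lambda>c d. X $$ (c, d)"
  have "(\<Sum>c<n. \<Sum>d<n. \<Sum>c'<n. \<Sum>d'<n. (cmod (?x c d * ?x c' d' - ?x c' d * ?x c d'))\<^sup>2) = 0"
    unfolding minors_square_sum[OF X] f by simp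
  hence mn: "?x c d * ?x c' d' = ?x c' d * ?x c d'" if "c < n" "d < n" "c' < n" "d' < n" for c d c' d'
    using that by (subst (asm) sum_nonneg_eq_0_iff; (auto intro!: sum_nonneg)?)+
  have "\<exists>c0<n. \<exists>d0<n. ?x c0 d0 \<noteq> 0"
  proof (rule ccontr)
    assume "\<not> ?thesis"
    hence "frob_sq n X = 0" unfolding frob_sq_def by simp
    thus False using f by simp
  qed
  then obtain c0 d0 where cd: "c0 < n" "d0 < n" "?x c0 d0 \<noteq> 0" by auto
  \<comment> \<open>The squared length of the pivot column. Moving \<open>sqrt r\<close> to the
    other factor makes \<open>u\<close> a unit vector; then \<open>v\<close> is one as well, because
    the Frobenius norm of a rank one matrix is the product of the two lengths.\<close>
  define r where "r = (\<Sum>c<n. (cmod (?x c d0))\<^sup>2)"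
  have r: "r > 0" unfolding r_def using cd by (auto intro!: sum_pos2)
  define u where "u c = ?x c d0 / sqrt r" for c
  define v where "v d = sqrt r * ?x c0 d / ?x c0 d0" for d
  have X': "X $$ (c, d) = u c * v d" if "c < n" "d < n" for c d
    using mn[of c d0 c0 d] that cd r by (simp add: u_def v_def field_simps)
  have u: "(\<Sum>c<n. (cmod (u c))\<^sup>2) = 1"
    using r by (simp add: u_def norm_divide power_divide flip: sum_divide_distrib r_def)
  have "1 = (\<Sum>c<n. \<Sum>d<n. (cmod (u c))\<^sup>2 * (cmod (v d))\<^sup>2)"
    unfolding f(1)[symmetric] frob_sq_def by (auto simp: X' norm_mult power_mult_distrib intro!: sum.cong)
  also have "\<dots> = (\<Sum>d<n. (cmod (v d))\<^sup>2)"
    unfolding sum_product[symmetric] u by simp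
  finally show ?thesis using X' u by (intro exI[of _ u] exI[of _ v]) auto
qed

text \<open>The squared Frobenius distance of the Gram matrix \<open>P\<close> from the identity is
  the squared norm of \<open>P\<close>, minus twice the real part of its trace, plus
  \<open>n\<close>. This is \<open>n - 2 n + n = 0\<close>.\<close>

lemma unitary_if_gram_extremal:
  fixes X :: "complex mat"
  assumes X: "X \<in> carrier_mat n n" and f: "frob_sq n X = n" "frob_sq n (mat_adjoint X * X) = n"
  shows "unitary_mat n X"
proof -
  let ?P = "mat_adjoint X * X"
  have P: "?P \<in> carrier_mat n n" using X by (rule gram_carrier)
  have ex: "(cmod (a - (if b then 1 else 0)))\<^sup>2 = (cmod a)\<^sup>2 + (if b then 1 - 2 * Re a else 0)" for a b
    unfolding cmod_power2 by (simp add: power2_eq_square algebra_simps)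
  have "(\<Sum>i<n. ?P $$ (i, i)) = complex_of_real (frob_sq n X)"
    unfolding frob_sq_def
    by (subst sum.swap) (auto simp: gram_entry[OF X] complex_norm_square mult.commute simp del: index_mult_mat of_real_power intro!: sum.cong)
  hence "Re (\<Sum>i<n. ?P $$ (i, i)) = n" using f by simp
  hence tr: "(\<Sum>i<n. Re (?P $$ (i, i))) = n" by (simp del: index_mult_mat)
  have "(\<Sum>i<n. \<Sum>j<n. (cmod (?P $$ (i, j) - (if j = i then 1 else 0)))\<^sup>2)
      = frob_sq n ?P + (\<Sum>i<n. 1 - 2 * Re (?P $$ (i, i)))"
    unfolding ex frob_sq_def by (simp add: sum.distrib del: index_mult_mat)
  also have "\<dots> = 0" using f tr by (simp add: sum_subtractf flip: sum_distrib_left del: index_mult_mat)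
  finally have z: "(\<Sum>i<n. \<Sum>j<n. (cmod (?P $$ (i, j) - (if j = i then 1 else 0)))\<^sup>2) = 0" .
  have "?P $$ (i, j) = (if j = i then 1 else 0)" if "i < n" "j < n" for i j
    using z that by (subst (asm) sum_nonneg_eq_0_iff; (auto intro!: sum_nonneg simp del: index_mult_mat)?)+
  hence "?P = 1\<^sub>m n" using P by (intro eq_matI) (auto simp del: index_mult_mat)
  moreover from this have "X * mat_adjoint X = 1\<^sub>m n"
    by (rule mat_mult_left_right_inverse[OF mat_adjoint_carrier[OF X] X])
  ultimately show ?thesis unfolding unitary_mat_def using X by simp
qed

subsection \<open>Orthonormal frames of rank one matrices\<close>

lemma schatten_norm_powr:
  assumes "p > 0"
  shows "(\<Sum>s\<leftarrow>singular_values X. s powr p) = schatten_norm p X powr p"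
proof -
  have "(\<Sum>s\<leftarrow>singular_values X. s powr p) \<ge> 0" by (intro sum_list_nonneg) auto
  thus ?thesis unfolding schatten_norm_def using assms by (simp add: powr_powr)
qed

section \<open>Orthonormal systems and Parseval's identity\<close>

lemma unitary_mat_columns:
  assumes "unitary_mat n U" "i < n" "j < n"
  shows "(\<Sum>c<n. cnj (U $$ (c, i)) * U $$ (c, j)) = (if i = j then 1 else 0)"
proof -
  have U: "U \<in> carrier_mat n n" and e: "mat_adjoint U * U = 1\<^sub>m n" using assms by (auto simp: unitary_mat_def)
  show ?thesis using gram_entry[OF U assms(2,3)] assms(2,3) unfolding e by auto
qed

lemma unitary_mat_adjoint: "unitary_mat n U \<Longrightarrow> unitary_mat n (mat_adjoint U)"
  unfolding unitary_mat_def by (simp add: mat_adjoint_adjoint)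

lemma unitary_mat_rows:
  assumes "unitary_mat n U" "i < n" "j < n"
  shows "(\<Sum>c<n. U $$ (i, c) * cnj (U $$ (j, c))) = (if i = j then 1 else 0)"
proof -
  have U: "U \<in> carrier_mat n n" using assms by (auto simp: unitary_mat_def)
  show ?thesis using unitary_mat_columns[OF unitary_mat_adjoint[OF assms(1)] assms(2,3)] assms(2,3)
    by (simp add: mat_adjoint_entry[OF U])
qed

lemma unitary_matI:
  assumes U: "U \<in> carrier_mat n n"
    and "\<And>i j. i < n \<Longrightarrow> j < n \<Longrightarrow> (\<Sum>c<n. cnj (U $$ (c, i)) * U $$ (c, j)) = (if i = j then 1 else 0)"
  shows "unitary_mat n U"
proof -
  have 1: "mat_adjoint U * U = 1\<^sub>m n"
    using gram_carrier[OF U] by (intro eq_matI) (auto simp: gram_entry[OF U] assms simp del: index_mult_mat)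
  moreover have "U * mat_adjoint U = 1\<^sub>m n"
    by (rule mat_mult_left_right_inverse[OF mat_adjoint_carrier[OF U] U 1])
  ultimately show ?thesis using U unfolding unitary_mat_def by simp
qed

text \<open>A square matrix with orthonormal columns has orthonormal rows. The frame argument yields
  a resolution of the identity, and this turns it into orthonormality of the frame vectors.\<close>

lemma orthonormal_dual:
  fixes w :: "nat \<Rightarrow> nat \<Rightarrow> complex"
  assumes "\<And>d d'. d < n \<Longrightarrow> d' < n \<Longrightarrow> (\<Sum>b<n. cnj (w b d) * w b d') = (if d = d' then 1 else 0)"
    and "b < n" "b' < n"
  shows "(\<Sum>d<n. cnj (w b d) * w b' d) = (if b = b' then 1 else 0)"
proof -
  have "unitary_mat n (mat n n (\<lambda>(b, d). w b d))"
    by (rule unitary_matI) (auto simp: assms(1))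
  from unitary_mat_rows[OF this assms(3,2)] show ?thesis
    using assms(2,3) by (auto simp: mult.commute)
qed

lemma parseval_sum:
  fixes \<chi> :: "'q \<Rightarrow> nat \<Rightarrow> complex"
  assumes "\<And>b b'. b < N \<Longrightarrow> b' < N \<Longrightarrow>
      (\<Sum>q\<in>Q. cnj (\<chi> q b) * \<chi> q b') = (if b = b' then of_nat (card Q) else 0)"
  shows "(\<Sum>q\<in>Q. cnj (\<Sum>b<N. \<chi> q b * f b) * (\<Sum>b<N. \<chi> q b * g b))
    = of_nat (card Q) * (\<Sum>b<N. cnj (f b) * g b)"
proof -
  have "(\<Sum>q\<in>Q. cnj (\<Sum>b<N. \<chi> q b * f b) * (\<Sum>b<N. \<chi> q b * g b))
      = (\<Sum>q\<in>Q. \<Sum>b<N. \<Sum>b'<N. cnj (f b) * g b' * (cnj (\<chi> q b) * \<chi> q b'))"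
    unfolding cnj_sum sum_product by (simp add: mult_ac)
  also have "\<dots> = (\<Sum>b<N. \<Sum>b'<N. \<Sum>q\<in>Q. cnj (f b) * g b' * (cnj (\<chi> q b) * \<chi> q b'))"
    by (subst sum.swap, rule sum.cong[OF refl], rule sum.swap)
  also have "\<dots> = (\<Sum>b<N. \<Sum>b'<N. cnj (f b) * g b' * (if b = b' then of_nat (card Q) else 0))"
    by (intro sum.cong refl) (simp add: assms flip: sum_distrib_left)
  also have "\<dots> = (\<Sum>b<N. cnj (f b) * g b * of_nat (card Q))"
    by (intro sum.cong refl) (simp add: if_distrib cong: if_cong)
  finally show ?thesis by (simp add: sum_distrib_left mult_ac)
qed

text \<open>Averaging over the family \<open>T q\<close> gives \<open>\<Sum>\<^sub>q |T q|\<^sup>2 = card Q \<cdot> \<Sum>\<^sub>b |F b|\<^sup>2\<close> for the Frobenius norm. For \<open>p > 2\<close> the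
  hypotheses on the Schatten norms force \<open>|F b|\<^sup>2 \<ge> 1\<close> and \<open>|T q|\<^sup>2 \<le> N\<close>, for \<open>p < 2\<close> the reverse,
  so equality holds throughout: each \<open>F b\<close> has rank one and each \<open>T q\<close> is unitary.\<close>

lemma orthonormal_rank_one_frame:
  fixes F :: "nat \<Rightarrow> complex mat" and \<chi> :: "'q \<Rightarrow> nat \<Rightarrow> complex"
  assumes p: "1 \<le> p" "p \<noteq> 2" and Q: "finite Q" "Q \<noteq> {}"
    and orth: "\<And>b b'. b < N \<Longrightarrow> b' < N \<Longrightarrow>
      (\<Sum>q\<in>Q. cnj (\<chi> q b) * \<chi> q b') = (if b = b' then of_nat (card Q) else 0)"
    and F: "\<And>b. b < N \<Longrightarrow> F b \<in> carrier_mat N N" "\<And>b. b < N \<Longrightarrow> schatten_norm p (F b) = 1"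
    and T: "\<And>q. q \<in> Q \<Longrightarrow> T q \<in> carrier_mat N N" "\<And>q. q \<in> Q \<Longrightarrow> schatten_norm p (T q) = real N powr (1 / p)"
    and TF: "\<And>q c d. q \<in> Q \<Longrightarrow> c < N \<Longrightarrow> d < N \<Longrightarrow> T q $$ (c, d) = (\<Sum>b<N. \<chi> q b * F b $$ (c, d))"
  shows "\<exists>u v. (\<forall>b<N. \<forall>c<N. \<forall>d<N. F b $$ (c, d) = u b c * v b d) \<and>
    (\<forall>b<N. \<forall>b'<N. (\<Sum>c<N. cnj (u b c) * u b' c) = (if b = b' then 1 else 0)) \<and>
    (\<forall>b<N. \<forall>b'<N. (\<Sum>c<N. cnj (v b c) * v b' c) = (if b = b' then 1 else 0))"
proof -
  let ?k = "card Q"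
  have k: "?k > 0" using Q by (simp add: card_gt_0_iff)
  have p0: "p > 0" using p by simp
  have Fp: "(\<Sum>s\<leftarrow>singular_values (F b). s powr p) = 1" if "b < N" for b
    using schatten_norm_powr[OF p0] F(2)[OF that] by simp
  have Tp: "(\<Sum>s\<leftarrow>singular_values (T q). s powr p) = length (singular_values (T q))" if "q \<in> Q" for q
    using schatten_norm_powr[OF p0] T(2)[OF that] p0 singular_values_gram(1)[OF T(1)[OF that]] by (simp add: powr_powr)
  have Fge: "(p - 2) * (frob_sq N (F b) - 1) \<ge> 0" if "b < N" for b
    using powr_sum_one_vs_square_sum(1)[OF p _ Fp[OF that]] singular_values_gram[OF F(1)[OF that]] by simp
  have Tle: "(p - 2) * (real N - frob_sq N (T q)) \<ge> 0" if "q \<in> Q" for q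
    using powr_sum_length_vs_square_sum(1)[OF p _ Tp[OF that]] singular_values_gram[OF T(1)[OF that]] by simp
  have par: "(\<Sum>q\<in>Q. cnj (T q $$ (c, d)) * T q $$ (c', d')) = of_nat ?k * (\<Sum>b<N. cnj (F b $$ (c, d)) * F b $$ (c', d'))"
    if "c < N" "d < N" "c' < N" "d' < N" for c d c' d'
    using parseval_sum[OF orth, where f = "\<lambda>b. F b $$ (c, d)" and g = "\<lambda>b. F b $$ (c', d')"] that by (simp add: TF)
  have par_norm: "(\<Sum>q\<in>Q. (cmod (T q $$ (c, d)))\<^sup>2) = ?k * (\<Sum>b<N. (cmod (F b $$ (c, d)))\<^sup>2)"
    if "c < N" "d < N" for c d
  proof -
    have "complex_of_real (\<Sum>q\<in>Q. (cmod (T q $$ (c, d)))\<^sup>2) = complex_of_real (?k * (\<Sum>b<N. (cmod (F b $$ (c, d)))\<^sup>2))"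
      using par[OF that that] by (simp add: complex_norm_square mult.commute del: of_real_power)
    thus ?thesis using of_real_eq_iff by blast
  qed
  have "(\<Sum>q\<in>Q. frob_sq N (T q)) = (\<Sum>c<N. \<Sum>d<N. \<Sum>q\<in>Q. (cmod (T q $$ (c, d)))\<^sup>2)"
    unfolding frob_sq_def by (subst sum.swap, rule sum.cong[OF refl], rule sum.swap)
  also have "\<dots> = ?k * (\<Sum>c<N. \<Sum>d<N. \<Sum>b<N. (cmod (F b $$ (c, d)))\<^sup>2)"
    unfolding sum_distrib_left by (intro sum.cong refl) (simp add: par_norm sum_distrib_left)
  also have "(\<Sum>c<N. \<Sum>d<N. \<Sum>b<N. (cmod (F b $$ (c, d)))\<^sup>2) = (\<Sum>b<N. frob_sq N (F b))"
    unfolding frob_sq_def by (subst (2) sum.swap, rule sum.cong[OF refl], rule sum.swap)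
  finally have tot: "(\<Sum>q\<in>Q. frob_sq N (T q)) = ?k * (\<Sum>b<N. frob_sq N (F b))" .
  \<comment> \<open>By \<open>tot\<close> these two totals are negatives of each other, while
    \<open>Tle\<close> and \<open>Fge\<close> make both nonnegative. Hence both vanish, and so does
    each of their terms.\<close>
  have "(\<Sum>q\<in>Q. (p - 2) * (real N - frob_sq N (T q))) = - (?k * (\<Sum>b<N. (p - 2) * (frob_sq N (F b) - 1)))"
    by (simp add: sum_subtractf tot flip: sum_distrib_left) (simp add: algebra_simps)
  moreover have "(\<Sum>q\<in>Q. (p - 2) * (real N - frob_sq N (T q))) \<ge> 0" using Tle by (intro sum_nonneg) auto
  moreover have "?k * (\<Sum>b<N. (p - 2) * (frob_sq N (F b) - 1)) \<ge> 0"
    by (rule mult_nonneg_nonneg[OF of_nat_0_le_iff], rule sum_nonneg) (simp only: lessThan_iff Fge)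
  ultimately have "(\<Sum>q\<in>Q. (p - 2) * (real N - frob_sq N (T q))) = 0"
    "?k * (\<Sum>b<N. (p - 2) * (frob_sq N (F b) - 1)) = 0"
    by linarith+
  hence z: "(\<Sum>q\<in>Q. (p - 2) * (real N - frob_sq N (T q))) = 0" "(\<Sum>b<N. (p - 2) * (frob_sq N (F b) - 1)) = 0"
    using k by auto
  have F1: "frob_sq N (F b) = 1" if "b < N" for b
    using z(2) Fge that p by (subst (asm) sum_nonneg_eq_0_iff) auto
  have T1: "frob_sq N (T q) = real N" if "q \<in> Q" for q
    using z(1) Tle that p Q by (subst (asm) sum_nonneg_eq_0_iff) auto
  have "\<exists>u v. (\<forall>c<N. \<forall>d<N. F b $$ (c, d) = u c * v d) \<and>
      (\<Sum>c<N. (cmod (u c))\<^sup>2) = 1 \<and> (\<Sum>d<N. (cmod (v d))\<^sup>2) = 1" if b: "b < N" for b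
    using powr_sum_one_vs_square_sum(2)[OF p _ Fp[OF b]] singular_values_gram[OF F(1)[OF b]] F1[OF b]
    by (intro rank_one_if_gram_extremal[OF F(1)[OF b]]) auto
  then obtain u v where uv: "\<And>b c d. b < N \<Longrightarrow> c < N \<Longrightarrow> d < N \<Longrightarrow> F b $$ (c, d) = u b c * v b d"
    "\<And>b. b < N \<Longrightarrow> (\<Sum>c<N. (cmod (u b c))\<^sup>2) = 1" "\<And>b. b < N \<Longrightarrow> (\<Sum>d<N. (cmod (v b d))\<^sup>2) = 1"
    by metis
  have nrm: "(\<Sum>c<N. cnj (w c) * w c) = 1" if "(\<Sum>c<N. (cmod (w c))\<^sup>2) = 1" for w :: "nat \<Rightarrow> complex"
  proof -
    have "(\<Sum>c<N. cnj (w c) * w c) = complex_of_real (\<Sum>c<N. (cmod (w c))\<^sup>2)"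
      by (simp add: complex_norm_square mult.commute del: of_real_power)
    thus ?thesis using that by simp
  qed
  have unit: "unitary_mat N (T q)" if q: "q \<in> Q" for q
  proof (rule unitary_if_gram_extremal[OF T(1)[OF q] T1[OF q]])
    note sv = singular_values_gram[OF T(1)[OF q]]
    have s1: "s = 1" if "s \<in> set (singular_values (T q))" for s
      using powr_sum_length_vs_square_sum(2)[OF p _ Tp[OF q] _ that] sv T1[OF q] by simp
    have "(\<Sum>s\<leftarrow>singular_values (T q). s ^ 4) = (\<Sum>s\<leftarrow>singular_values (T q). 1)"
      by (intro arg_cong[of _ _ sum_list] map_cong refl) (simp add: s1[THEN arg_cong, of _ "\<lambda>s. s ^ 4"])
    thus "frob_sq N (mat_adjoint (T q) * T q) = real N" using sv by (simp add: sum_list_triv)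
  qed
  \<comment> \<open>Averaging \<open>mat_adjoint (T q) * T q = 1\<^sub>m N\<close> over
    \<open>q\<close> and applying Parseval gives that the Gram matrices of the \<open>F b\<close>
    add up to the identity. As \<open>u b\<close> is a unit vector, the Gram matrix of
    \<open>F b\<close> has the entries \<open>cnj (v b d) * v b d'\<close>.\<close>
  have vd: "(\<Sum>b<N. cnj (v b d) * v b d') = (if d = d' then 1 else 0)" if d: "d < N" "d' < N" for d d'
  proof -
    have "of_nat ?k * (\<Sum>b<N. cnj (v b d) * v b d')
        = of_nat ?k * (\<Sum>b<N. \<Sum>c<N. cnj (u b c) * u b c * (cnj (v b d) * v b d'))"
      by (simp add: nrm uv(2) flip: sum_distrib_right)
    also have "\<dots> = of_nat ?k * (\<Sum>b<N. \<Sum>c<N. cnj (F b $$ (c, d)) * F b $$ (c, d'))"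
      using d by (intro arg_cong[of _ _ "\<lambda>z. of_nat ?k * z"] sum.cong refl) (simp add: uv(1) mult_ac)
    also have "\<dots> = (\<Sum>c<N. of_nat ?k * (\<Sum>b<N. cnj (F b $$ (c, d)) * F b $$ (c, d')))"
      by (subst sum.swap) (simp add: sum_distrib_left)
    also have "\<dots> = (\<Sum>c<N. \<Sum>q\<in>Q. cnj (T q $$ (c, d)) * T q $$ (c, d'))"
      using d by (intro sum.cong refl) (simp add: par)
    also have "\<dots> = (\<Sum>q\<in>Q. \<Sum>c<N. cnj (T q $$ (c, d)) * T q $$ (c, d'))" by (rule sum.swap)
    also have "\<dots> = of_nat ?k * (if d = d' then 1 else 0)"
      by (simp add: unitary_mat_columns[OF unit d])
    finally show ?thesis using k by (auto split: if_splits)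
  qed
  \<comment> \<open>The same with \<open>T q * mat_adjoint (T q)\<close> and the unit vectors
    \<open>v b\<close>.\<close>
  have ud: "(\<Sum>b<N. cnj (u b c) * u b c') = (if c = c' then 1 else 0)" if c: "c < N" "c' < N" for c c'
  proof -
    have "of_nat ?k * (\<Sum>b<N. cnj (u b c) * u b c')
        = of_nat ?k * (\<Sum>b<N. \<Sum>d<N. cnj (v b d) * v b d * (cnj (u b c) * u b c'))"
      by (simp add: nrm uv(3) flip: sum_distrib_right)
    also have "\<dots> = of_nat ?k * (\<Sum>b<N. \<Sum>d<N. cnj (F b $$ (c, d)) * F b $$ (c', d))"
      using c by (intro arg_cong[of _ _ "\<lambda>z. of_nat ?k * z"] sum.cong refl) (simp add: uv(1) mult_ac)
    also have "\<dots> = (\<Sum>d<N. of_nat ?k * (\<Sum>b<N. cnj (F b $$ (c, d)) * F b $$ (c', d)))"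
      by (subst sum.swap) (simp add: sum_distrib_left)
    also have "\<dots> = (\<Sum>d<N. \<Sum>q\<in>Q. cnj (T q $$ (c, d)) * T q $$ (c', d))"
      using c by (intro sum.cong refl) (simp add: par)
    also have "\<dots> = (\<Sum>q\<in>Q. \<Sum>d<N. T q $$ (c', d) * cnj (T q $$ (c, d)))"
      by (subst sum.swap) (simp add: mult.commute)
    also have "\<dots> = of_nat ?k * (if c = c' then 1 else 0)"
      by (simp add: unitary_mat_rows[OF unit c(2,1)])
    finally show ?thesis using k by (auto split: if_splits)
  qed
  have "(\<Sum>c<N. cnj (u b c) * u b' c) = (if b = b' then 1 else 0)"
    "(\<Sum>c<N. cnj (v b c) * v b' c) = (if b = b' then 1 else 0)" if "b < N" "b' < N" for b b'
    using orthonormal_dual[OF ud that] orthonormal_dual[OF vd that] by auto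
  thus ?thesis using uv(1) by (intro exI[of _ u] exI[of _ v] conjI allI impI) auto
qed

subsection \<open>Kronecker products\<close>

lemma kronecker_carrier:
  "A \<in> carrier_mat a b \<Longrightarrow> B \<in> carrier_mat c d \<Longrightarrow> kronecker A B \<in> carrier_mat (a * c) (b * d)"
  unfolding kronecker_def by auto

lemma mult_add_less_mult:
  fixes a b c d :: nat
  assumes "a < c" "b < d"
  shows "a * d + b < c * d"
proof -
  have "a * d + b < (a + 1) * d" using assms by simp
  also have "\<dots> \<le> c * d" using assms by (intro mult_right_mono) auto
  finally show ?thesis .
qed

text \<open>Position in \<open>{..<\<Prod>s. n s}\<close> of the basis tensor with multi-index \<open>i\<close>.\<close>

fun enc :: "(nat \<Rightarrow> nat) \<Rightarrow> nat \<Rightarrow> (nat \<Rightarrow> nat) \<Rightarrow> nat" where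
  "enc n 0 i = 0"
| "enc n (Suc m) i = enc n m i * n (Suc m) + i (Suc m)"

lemma enc_less:
  assumes "\<And>s. s \<in> {1..m} \<Longrightarrow> i s < n s"
  shows "enc n m i < (\<Prod>s=1..m. n s)"
  using assms
proof (induction m)
  case (Suc m)
  have "enc n m i < (\<Prod>s=1..m. n s)" using Suc.prems by (intro Suc.IH) auto
  moreover have "i (Suc m) < n (Suc m)" using Suc.prems by simp
  ultimately show ?case by (simp add: mult_add_less_mult)
qed simp

lemma enc_inject:
  assumes "\<And>s. s \<in> {1..m} \<Longrightarrow> i s < n s" "\<And>s. s \<in> {1..m} \<Longrightarrow> j s < n s" "enc n m i = enc n m j"
  shows "s \<in> {1..m} \<Longrightarrow> i s = j s"
  using assms
proof (induction m arbitrary: s)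
  case (Suc m)
  have l: "i (Suc m) < n (Suc m)" "j (Suc m) < n (Suc m)" using Suc.prems by auto
  have eq: "enc n m i * n (Suc m) + i (Suc m) = enc n m j * n (Suc m) + j (Suc m)" using Suc.prems by simp
  have "i (Suc m) = j (Suc m)" using arg_cong[OF eq, of "\<lambda>x. x mod n (Suc m)"] l by simp
  moreover from this have "enc n m i = enc n m j" using eq l by simp
  hence "s \<in> {1..m} \<Longrightarrow> i s = j s" using Suc.prems by (intro Suc.IH) auto
  ultimately show ?case using Suc.prems(1) by (cases "s = Suc m") auto
qed simp

lemma kronecker_fam_carrier:
  assumes "\<And>s. s \<in> {1..m} \<Longrightarrow> A s \<in> carrier_mat (n s) (n s)"
  shows "kronecker_fam A m \<in> carrier_mat (\<Prod>s=1..m. n s) (\<Prod>s=1..m. n s)"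
  using assms by (induction m) (auto intro!: kronecker_carrier)

text \<open>The passage from the recursive definition to multi-indices: algebraic identities for
  \<open>kronecker_fam\<close> reduce to identities between products of entries.\<close>

lemma kronecker_fam_entry:
  assumes "\<And>s. s \<in> {1..m} \<Longrightarrow> A s \<in> carrier_mat (n s) (n s)"
    and "\<And>s. s \<in> {1..m} \<Longrightarrow> i s < n s" "\<And>s. s \<in> {1..m} \<Longrightarrow> j s < n s"
  shows "kronecker_fam A m $$ (enc n m i, enc n m j) = (\<Prod>s=1..m. A s $$ (i s, j s))"
  using assms
proof (induction m)
  case (Suc m)
  have IH: "kronecker_fam A m $$ (enc n m i, enc n m j) = (\<Prod>s=1..m. A s $$ (i s, j s))"
    using Suc.prems by (intro Suc.IH) auto
  have K: "kronecker_fam A m \<in> carrier_mat (\<Prod>s=1..m. n s) (\<Prod>s=1..m. n s)"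
    using Suc.prems by (intro kronecker_fam_carrier) auto
  have A: "A (Suc m) \<in> carrier_mat (n (Suc m)) (n (Suc m))" "i (Suc m) < n (Suc m)" "j (Suc m) < n (Suc m)"
    using Suc.prems by auto
  have l: "enc n m i < (\<Prod>s=1..m. n s)" "enc n m j < (\<Prod>s=1..m. n s)"
    by (rule enc_less, use Suc.prems in simp)+
  have "kronecker_fam A (Suc m) $$ (enc n (Suc m) i, enc n (Suc m) j)
      = kronecker_fam A m $$ (enc n m i, enc n m j) * A (Suc m) $$ (i (Suc m), j (Suc m))"
    using K A mult_add_less_mult[OF l(1) A(2)] mult_add_less_mult[OF l(2) A(3)] by (simp add: kronecker_def)
  thus ?case using IH by simp
qed simp

section \<open>Linear maps and matrix units\<close>

definition diag_fun :: "nat \<Rightarrow> (nat \<Rightarrow> 'a::zero) \<Rightarrow> 'a mat" where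
  "diag_fun n f = mat n n (\<lambda>(i, j). if i = j then f i else 0)"

definition unit_mat :: "nat \<Rightarrow> nat \<Rightarrow> nat \<Rightarrow> complex mat" where
  "unit_mat n a b = mat n n (\<lambda>(i, j). if i = a \<and> j = b then 1 else 0)"

text \<open>Linearity is available for two summands only, so the expansion in matrix units is an
  induction over the set of positions at which \<open>X\<close> has been filled in.\<close>

lemma linear_on_mats_entry:
  assumes lin: "linear_on_mats n \<phi>" and X: "X \<in> carrier_mat n n" and cd: "c < n" "d < n"
  shows "\<phi> X $$ (c, d) = (\<Sum>a<n. \<Sum>b<n. X $$ (a, b) * \<phi> (unit_mat n a b) $$ (c, d))"
proof -
  define Y where "Y S = mat n n (\<lambda>(i, j). if (i, j) \<in> S then X $$ (i, j) else 0)" for S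
  have Y: "Y S \<in> carrier_mat n n" for S unfolding Y_def by simp
  have E: "unit_mat n a b \<in> carrier_mat n n" for a b unfolding unit_mat_def by simp
  have car: "\<phi> Z \<in> carrier_mat n n" if "Z \<in> carrier_mat n n" for Z
    using lin that unfolding linear_on_mats_def by blast
  have "\<phi> (Y S) $$ (c, d) = (\<Sum>(a, b)\<in>S. X $$ (a, b) * \<phi> (unit_mat n a b) $$ (c, d))"
    if "finite S" "S \<subseteq> {..<n} \<times> {..<n}" for S
    using that
  proof (induction S)
    case empty
    \<comment> \<open>The value at the zero matrix comes from homogeneity with the scalar 0.\<close>
    have "Y {} = 0 \<cdot>\<^sub>m Y {}" unfolding Y_def by (intro eq_matI) auto
    hence "\<phi> (Y {}) = 0 \<cdot>\<^sub>m \<phi> (Y {})" using lin Y unfolding linear_on_mats_def by metis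
    hence "\<phi> (Y {}) $$ (c, d) = (0 \<cdot>\<^sub>m \<phi> (Y {})) $$ (c, d)" by simp
    thus ?case using car[OF Y] cd by (simp add: carrier_matD[OF car[OF Y]])
  next
    case (insert x S)
    obtain a b where x: "x = (a, b)" "a < n" "b < n" using insert.prems by (cases x) auto
    have "Y (insert x S) = Y S + X $$ (a, b) \<cdot>\<^sub>m unit_mat n a b"
      using insert.hyps X x unfolding Y_def unit_mat_def by (intro eq_matI) auto
    hence "\<phi> (Y (insert x S)) = \<phi> (Y S) + X $$ (a, b) \<cdot>\<^sub>m \<phi> (unit_mat n a b)"
      using lin Y[of S] E[of a b] unfolding linear_on_mats_def by (metis smult_carrier_mat)
    thus ?case using insert x cd car[OF Y[of S]] car[OF E[of a b]] by auto
  qed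
  from this[of "{..<n} \<times> {..<n}"] have "\<phi> (Y ({..<n} \<times> {..<n})) $$ (c, d)
      = (\<Sum>(a, b)\<in>{..<n} \<times> {..<n}. X $$ (a, b) * \<phi> (unit_mat n a b) $$ (c, d))" by simp
  moreover have "Y ({..<n} \<times> {..<n}) = X" using X unfolding Y_def by (intro eq_matI) auto
  ultimately show ?thesis by (simp add: sum.cartesian_product)
qed

lemma linear_on_mats_mult:
  assumes lin: "linear_on_mats n \<phi>" and P: "P \<in> carrier_mat n n" and Q: "Q \<in> carrier_mat n n"
  shows "linear_on_mats n (\<lambda>X. \<phi> (P * X * Q))"
proof -
  have "P * (X + Y) * Q = P * X * Q + P * Y * Q" if "X \<in> carrier_mat n n" "Y \<in> carrier_mat n n" for X Y
    using that P Q by (simp add: mult_add_distrib_mat[of _ n n _ n] add_mult_distrib_mat[of _ n n _ _ n])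
  moreover have "P * (c \<cdot>\<^sub>m X) * Q = c \<cdot>\<^sub>m (P * X * Q)" if "X \<in> carrier_mat n n" for X c
    using that P Q by (simp add: mult_smult_distrib[of _ n n _ n] mult_smult_assoc_mat[of _ n n _ n])
  ultimately show ?thesis
    using lin P Q unfolding linear_on_mats_def by auto
qed

section \<open>Singular values under unitary factors and of diagonal matrices\<close>

lemma mult_mat_assoc_dim:
  fixes A B C :: "'a::semiring_0 mat"
  assumes "dim_col A = dim_row B" "dim_col B = dim_row C"
  shows "(A * B) * C = A * (B * C)"
  by (rule assoc_mult_mat[of A "dim_row A" "dim_col A" B "dim_col B" C "dim_col C"]) (use assms in auto)

lemma char_poly_unitary_conj:
  assumes V: "unitary_mat n V" and P: "P \<in> carrier_mat n n"
  shows "char_poly (mat_adjoint V * P * V) = char_poly P"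
proof (rule char_poly_similar)
  have V': "V \<in> carrier_mat n n" "mat_adjoint V * V = 1\<^sub>m n" "V * mat_adjoint V = 1\<^sub>m n"
    using V unfolding unitary_mat_def by auto
  show "similar_mat (mat_adjoint V * P * V) P"
    using V' P by (intro similar_matI[of _ _ "mat_adjoint V" V n]) auto
qed

lemma singular_values_unitary:
  assumes U: "unitary_mat n U" and V: "unitary_mat n V" and X: "X \<in> carrier_mat n n"
  shows "singular_values (U * X * V) = singular_values X"
proof -
  have U': "U \<in> carrier_mat n n" "mat_adjoint U * U = 1\<^sub>m n" and V': "V \<in> carrier_mat n n"
    using U V unfolding unitary_mat_def by auto
  have "mat_adjoint (U * X * V) = mat_adjoint V * (mat_adjoint X * mat_adjoint U)"
    using U' V' X by (simp add: mat_adjoint_mult[of _ n n _ n] assoc_mult_mat[of _ n n _ n _ n])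
  also have "\<dots> * (U * X * V) = mat_adjoint V * (mat_adjoint X * ((mat_adjoint U * U) * X)) * V"
    using carrier_matD[OF U'(1)] carrier_matD[OF V'] carrier_matD[OF X] by (simp add: mult_mat_assoc_dim)
  also have "\<dots> = mat_adjoint V * (mat_adjoint X * X) * V"
    using U' X by simp
  finally have "mat_adjoint (U * X * V) * (U * X * V) = mat_adjoint V * (mat_adjoint X * X) * V" .
  thus ?thesis unfolding singular_values_def using char_poly_unitary_conj[OF V gram_carrier[OF X]] by simp
qed

lemma singular_values_diag:
  "mset (singular_values (diag_fun n f)) = mset (map (\<lambda>i. cmod (f i)) [0..<n])"
proof -
  let ?D = "diag_fun n f"
  have D: "?D \<in> carrier_mat n n" unfolding diag_fun_def by simp
  have P: "mat_adjoint ?D * ?D = diag_fun n (\<lambda>i. cnj (f i) * f i)"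
  proof (rule eq_matI)
    fix i j assume "i < dim_row (diag_fun n (\<lambda>i. cnj (f i) * f i))" "j < dim_col (diag_fun n (\<lambda>i. cnj (f i) * f i))"
    hence ij: "i < n" "j < n" by (auto simp: diag_fun_def)
    have "(mat_adjoint ?D * ?D) $$ (i, j) = (\<Sum>c<n. cnj (?D $$ (c, i)) * ?D $$ (c, j))"
      by (rule gram_entry[OF D ij])
    also have "\<dots> = (\<Sum>c<n. if c = i then (if i = j then cnj (f i) * f i else 0) else 0)"
      using ij by (intro sum.cong) (auto simp: diag_fun_def)
    also have "\<dots> = diag_fun n (\<lambda>i. cnj (f i) * f i) $$ (i, j)"
      using ij by (simp add: diag_fun_def)
    finally show "(mat_adjoint ?D * ?D) $$ (i, j) = diag_fun n (\<lambda>i. cnj (f i) * f i) $$ (i, j)" .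
  qed (auto simp: diag_fun_def)
  have "char_poly (mat_adjoint ?D * ?D) = (\<Prod>a\<leftarrow>diag_mat (diag_fun n (\<lambda>i. cnj (f i) * f i)). [:- a, 1:])"
    unfolding P by (intro char_poly_upper_triangular[of _ n]) (auto simp: diag_fun_def)
  hence "mset (singular_values ?D) = mset (map (\<lambda>e. sqrt (Re e)) (diag_mat (diag_fun n (\<lambda>i. cnj (f i) * f i))))"
    by (rule mset_singular_values)
  also have "diag_mat (diag_fun n (\<lambda>i. cnj (f i) * f i)) = map (\<lambda>i. cnj (f i) * f i) [0..<n]"
    by (auto simp: diag_mat_def diag_fun_def)
  also have "map (\<lambda>e. sqrt (Re e)) (map (\<lambda>i. cnj (f i) * f i) [0..<n]) = map (\<lambda>i. cmod (f i)) [0..<n]"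
    by (auto simp: cmod_def power2_eq_square)
  finally show ?thesis .
qed

text \<open>A modulus of 0 or 1 equals its own power \<open>p\<close>. This one formula covers the
  diagonal matrix units and the diagonal unitary matrices.\<close>

lemma schatten_norm_diag:
  assumes "\<And>i. i < n \<Longrightarrow> cmod (f i) = 0 \<or> cmod (f i) = 1" and "p > 0"
  shows "schatten_norm p (diag_fun n f) = (\<Sum>i<n. cmod (f i)) powr (1 / p)"
proof -
  have "(\<Sum>s\<leftarrow>singular_values (diag_fun n f). s powr p) = (\<Sum>s\<leftarrow>map (\<lambda>i. cmod (f i)) [0..<n]. s powr p)"
    using singular_values_diag[of n f]
    by (metis (no_types, lifting) mset_map sum_mset_sum_list)
  also have "\<dots> = (\<Sum>i<n. cmod (f i) powr p)"
    by (simp add: comp_def interv_sum_list_conv_sum_set_nat atLeast0LessThan)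
  also have "\<dots> = (\<Sum>i<n. cmod (f i))"
    by (intro sum.cong refl) (use assms in fastforce)
  finally show ?thesis unfolding schatten_norm_def by simp
qed

section \<open>Multi-indices and the algebra of tensor products\<close>

declare One_nat_def [simp del]

text \<open>Extensional functions, so that multi-indices with equal components on
  \<open>{1..m}\<close> are equal and \<open>enc\<close> becomes a bijection.\<close>

abbreviation midx :: "(nat \<Rightarrow> nat) \<Rightarrow> nat \<Rightarrow> (nat \<Rightarrow> nat) set" where
  "midx n m \<equiv> PiE {1..m} (\<lambda>s. {..<n s})"

lemma midx_less: "i \<in> midx n m \<Longrightarrow> s \<in> {1..m} \<Longrightarrow> i s < n s"
  using PiE_mem[of i "{1..m}" "\<lambda>s. {..<n s}" s] by simp

lemma bij_betw_enc: "bij_betw (enc n m) (midx n m) {..<\<Prod>s=1..m. n s}"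
proof -
  have inj: "inj_on (enc n m) (midx n m)"
  proof (rule inj_onI)
    fix i j assume i: "i \<in> midx n m" and j: "j \<in> midx n m" and e: "enc n m i = enc n m j"
    show "i = j" by (rule PiE_ext[OF i j], rule enc_inject[OF _ _ e]) (use i j midx_less in blast)+
  qed
  have sub: "enc n m ` midx n m \<subseteq> {..<\<Prod>s=1..m. n s}"
    by (auto intro!: enc_less dest: PiE_mem simp del: One_nat_def)
  have "card (enc n m ` midx n m) = (\<Prod>s=1..m. n s)"
    by (simp add: card_image[OF inj] card_PiE)
  hence "enc n m ` midx n m = {..<\<Prod>s=1..m. n s}"
    by (intro card_subset_eq sub) auto
  thus ?thesis using inj by (simp add: bij_betw_def)
qed

lemma sum_over_enc: "(\<Sum>b<(\<Prod>s=1..m. n s). f b) = (\<Sum>i\<in>midx n m. f (enc n m i))"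
  by (rule sum.reindex_bij_betw[OF bij_betw_enc, symmetric])

lemma enc_lt: "i \<in> midx n m \<Longrightarrow> enc n m i < (\<Prod>s=1..m. n s)"
  using bij_betw_apply[OF bij_betw_enc] by auto

lemma enc_eq_iff: "i \<in> midx n m \<Longrightarrow> j \<in> midx n m \<Longrightarrow> enc n m i = enc n m j \<longleftrightarrow> i = j"
  using inj_on_eq_iff[OF bij_betw_imp_inj_on[OF bij_betw_enc]] .

lemma enc_cases:
  assumes "b < (\<Prod>s=1..m. n s)"
  obtains i where "i \<in> midx n m" "b = enc n m i"
  using assms bij_betw_imp_surj_on[OF bij_betw_enc] by blast

lemma kronecker_fam_entry_midx:
  assumes "\<And>s. s \<in> {1..m} \<Longrightarrow> A s \<in> carrier_mat (n s) (n s)" "i \<in> midx n m" "j \<in> midx n m"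
  shows "kronecker_fam A m $$ (enc n m i, enc n m j) = (\<Prod>s=1..m. A s $$ (i s, j s))"
  by (rule kronecker_fam_entry) (use assms midx_less in blast)+

lemma mat_eq_on_enc:
  assumes "X \<in> carrier_mat (\<Prod>s=1..m. n s) (\<Prod>s=1..m. n s)" "Y \<in> carrier_mat (\<Prod>s=1..m. n s) (\<Prod>s=1..m. n s)"
    and "\<And>i j. i \<in> midx n m \<Longrightarrow> j \<in> midx n m \<Longrightarrow> X $$ (enc n m i, enc n m j) = Y $$ (enc n m i, enc n m j)"
  shows "X = Y"
proof (rule eq_matI)
  fix a b assume "a < dim_row Y" "b < dim_col Y"
  hence ab: "a < (\<Prod>s=1..m. n s)" "b < (\<Prod>s=1..m. n s)" using assms by auto
  obtain i j where "i \<in> midx n m" "a = enc n m i" "j \<in> midx n m" "b = enc n m j"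
    using enc_cases[OF ab(1)] enc_cases[OF ab(2)] by metis
  thus "X $$ (a, b) = Y $$ (a, b)" using assms(3) by simp
qed (use assms in auto)

text \<open>The mixed product rule. The sum over the inner multi-index of a product over the factors
  is, by distributivity, the product over the factors of the single sums.\<close>

lemma kronecker_fam_mult:
  assumes A: "\<And>s. s \<in> {1..m} \<Longrightarrow> A s \<in> carrier_mat (n s) (n s)"
    and B: "\<And>s. s \<in> {1..m} \<Longrightarrow> B s \<in> carrier_mat (n s) (n s)"
  shows "kronecker_fam (\<lambda>s. A s * B s) m = kronecker_fam A m * (kronecker_fam B m :: 'a::comm_semiring_1 mat)"
proof (rule mat_eq_on_enc)
  let ?N = "\<Prod>s=1..m. n s"
  have KA: "kronecker_fam A m \<in> carrier_mat ?N ?N" by (rule kronecker_fam_carrier[OF A])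
  have KB: "kronecker_fam B m \<in> carrier_mat ?N ?N" by (rule kronecker_fam_carrier[OF B])
  have AB: "A s * B s \<in> carrier_mat (n s) (n s)" if "s \<in> {1..m}" for s
    using mult_carrier_mat[OF A[OF that] B[OF that]] .
  show "kronecker_fam (\<lambda>s. A s * B s) m \<in> carrier_mat ?N ?N" by (rule kronecker_fam_carrier[OF AB])
  show "kronecker_fam A m * kronecker_fam B m \<in> carrier_mat ?N ?N" using KA KB by simp
  fix i j assume ij: "i \<in> midx n m" "j \<in> midx n m"
  have "(kronecker_fam A m * kronecker_fam B m) $$ (enc n m i, enc n m j)
      = (\<Sum>k\<in>midx n m. (\<Prod>s=1..m. A s $$ (i s, k s)) * (\<Prod>s=1..m. B s $$ (k s, j s)))"
    unfolding mult_mat_entry[OF KA KB enc_lt[OF ij(1)] enc_lt[OF ij(2)]] sum_over_enc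
    by (intro sum.cong refl arg_cong2[of _ _ _ _ "(*)"] kronecker_fam_entry_midx A B ij)
  also have "\<dots> = (\<Sum>k\<in>midx n m. \<Prod>s=1..m. A s $$ (i s, k s) * B s $$ (k s, j s))"
    by (simp only: prod.distrib)
  also have "\<dots> = (\<Prod>s=1..m. \<Sum>k<n s. A s $$ (i s, k) * B s $$ (k, j s))"
    by (rule prod_sum_PiE[symmetric]) auto
  also have "\<dots> = (\<Prod>s=1..m. (A s * B s) $$ (i s, j s))"
    by (intro prod.cong refl)
      (simp only: mult_mat_entry[OF A B midx_less[OF ij(1)] midx_less[OF ij(2)]])
  also have "\<dots> = kronecker_fam (\<lambda>s. A s * B s) m $$ (enc n m i, enc n m j)"
    by (rule kronecker_fam_entry_midx[OF AB ij, symmetric])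
  finally show "kronecker_fam (\<lambda>s. A s * B s) m $$ (enc n m i, enc n m j)
    = (kronecker_fam A m * kronecker_fam B m) $$ (enc n m i, enc n m j)" ..
qed

lemma prod_midx_delta:
  fixes f :: "nat \<Rightarrow> 'a::comm_semiring_1"
  assumes ij: "i \<in> midx n m" "j \<in> midx n m"
  shows "(\<Prod>s=1..m. if i s = j s then f s else 0) = (if i = j then \<Prod>s=1..m. f s else 0)"
proof (cases "i = j")
  case False
  then obtain s where "s \<in> {1..m}" "i s \<noteq> j s" using PiE_ext[OF ij] by blast
  hence "(\<Prod>s=1..m. if i s = j s then f s else 0) = 0" by (intro prod_zero) auto
  thus ?thesis using False by simp
qed simp

lemma kronecker_fam_one: "kronecker_fam (\<lambda>s. 1\<^sub>m (n s)) m = (1\<^sub>m (\<Prod>s=1..m. n s) :: 'a::comm_semiring_1 mat)"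
proof (rule mat_eq_on_enc)
  fix i j assume ij: "i \<in> midx n m" "j \<in> midx n m"
  have "kronecker_fam (\<lambda>s. 1\<^sub>m (n s) :: 'a mat) m $$ (enc n m i, enc n m j) = (\<Prod>s=1..m. 1\<^sub>m (n s) $$ (i s, j s))"
    by (rule kronecker_fam_entry_midx[OF _ ij]) auto
  also have "\<dots> = (\<Prod>s=1..m. if i s = j s then 1 else 0)"
    by (intro prod.cong refl) (simp add: midx_less[OF ij(1)] midx_less[OF ij(2)])
  also have "\<dots> = (if i = j then 1 else 0)"
    by (simp add: prod_midx_delta[OF ij])
  finally show "kronecker_fam (\<lambda>s. 1\<^sub>m (n s) :: 'a mat) m $$ (enc n m i, enc n m j)
      = 1\<^sub>m (\<Prod>s=1..m. n s) $$ (enc n m i, enc n m j)"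
    using enc_lt[OF ij(1)] enc_lt[OF ij(2)] enc_eq_iff[OF ij] by simp
qed (auto intro!: kronecker_fam_carrier)

lemma kronecker_fam_adjoint:
  fixes A :: "nat \<Rightarrow> complex mat"
  assumes A: "\<And>s. s \<in> {1..m} \<Longrightarrow> A s \<in> carrier_mat (n s) (n s)"
  shows "kronecker_fam (\<lambda>s. mat_adjoint (A s)) m = mat_adjoint (kronecker_fam A m)"
proof (rule mat_eq_on_enc)
  let ?N = "\<Prod>s=1..m. n s"
  have KA: "kronecker_fam A m \<in> carrier_mat ?N ?N" by (rule kronecker_fam_carrier[OF A])
  have A': "mat_adjoint (A s) \<in> carrier_mat (n s) (n s)" if "s \<in> {1..m}" for s using A that by simp
  show "kronecker_fam (\<lambda>s. mat_adjoint (A s)) m \<in> carrier_mat ?N ?N" by (rule kronecker_fam_carrier[OF A'])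
  show "mat_adjoint (kronecker_fam A m) \<in> carrier_mat ?N ?N" using KA by simp
  fix i j assume ij: "i \<in> midx n m" "j \<in> midx n m"
  have "kronecker_fam (\<lambda>s. mat_adjoint (A s)) m $$ (enc n m i, enc n m j) = (\<Prod>s=1..m. mat_adjoint (A s) $$ (i s, j s))"
    by (rule kronecker_fam_entry_midx[OF A' ij])
  also have "\<dots> = (\<Prod>s=1..m. cnj (A s $$ (j s, i s)))"
    by (intro prod.cong refl mat_adjoint_entry[OF A] midx_less[OF ij(1)] midx_less[OF ij(2)])
  also have "\<dots> = cnj (kronecker_fam A m $$ (enc n m j, enc n m i))"
    by (simp only: kronecker_fam_entry_midx[OF A ij(2,1)] cnj_prod)
  also have "\<dots> = mat_adjoint (kronecker_fam A m) $$ (enc n m i, enc n m j)"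
    by (rule mat_adjoint_entry[OF KA enc_lt[OF ij(1)] enc_lt[OF ij(2)], symmetric])
  finally show "kronecker_fam (\<lambda>s. mat_adjoint (A s)) m $$ (enc n m i, enc n m j)
    = mat_adjoint (kronecker_fam A m) $$ (enc n m i, enc n m j)" .
qed

lemma kronecker_fam_cong:
  assumes "\<And>s. s \<in> {1..m} \<Longrightarrow> A s = B s"
  shows "kronecker_fam A m = kronecker_fam B m"
  using assms by (induction m) auto

lemma unitary_kronecker_fam:
  assumes U: "\<And>s. s \<in> {1..m} \<Longrightarrow> unitary_mat (n s) (U s)"
  shows "unitary_mat (\<Prod>s=1..m. n s) (kronecker_fam U m)"
proof -
  have C: "U s \<in> carrier_mat (n s) (n s)" "mat_adjoint (U s) \<in> carrier_mat (n s) (n s)"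
    "mat_adjoint (U s) * U s = 1\<^sub>m (n s)" "U s * mat_adjoint (U s) = 1\<^sub>m (n s)" if "s \<in> {1..m}" for s
    using U[OF that] by (auto simp: unitary_mat_def)
  have adj: "kronecker_fam (\<lambda>s. mat_adjoint (U s)) m = mat_adjoint (kronecker_fam U m)"
    by (rule kronecker_fam_adjoint[OF C(1)])
  have "mat_adjoint (kronecker_fam U m) * kronecker_fam U m = kronecker_fam (\<lambda>s. mat_adjoint (U s) * U s) m"
    unfolding adj[symmetric] by (rule kronecker_fam_mult[OF C(2,1), symmetric])
  also have "\<dots> = kronecker_fam (\<lambda>s. 1\<^sub>m (n s)) m" by (rule kronecker_fam_cong[OF C(3)])
  finally have 1: "mat_adjoint (kronecker_fam U m) * kronecker_fam U m = 1\<^sub>m (\<Prod>s=1..m. n s)"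
    by (simp only: kronecker_fam_one)
  have "kronecker_fam U m * mat_adjoint (kronecker_fam U m) = kronecker_fam (\<lambda>s. U s * mat_adjoint (U s)) m"
    unfolding adj[symmetric] by (rule kronecker_fam_mult[OF C(1,2), symmetric])
  also have "\<dots> = kronecker_fam (\<lambda>s. 1\<^sub>m (n s)) m" by (rule kronecker_fam_cong[OF C(4)])
  finally have 2: "kronecker_fam U m * mat_adjoint (kronecker_fam U m) = 1\<^sub>m (\<Prod>s=1..m. n s)"
    by (simp only: kronecker_fam_one)
  show ?thesis unfolding unitary_mat_def
    by (intro conjI 1 2 kronecker_fam_carrier[OF C(1)])
qed

lemma phi_kronecker_entry:
  assumes lin: "linear_on_mats (\<Prod>s=1..m. n s) \<phi>" and A: "\<And>s. s \<in> {1..m} \<Longrightarrow> A s \<in> carrier_mat (n s) (n s)"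
    and cd: "c < (\<Prod>s=1..m. n s)" "d < (\<Prod>s=1..m. n s)"
  shows "\<phi> (kronecker_fam A m) $$ (c, d) = (\<Sum>i\<in>midx n m. \<Sum>j\<in>midx n m.
    (\<Prod>s=1..m. A s $$ (i s, j s)) * \<phi> (unit_mat (\<Prod>s=1..m. n s) (enc n m i) (enc n m j)) $$ (c, d))"
proof -
  have "\<phi> (kronecker_fam A m) $$ (c, d) = (\<Sum>i\<in>midx n m. \<Sum>j\<in>midx n m.
      kronecker_fam A m $$ (enc n m i, enc n m j) * \<phi> (unit_mat (\<Prod>s=1..m. n s) (enc n m i) (enc n m j)) $$ (c, d))"
    using linear_on_mats_entry[OF lin kronecker_fam_carrier[OF A] cd] by (simp only: sum_over_enc)
  also have "\<dots> = (\<Sum>i\<in>midx n m. \<Sum>j\<in>midx n m.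
      (\<Prod>s=1..m. A s $$ (i s, j s)) * \<phi> (unit_mat (\<Prod>s=1..m. n s) (enc n m i) (enc n m j)) $$ (c, d))"
    by (intro sum.cong refl) (simp only: kronecker_fam_entry_midx[OF A])
  finally show ?thesis .
qed

text \<open>Orthogonality of the characters of the cyclic group of order \<open>n\<close>: a
  geometric sum whose ratio \<open>z\<close> is an \<open>n\<close>-th root of unity, equal to 1
  only for \<open>a = b\<close> since both are below \<open>n\<close>.\<close>

lemma cis_roots_sum:
  fixes a b n :: nat
  assumes "a < n" "b < n"
  shows "(\<Sum>k<n. cnj (cis (2 * pi * real k * real a / real n)) * cis (2 * pi * real k * real b / real n))
    = (if a = b then of_nat n else 0)"
proof -
  define z where "z = cnj (cis (2 * pi * real a / real n)) * cis (2 * pi * real b / real n)"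
  have "cnj (cis (2 * pi * real k * real a / real n)) * cis (2 * pi * real k * real b / real n) = z ^ k" for k
    unfolding z_def power_mult_distrib complex_cnj_power[symmetric] DeMoivre by (simp add: mult_ac)
  hence s: "(\<Sum>k<n. cnj (cis (2 * pi * real k * real a / real n)) * cis (2 * pi * real k * real b / real n))
      = (\<Sum>k<n. z ^ k)" by simp
  show ?thesis
  proof (cases "a = b")
    case True
    hence "z = 1" unfolding z_def by (simp add: cis_cnj cis_mult)
    thus ?thesis using s True by simp
  next
    case False
    have "z \<noteq> 1"
    proof
      assume "z = 1"
      have "cis (2 * pi * real b / real n) = cis (2 * pi * real a / real n) * z"
        unfolding z_def by (simp add: cis_cnj cis_mult)
      hence "cis (2 * pi * real b / real n) = cis (2 * pi * real a / real n)" using \<open>z = 1\<close> by simp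
      moreover have "inj_on (\<lambda>k. cis (2 * pi * real k / real n)) {..<n}"
        by (rule bij_betw_imp_inj_on[OF bij_betw_roots_unity]) (use assms in auto)
      ultimately show False using False assms by (auto dest: inj_onD)
    qed
    moreover have "z ^ n = 1"
      unfolding z_def power_mult_distrib complex_cnj_power[symmetric] DeMoivre
      using assms by (simp add: cis_multiple_2pi)
    ultimately show ?thesis using s False geometric_sum[of z n] by simp
  qed
qed

section \<open>Images of the diagonal matrix units and their unitary translates\<close>

lemma unit_mat_eq_diag_fun: "unit_mat n b b = diag_fun n (\<lambda>i. if i = b then 1 else 0)"
  unfolding unit_mat_def diag_fun_def by (intro eq_matI) auto

lemma kronecker_fam_unit_mat:
  assumes ij: "i \<in> midx n m" "j \<in> midx n m"
  shows "kronecker_fam (\<lambda>s. unit_mat (n s) (i s) (j s)) m = unit_mat (\<Prod>s=1..m. n s) (enc n m i) (enc n m j)"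
proof (rule mat_eq_on_enc)
  have U: "unit_mat (n s) (i s) (j s) \<in> carrier_mat (n s) (n s)" for s by (simp add: unit_mat_def)
  show "kronecker_fam (\<lambda>s. unit_mat (n s) (i s) (j s)) m \<in> carrier_mat (\<Prod>s=1..m. n s) (\<Prod>s=1..m. n s)"
    by (rule kronecker_fam_carrier[OF U])
  fix k l assume kl: "k \<in> midx n m" "l \<in> midx n m"
  have "kronecker_fam (\<lambda>s. unit_mat (n s) (i s) (j s)) m $$ (enc n m k, enc n m l)
      = (\<Prod>s=1..m. unit_mat (n s) (i s) (j s) $$ (k s, l s))"
    by (rule kronecker_fam_entry_midx[OF U kl])
  also have "\<dots> = (\<Prod>s=1..m. if k s = i s then if l s = j s then 1 else 0 else 0)"
    by (intro prod.cong refl) (simp add: unit_mat_def midx_less[OF kl(1)] midx_less[OF kl(2)])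
  also have "\<dots> = (if k = i then if l = j then 1 else 0 else 0)"
    unfolding prod_midx_delta[OF kl(1) ij(1)] prod_midx_delta[OF kl(2) ij(2)] by simp
  also have "\<dots> = unit_mat (\<Prod>s=1..m. n s) (enc n m i) (enc n m j) $$ (enc n m k, enc n m l)"
    using enc_lt[OF kl(1)] enc_lt[OF kl(2)] enc_eq_iff[OF kl(1) ij(1)] enc_eq_iff[OF kl(2) ij(2)]
    by (simp add: unit_mat_def)
  finally show "kronecker_fam (\<lambda>s. unit_mat (n s) (i s) (j s)) m $$ (enc n m k, enc n m l)
    = unit_mat (\<Prod>s=1..m. n s) (enc n m i) (enc n m j) $$ (enc n m k, enc n m l)" .
qed (simp add: unit_mat_def)

text \<open>The frame lemma is applied to \<open>\<phi>\<close> after multiplication by the product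
  unitaries from both sides. Its two families, diagonal matrix units and diagonal tensors of roots
  of unity, consist of product tensors and stay so under this multiplication, hence their image
  norms are known.\<close>

lemma tensor_frame_image:
  fixes n :: "nat \<Rightarrow> nat" and m :: nat
  defines "N \<equiv> \<Prod>s=1..m. n s"
  assumes pos: "\<And>s. s \<in> {1..m} \<Longrightarrow> n s > 0" and p: "1 \<le> p" "p \<noteq> 2" and lin: "linear_on_mats N \<phi>"
    and iso: "\<And>A. (\<And>s. s \<in> {1..m} \<Longrightarrow> A s \<in> carrier_mat (n s) (n s)) \<Longrightarrow>
        schatten_norm p (\<phi> (kronecker_fam A m)) = schatten_norm p (kronecker_fam A m)"
    and W: "\<And>s. s \<in> {1..m} \<Longrightarrow> unitary_mat (n s) (W s)"
    and W': "\<And>s. s \<in> {1..m} \<Longrightarrow> unitary_mat (n s) (W' s)"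
  shows "\<exists>u v. (\<forall>i\<in>midx n m. \<forall>c<N. \<forall>d<N.
      \<phi> (kronecker_fam (\<lambda>s. W s * unit_mat (n s) (i s) (i s) * W' s) m) $$ (c, d) = u (enc n m i) c * v (enc n m i) d) \<and>
    (\<forall>b<N. \<forall>b'<N. (\<Sum>c<N. cnj (u b c) * u b' c) = (if b = b' then 1 else 0)) \<and>
    (\<forall>b<N. \<forall>b'<N. (\<Sum>c<N. cnj (v b c) * v b' c) = (if b = b' then 1 else 0))"
proof -
  have p0: "p > 0" using p by simp
  have WC: "W s \<in> carrier_mat (n s) (n s)" "W' s \<in> carrier_mat (n s) (n s)" if "s \<in> {1..m}" for s
    using W[OF that] W'[OF that] by (auto simp: unitary_mat_def)
  define P where "P = kronecker_fam W m"
  define P' where "P' = kronecker_fam W' m"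
  have uP: "unitary_mat N P" "unitary_mat N P'"
    unfolding P_def P'_def N_def by (intro unitary_kronecker_fam W W'; assumption)+
  hence PC: "P \<in> carrier_mat N N" "P' \<in> carrier_mat N N" by (auto simp: unitary_mat_def)
  define \<psi> where "\<psi> X = \<phi> (P * X * P')" for X
  have lin': "linear_on_mats N \<psi>" unfolding \<psi>_def by (rule linear_on_mats_mult[OF lin PC])
  have car: "\<psi> X \<in> carrier_mat N N" if "X \<in> carrier_mat N N" for X
    using lin' that unfolding linear_on_mats_def by blast
  have conj: "P * kronecker_fam A m * P' = kronecker_fam (\<lambda>s. W s * A s * W' s) m"
    if A: "\<And>s. s \<in> {1..m} \<Longrightarrow> A s \<in> carrier_mat (n s) (n s)" for A
  proof -
    have WA: "W s * A s \<in> carrier_mat (n s) (n s)" if "s \<in> {1..m}" for s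
      using mult_carrier_mat[OF WC(1)[OF that] A[OF that]] .
    show ?thesis unfolding P_def P'_def
      by (simp only: kronecker_fam_mult[of m W n A, OF WC(1) A] kronecker_fam_mult[of m "\<lambda>s. W s * A s" n W', OF WA WC(2)])
  qed
  have nrm: "schatten_norm p (\<psi> (kronecker_fam A m)) = schatten_norm p (kronecker_fam A m)"
    if A: "\<And>s. s \<in> {1..m} \<Longrightarrow> A s \<in> carrier_mat (n s) (n s)" for A
  proof -
    have c: "P * kronecker_fam A m * P' = kronecker_fam (\<lambda>s. W s * A s * W' s) m"
      by (rule conj) (rule A)
    have "schatten_norm p (\<psi> (kronecker_fam A m)) = schatten_norm p (P * kronecker_fam A m * P')"
      unfolding \<psi>_def c by (rule iso) (metis A WC mult_carrier_mat)
    also have "\<dots> = schatten_norm p (kronecker_fam A m)"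
      unfolding schatten_norm_def N_def
      by (subst singular_values_unitary[OF uP]) (use kronecker_fam_carrier[OF A] in \<open>auto simp: N_def\<close>)
    finally show ?thesis .
  qed
  \<comment> \<open>Each diagonal lists the values of one character of a cyclic group of order
    \<open>n s\<close>. Finitely many unitaries thus suffice for exact orthogonality, and they are
    again indexed by \<open>midx n m\<close>.\<close>
  define D where "D K s = diag_fun (n s) (\<lambda>a. cis (2 * pi * real (K s) * real a / real (n s)))" for K s
  have DC: "D K s \<in> carrier_mat (n s) (n s)" for K s unfolding D_def diag_fun_def by simp
  define \<chi> where "\<chi> K b = kronecker_fam (D K) m $$ (b, b)" for K b
  have KD: "kronecker_fam (D K) m \<in> carrier_mat N N" for K
    unfolding N_def by (rule kronecker_fam_carrier[OF DC])
  have \<chi>: "\<chi> K (enc n m i) = (\<Prod>s=1..m. cis (2 * pi * real (K s) * real (i s) / real (n s)))" if i: "i \<in> midx n m" for K i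
    unfolding \<chi>_def kronecker_fam_entry_midx[OF DC i i]
    by (intro prod.cong refl) (simp add: D_def diag_fun_def midx_less[OF i])
  have KDd: "kronecker_fam (D K) m = diag_fun N (\<chi> K)" for K
  proof (rule mat_eq_on_enc)
    fix i j assume ij: "i \<in> midx n m" "j \<in> midx n m"
    show "kronecker_fam (D K) m $$ (enc n m i, enc n m j) = diag_fun N (\<chi> K) $$ (enc n m i, enc n m j)"
    proof (cases "i = j")
      case True
      thus ?thesis using enc_lt[OF ij(1)] by (simp add: diag_fun_def \<chi>_def N_def)
    next
      case False
      then obtain s where s: "s \<in> {1..m}" "i s \<noteq> j s" using PiE_ext[OF ij] by blast
      have "D K s $$ (i s, j s) = 0"
        using s midx_less[OF ij(1) s(1)] midx_less[OF ij(2) s(1)] by (simp add: D_def diag_fun_def)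
      hence "(\<Prod>s=1..m. D K s $$ (i s, j s)) = 0" using s by (intro prod_zero) auto
      thus ?thesis unfolding kronecker_fam_entry_midx[OF DC ij]
        using False enc_eq_iff[OF ij] enc_lt[OF ij(1)] enc_lt[OF ij(2)] by (simp add: diag_fun_def N_def)
    qed
  qed (use KD in \<open>auto simp: N_def diag_fun_def\<close>)
  have unimod: "cmod (\<chi> K b) = 1" if b: "b < N" for K b
  proof -
    obtain i where i: "i \<in> midx n m" "b = enc n m i" using enc_cases b unfolding N_def by blast
    show ?thesis unfolding i(2) \<chi>[OF i(1)] by (simp add: prod_norm[symmetric])
  qed
  have unitd: "kronecker_fam (\<lambda>s. unit_mat (n s) (i s) (i s)) m = unit_mat N (enc n m i) (enc n m i)"
    if i: "i \<in> midx n m" for i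
    unfolding N_def by (rule kronecker_fam_unit_mat[OF i i])
  let ?F = "\<lambda>b. \<psi> (unit_mat N b b)"
  have "\<exists>u v. (\<forall>b<N. \<forall>c<N. \<forall>d<N. ?F b $$ (c, d) = u b c * v b d) \<and>
    (\<forall>b<N. \<forall>b'<N. (\<Sum>c<N. cnj (u b c) * u b' c) = (if b = b' then 1 else 0)) \<and>
    (\<forall>b<N. \<forall>b'<N. (\<Sum>c<N. cnj (v b c) * v b' c) = (if b = b' then 1 else 0))"
  proof (rule orthonormal_rank_one_frame[OF p, where Q = "midx n m" and \<chi> = \<chi> and T = "\<lambda>K. \<psi> (kronecker_fam (D K) m)"])
    show "finite (midx n m)" by (intro finite_PiE) auto
    have "restrict (\<lambda>_. 0) {1..m} \<in> midx n m" using pos by (intro restrict_PiE_iff[THEN iffD2]) auto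
    thus "midx n m \<noteq> {}" by blast
    fix b b' assume b: "b < N" "b' < N"
    obtain i j where ij: "i \<in> midx n m" "j \<in> midx n m" and bij: "b = enc n m i" "b' = enc n m j"
      using enc_cases b unfolding N_def by metis
    have "(\<Sum>K\<in>midx n m. cnj (\<chi> K b) * \<chi> K b')
        = (\<Sum>K\<in>midx n m. \<Prod>s=1..m. cnj (cis (2 * pi * real (K s) * real (i s) / real (n s))) * cis (2 * pi * real (K s) * real (j s) / real (n s)))"
      unfolding bij \<chi>[OF ij(1)] \<chi>[OF ij(2)] by (simp only: cnj_prod prod.distrib)
    also have "\<dots> = (\<Prod>s=1..m. \<Sum>k<n s. cnj (cis (2 * pi * real k * real (i s) / real (n s))) * cis (2 * pi * real k * real (j s) / real (n s)))"
      by (rule prod_sum_PiE[symmetric]) auto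
    also have "\<dots> = (\<Prod>s=1..m. if i s = j s then of_nat (n s) else 0)"
      by (intro prod.cong refl cis_roots_sum midx_less[OF ij(1)] midx_less[OF ij(2)])
    also have "\<dots> = (if i = j then of_nat (card (midx n m)) else 0)"
      by (simp add: prod_midx_delta[OF ij] card_PiE)
    finally show "(\<Sum>K\<in>midx n m. cnj (\<chi> K b) * \<chi> K b') = (if b = b' then of_nat (card (midx n m)) else 0)"
      using enc_eq_iff[OF ij] bij by simp
  next
    fix b assume b: "b < N"
    obtain i where i: "i \<in> midx n m" "b = enc n m i" using enc_cases b unfolding N_def by blast
    show "?F b \<in> carrier_mat N N" by (rule car) (simp add: unit_mat_def)
    have "schatten_norm p (?F b) = schatten_norm p (unit_mat N b b)"
      unfolding i(2) unitd[OF i(1), symmetric] by (rule nrm) (simp add: unit_mat_def)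
    also have "\<dots> = (\<Sum>i<N. cmod (if i = b then 1 else 0)) powr (1 / p)"
      unfolding unit_mat_eq_diag_fun by (rule schatten_norm_diag[OF _ p0]) auto
    also have "\<dots> = 1" using b by (simp add: if_distrib cong: if_cong)
    finally show "schatten_norm p (?F b) = 1" .
  next
    fix K assume K: "K \<in> midx n m"
    show "\<psi> (kronecker_fam (D K) m) \<in> carrier_mat N N" by (rule car[OF KD])
    have "schatten_norm p (\<psi> (kronecker_fam (D K) m)) = schatten_norm p (diag_fun N (\<chi> K))"
      using nrm[of "D K", OF DC] unfolding KDd .
    also have "\<dots> = real N powr (1 / p)"
      using unimod p0 by (subst schatten_norm_diag) auto
    finally show "schatten_norm p (\<psi> (kronecker_fam (D K) m)) = real N powr (1 / p)" .
    fix c d assume cd: "c < N" "d < N"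
    have "\<psi> (kronecker_fam (D K) m) $$ (c, d)
        = (\<Sum>a<N. \<Sum>b<N. diag_fun N (\<chi> K) $$ (a, b) * \<psi> (unit_mat N a b) $$ (c, d))"
      unfolding linear_on_mats_entry[OF lin' KD cd] unfolding KDd ..
    also have "\<dots> = (\<Sum>a<N. \<Sum>b<N. if b = a then \<chi> K a * ?F a $$ (c, d) else 0)"
      by (intro sum.cong refl) (auto simp: diag_fun_def)
    finally show "\<psi> (kronecker_fam (D K) m) $$ (c, d) = (\<Sum>b<N. \<chi> K b * ?F b $$ (c, d))" by simp
  qed
  then obtain u v where uv: "\<forall>b<N. \<forall>c<N. \<forall>d<N. ?F b $$ (c, d) = u b c * v b d"
    "\<forall>b<N. \<forall>b'<N. (\<Sum>c<N. cnj (u b c) * u b' c) = (if b = b' then 1 else 0)"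
    "\<forall>b<N. \<forall>b'<N. (\<Sum>c<N. cnj (v b c) * v b' c) = (if b = b' then 1 else 0)"
    by (elim exE conjE)
  have "\<phi> (kronecker_fam (\<lambda>s. W s * unit_mat (n s) (i s) (i s) * W' s) m) $$ (c, d) = u (enc n m i) c * v (enc n m i) d"
    if i: "i \<in> midx n m" and cd: "c < N" "d < N" for i c d
  proof -
    have "\<phi> (kronecker_fam (\<lambda>s. W s * unit_mat (n s) (i s) (i s) * W' s) m) = \<psi> (kronecker_fam (\<lambda>s. unit_mat (n s) (i s) (i s)) m)"
      unfolding \<psi>_def by (subst conj) (simp_all add: unit_mat_def)
    thus ?thesis unfolding unitd[OF i] using uv(1)[rule_format, of "enc n m i" c d] enc_lt[OF i] cd by (simp add: N_def)
  qed
  hence res: "\<forall>i\<in>midx n m. \<forall>c<N. \<forall>d<N.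
      \<phi> (kronecker_fam (\<lambda>s. W s * unit_mat (n s) (i s) (i s) * W' s) m) $$ (c, d) = u (enc n m i) c * v (enc n m i) d"
    by simp
  show ?thesis by (rule exI[of _ u], rule exI[of _ v]) (rule conjI[OF res conjI[OF uv(2,3)]])
qed

subsection \<open>Multilinear maps into rank one matrices\<close>

definition nonzero_upto :: "nat \<Rightarrow> (nat \<Rightarrow> complex) \<Rightarrow> bool" where
  "nonzero_upto N f \<longleftrightarrow> (\<exists>a<N. f a \<noteq> 0)"

text \<open>Vectors are functions of which only the first \<open>N\<close> values count. The nonzero
  factor makes the relation an equivalence, zero vectors included.\<close>

definition parallel_upto :: "nat \<Rightarrow> (nat \<Rightarrow> complex) \<Rightarrow> (nat \<Rightarrow> complex) \<Rightarrow> bool" where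
  "parallel_upto N f g \<longleftrightarrow> (\<exists>c. c \<noteq> 0 \<and> (\<forall>a<N. g a = c * f a))"

lemma parallel_upto_refl [simp]: "parallel_upto N f f"
  unfolding parallel_upto_def by (intro exI[of _ 1]) auto

lemma parallel_upto_sym: "parallel_upto N f g \<Longrightarrow> parallel_upto N g f"
  unfolding parallel_upto_def by (metis divide_inverse_commute inverse_nonzero_iff_nonzero nonzero_mult_div_cancel_left)

lemma parallel_upto_trans: "parallel_upto N f g \<Longrightarrow> parallel_upto N g h \<Longrightarrow> parallel_upto N f h"
  unfolding parallel_upto_def by (metis mult.assoc no_zero_divisors)

lemma parallel_upto_add_cancel:
  assumes "parallel_upto N f g" "parallel_upto N f (\<lambda>a. g a + h a)" "nonzero_upto N h"
  shows "parallel_upto N f h"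
proof -
  obtain c1 c2 where c: "\<forall>a<N. g a = c1 * f a" "\<forall>a<N. g a + h a = c2 * f a"
    using assms unfolding parallel_upto_def by blast
  have h: "h a = (c2 - c1) * f a" if "a < N" for a
    using c that by (metis add_diff_cancel_left' left_diff_distrib)
  moreover have "c2 - c1 \<noteq> 0" using assms(3) h unfolding nonzero_upto_def by auto
  ultimately show ?thesis unfolding parallel_upto_def by blast
qed

lemma parallel_upto_if_minors:
  assumes "nonzero_upto N f" "nonzero_upto N g"
    and "\<And>a b. a < N \<Longrightarrow> b < N \<Longrightarrow> f a * g b = f b * g a"
  shows "parallel_upto N f g"
proof -
  obtain a0 where a0: "a0 < N" "f a0 \<noteq> 0" using assms(1) unfolding nonzero_upto_def by auto
  have eq: "g b = (g a0 / f a0) * f b" if "b < N" for b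
    using assms(3)[OF a0(1) that] a0(2) by (simp add: field_simps)
  have "g a0 / f a0 \<noteq> 0" using assms(2) eq unfolding nonzero_upto_def by auto
  thus ?thesis unfolding parallel_upto_def using eq by blast
qed

text \<open>A 2 by 2 minor of the sum of two rank one matrices is a minor of \<open>u, u'\<close>
  times a minor of \<open>v, v'\<close>. If neither pair were parallel, both could be chosen
  nonzero, but all minors of the right side vanish.\<close>

lemma rank_one_sum_parallel:
  assumes nz: "nonzero_upto N u" "nonzero_upto N v" "nonzero_upto N u'" "nonzero_upto N v'"
    and s: "\<And>c e. c < N \<Longrightarrow> e < N \<Longrightarrow> u c * v e + u' c * v' e = w c * z e"
  shows "parallel_upto N u u' \<or> parallel_upto N v v'"
proof (rule ccontr)
  assume "\<not> ?thesis"
  hence "\<not> parallel_upto N u u'" "\<not> parallel_upto N v v'" by auto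
  then obtain a b c e where ab: "a < N" "b < N" "u a * u' b \<noteq> u b * u' a" and ce: "c < N" "e < N" "v c * v' e \<noteq> v e * v' c"
    using parallel_upto_if_minors[of N u u'] parallel_upto_if_minors[of N v v'] nz by blast
  have "(u a * v c + u' a * v' c) * (u b * v e + u' b * v' e) = (u a * v e + u' a * v' e) * (u b * v c + u' b * v' c)"
    using ab ce by (simp add: s)
  moreover have "(u a * u' b - u b * u' a) * (v c * v' e - v e * v' c)
      = (u a * v c + u' a * v' c) * (u b * v e + u' b * v' e) - (u a * v e + u' a * v' e) * (u b * v c + u' b * v' c)"
    by (simp add: algebra_simps)
  ultimately have "(u a * u' b - u b * u' a) * (v c * v' e - v e * v' c) = 0" by simp
  thus False using ab ce by simp
qed

lemma PiE_fun_upd_mem: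
  assumes "k \<in> PiE T B" "t \<in> T" "a \<in> B t"
  shows "k(t := a) \<in> PiE T B"
  using assms by (auto simp: PiE_iff extensional_def)

text \<open>The coordinates in \<open>S\<close> are replaced by those of \<open>k'\<close> one at a
  time. Restricting the changes to \<open>S\<close> later allows moves in the directions of one type
  only.\<close>

lemma PiE_change_coordinates:
  assumes "finite S" "S \<subseteq> T" "k \<in> PiE T B" "k' \<in> PiE T B" "\<And>t. t \<in> T - S \<Longrightarrow> k t = k' t" "Q k"
    and step: "\<And>l t a. l \<in> PiE T B \<Longrightarrow> t \<in> S \<Longrightarrow> a \<in> B t \<Longrightarrow> Q l \<Longrightarrow> Q (l(t := a))"
  shows "Q k'"
  using assms
proof (induction S arbitrary: k rule: finite_induct)
  case empty
  hence "k = k'" by (intro PiE_ext[of _ T B]) auto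
  thus ?case using empty.prems by simp
next
  case (insert s S)
  have ks: "k' s \<in> B s" using insert.prems by (auto dest: PiE_mem)
  show ?case
  proof (rule insert.IH)
    show "k(s := k' s) \<in> PiE T B" using insert.prems ks by (intro PiE_fun_upd_mem) auto
    show "Q (k(s := k' s))" using insert.prems ks by blast
    show "(k(s := k' s)) t = k' t" if "t \<in> T - S" for t using that insert.prems by auto
  qed (use insert.prems in auto)
qed

text \<open>The matrices \<open>u k \<otimes> v k\<close> are the values on basis tensors of a multilinear map that sends
  families of nonzero vectors to nonzero matrices of rank one; only vectors with at most two nonzero
  coordinates are needed.\<close>

locale rank_one_family =
  fixes T :: "'t set" and dm :: "'t \<Rightarrow> nat" and N :: nat and u v :: "('t \<Rightarrow> nat) \<Rightarrow> nat \<Rightarrow> complex"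
  assumes finite_T: "finite T"
    and nz: "k \<in> PiE T (\<lambda>t. {..<dm t}) \<Longrightarrow> nonzero_upto N (u k) \<and> nonzero_upto N (v k)"
    and pair: "\<lbrakk>k \<in> PiE T (\<lambda>t. {..<dm t}); t \<in> T; a < dm t; b < dm t; a \<noteq> b; \<alpha> \<noteq> 0 \<or> \<beta> \<noteq> 0\<rbrakk> \<Longrightarrow>
      \<exists>w z. nonzero_upto N w \<and> nonzero_upto N z \<and> (\<forall>c<N. \<forall>e<N.
        \<alpha> * (u (k(t := a)) c * v (k(t := a)) e) + \<beta> * (u (k(t := b)) c * v (k(t := b)) e) = w c * z e)"
    and square: "\<lbrakk>k \<in> PiE T (\<lambda>t. {..<dm t}); t \<in> T; t' \<in> T; t \<noteq> t'; a < dm t; b < dm t; a \<noteq> b;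
        a' < dm t'; b' < dm t'; a' \<noteq> b'\<rbrakk> \<Longrightarrow>
      \<exists>w z. \<forall>c<N. \<forall>e<N.
        u (k(t := a, t' := a')) c * v (k(t := a, t' := a')) e + u (k(t := a, t' := b')) c * v (k(t := a, t' := b')) e +
        (u (k(t := b, t' := a')) c * v (k(t := b, t' := a')) e + u (k(t := b, t' := b')) c * v (k(t := b, t' := b')) e)
        = w c * z e"
begin

abbreviation K where "K \<equiv> PiE T (\<lambda>t. {..<dm t})"

definition keeps_u where "keeps_u k t a b \<longleftrightarrow> parallel_upto N (u (k(t := a))) (u (k(t := b)))"
definition keeps_v where "keeps_v k t a b \<longleftrightarrow> parallel_upto N (v (k(t := a))) (v (k(t := b)))"

lemma upd_K: "k \<in> K \<Longrightarrow> t \<in> T \<Longrightarrow> a < dm t \<Longrightarrow> k(t := a) \<in> K"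
  by (rule PiE_fun_upd_mem) auto

text \<open>If both factors were kept, the two images would be proportional and some nonzero
  combination of the two basis vectors would have image zero. If neither were kept, the sum of the
  two images could not have rank one.\<close>

lemma keeps_u_or_v:
  assumes "k \<in> K" "t \<in> T" "a < dm t" "b < dm t" "a \<noteq> b"
  shows "keeps_u k t a b \<longleftrightarrow> \<not> keeps_v k t a b"
proof
  assume u: "keeps_u k t a b"
  show "\<not> keeps_v k t a b"
  proof
    assume v: "keeps_v k t a b"
    obtain c1 c2 where c: "\<forall>x<N. u (k(t := b)) x = c1 * u (k(t := a)) x" "\<forall>x<N. v (k(t := b)) x = c2 * v (k(t := a)) x"
      using u v unfolding keeps_u_def keeps_v_def parallel_upto_def by blast
    \<comment> \<open>The image at \<open>b\<close> is \<open>c1 * c2\<close> times the image at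
      \<open>a\<close>, so these coefficients produce the forbidden zero.\<close>
    obtain w z where wz: "nonzero_upto N w" "nonzero_upto N z" "\<forall>c<N. \<forall>e<N.
        (- (c1 * c2)) * (u (k(t := a)) c * v (k(t := a)) e) + 1 * (u (k(t := b)) c * v (k(t := b)) e) = w c * z e"
      using pair[OF assms, of "- (c1 * c2)" 1] by auto
    have "w x * z y = 0" if "x < N" "y < N" for x y
    proof -
      have "w x * z y = (- (c1 * c2)) * (u (k(t := a)) x * v (k(t := a)) y) + 1 * (u (k(t := b)) x * v (k(t := b)) y)"
        using wz(3) that by simp
      also have "\<dots> = 0" using c that by simp
      finally show ?thesis .
    qed
    thus False using wz(1,2) unfolding nonzero_upto_def by auto
  qed
next
  assume v: "\<not> keeps_v k t a b"
  obtain w z where "\<forall>c<N. \<forall>e<N.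
      1 * (u (k(t := a)) c * v (k(t := a)) e) + 1 * (u (k(t := b)) c * v (k(t := b)) e) = w c * z e"
    using pair[OF assms, of 1 1] by auto
  hence "parallel_upto N (u (k(t := a))) (u (k(t := b))) \<or> parallel_upto N (v (k(t := a))) (v (k(t := b)))"
    using nz upd_K assms by (intro rank_one_sum_parallel[of N _ _ _ _ w z]) auto
  thus "keeps_u k t a b" using v unfolding keeps_u_def keeps_v_def by simp
qed

lemma keeps_u_sym: "keeps_u k t a b \<Longrightarrow> keeps_u k t b a"
  unfolding keeps_u_def by (rule parallel_upto_sym)

text \<open>Otherwise the move from \<open>a\<close> to \<open>c\<close> keeps \<open>v\<close>. The
  move from \<open>b\<close> to \<open>c\<close> cannot keep \<open>v\<close>, as then the one from
  \<open>a\<close> to \<open>b\<close> would; so it keeps \<open>u\<close>, and by transitivity so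
  does the move from \<open>a\<close> to \<open>c\<close>.\<close>

lemma keeps_u_other:
  assumes k: "k \<in> K" "t \<in> T" and l: "a < dm t" "b < dm t" "c < dm t" "a \<noteq> b" "a \<noteq> c" and u: "keeps_u k t a b"
  shows "keeps_u k t a c"
proof (cases "b = c")
  case False
  show ?thesis
  proof (rule ccontr)
    assume n: "\<not> keeps_u k t a c"
    hence "keeps_v k t a c" using keeps_u_or_v[OF k l(1,3,5)] by simp
    moreover have "\<not> keeps_v k t a b" using keeps_u_or_v[OF k l(1,2,4)] u by simp
    ultimately have "\<not> keeps_v k t b c" unfolding keeps_v_def by (metis parallel_upto_sym parallel_upto_trans)
    hence "keeps_u k t b c" using keeps_u_or_v[OF k l(2,3) False] by simp
    thus False using u n unfolding keeps_u_def by (metis parallel_upto_trans)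
  qed
qed (use u in simp)

lemma keeps_u_all_pairs:
  assumes k: "k \<in> K" "t \<in> T" and l: "a < dm t" "b < dm t" "a \<noteq> b" "c < dm t" "e < dm t" "c \<noteq> e" and u: "keeps_u k t a b"
  shows "keeps_u k t c e"
proof (cases "a = c")
  case True
  thus ?thesis using keeps_u_other[OF k l(1,2,5,3) _ u] l by simp
next
  case False
  have "keeps_u k t a c" by (rule keeps_u_other[OF k l(1,2,4,3) False u])
  hence "keeps_u k t c a" by (rule keeps_u_sym)
  thus ?thesis using keeps_u_other[OF k l(4,1,5) _ l(6)] False by simp
qed

text \<open>Suppose the move from \<open>a\<close> to \<open>b\<close> keeps \<open>u\<close> at
  \<open>a'\<close> but \<open>v\<close> at \<open>b'\<close>. Changing \<open>t'\<close> from
  \<open>a'\<close> to \<open>b'\<close> can be done at \<open>a\<close>, at \<open>b\<close> and at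
  the sum of these two basis vectors; each time one of the two factors stays parallel. Two of the
  three cases concern the same factor, and this makes two vectors parallel that are not.\<close>

lemma keeps_u_step:
  assumes k: "k \<in> K" "t \<in> T" and l: "a < dm t" "b < dm t" "a \<noteq> b"
    and t': "t' \<in> T" "t \<noteq> t'" "a' < dm t'" "b' < dm t'" and ku: "keeps_u (k(t' := a')) t a b"
  shows "keeps_u (k(t' := b')) t a b"
proof (rule ccontr)
  assume n: "\<not> keeps_u (k(t' := b')) t a b"
  hence ab: "a' \<noteq> b'" using ku by auto
  let ?A = "\<lambda>x. k(t := x, t' := a')" and ?B = "\<lambda>x. k(t := x, t' := b')"
  have sw: "(k(t' := y))(t := x) = k(t := x, t' := y)" for x y using t' by (simp add: fun_upd_twist)
  have kA: "k(t' := a') \<in> K" and kB: "k(t' := b') \<in> K" using upd_K k t' by auto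
  have kv: "keeps_v (k(t' := b')) t a b" using n keeps_u_or_v[OF kB k(2) l] by simp
  have nkv: "\<not> keeps_v (k(t' := a')) t a b" using ku keeps_u_or_v[OF kA k(2) l] by simp
  have KK: "?A a \<in> K" "?A b \<in> K" "?B a \<in> K" "?B b \<in> K" using upd_K k t' l by auto
  obtain \<mu> where \<mu>: "\<mu> \<noteq> 0" "\<forall>x<N. u (?A b) x = \<mu> * u (?A a) x"
    using ku unfolding keeps_u_def sw parallel_upto_def by blast
  obtain \<nu> where \<nu>: "\<nu> \<noteq> 0" "\<forall>x<N. v (?B b) x = \<nu> * v (?B a) x"
    using kv unfolding keeps_v_def sw parallel_upto_def by blast
  \<comment> \<open>Up to the scalars absorbed here, the corners at \<open>a'\<close> are
    \<open>?u\<close> times \<open>?ga\<close> and \<open>?gb\<close>, and those at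
    \<open>b'\<close> are \<open>?ha\<close> and \<open>?hb\<close> times \<open>?v\<close>.\<close>
  let ?u = "u (?A a)" and ?v = "v (?B a)"
  let ?ga = "v (?A a)" and ?gb = "\<lambda>x. \<mu> * v (?A b) x"
  let ?ha = "u (?B a)" and ?hb = "\<lambda>x. \<nu> * u (?B b) x"
  have nzs: "nonzero_upto N ?u" "nonzero_upto N ?v" "nonzero_upto N ?ga" "nonzero_upto N ?ha"
    "nonzero_upto N ?gb" "nonzero_upto N ?hb"
    using nz[OF KK(1)] nz[OF KK(2)] nz[OF KK(3)] nz[OF KK(4)] \<mu>(1) \<nu>(1) unfolding nonzero_upto_def by auto
  have parg: "\<not> parallel_upto N ?ga ?gb"
  proof
    assume "parallel_upto N ?ga ?gb"
    moreover have "parallel_upto N ?gb (v (?A b))"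
      using \<mu>(1) unfolding parallel_upto_def by (intro exI[of _ "1 / \<mu>"]) auto
    ultimately show False using nkv unfolding keeps_v_def sw by (metis parallel_upto_trans)
  qed
  have parh: "\<not> parallel_upto N ?ha ?hb"
  proof
    assume "parallel_upto N ?ha ?hb"
    moreover have "parallel_upto N ?hb (u (?B b))"
      using \<nu>(1) unfolding parallel_upto_def by (intro exI[of _ "1 / \<nu>"]) auto
    ultimately show False using n unfolding keeps_u_def sw by (metis parallel_upto_trans)
  qed
  have A: "parallel_upto N ?u ?ha \<or> parallel_upto N ?ga ?v"
  proof -
    obtain w z where "\<forall>c<N. \<forall>e<N. 1 * (u ((k(t := a))(t' := a')) c * v ((k(t := a))(t' := a')) e)
        + 1 * (u ((k(t := a))(t' := b')) c * v ((k(t := a))(t' := b')) e) = w c * z e"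
      using pair[OF upd_K[OF k l(1)] t'(1,3,4) ab, of 1 1] by auto
    thus ?thesis using nzs by (intro rank_one_sum_parallel[of N _ _ _ _ w z]) auto
  qed
  have B: "parallel_upto N ?u ?hb \<or> parallel_upto N ?gb ?v"
  proof -
    obtain w z where "\<forall>c<N. \<forall>e<N. 1 * (u ((k(t := b))(t' := a')) c * v ((k(t := b))(t' := a')) e)
        + 1 * (u ((k(t := b))(t' := b')) c * v ((k(t := b))(t' := b')) e) = w c * z e"
      using pair[OF upd_K[OF k l(2)] t'(1,3,4) ab, of 1 1] by auto
    thus ?thesis using nzs \<mu> \<nu> by (intro rank_one_sum_parallel[of N _ _ _ _ w z]) (auto simp: algebra_simps)
  qed
  \<comment> \<open>The sums must not vanish if \<open>rank_one_sum_parallel\<close> is to apply to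
    them; \<open>pair\<close> with both coefficients 1 ensures this.\<close>
  have nzsum: "nonzero_upto N (\<lambda>x. ?ga x + ?gb x)" "nonzero_upto N (\<lambda>x. ?ha x + ?hb x)"
  proof -
    obtain w z where wz: "nonzero_upto N w" "nonzero_upto N z" "\<forall>c<N. \<forall>e<N.
        1 * (u (?A a) c * v (?A a) e) + 1 * (u (?A b) c * v (?A b) e) = w c * z e"
      using pair[OF kA k(2) l, of 1 1] unfolding sw by auto
    then obtain c e where "c < N" "w c \<noteq> 0" "e < N" "z e \<noteq> 0" unfolding nonzero_upto_def by blast
    hence "?u c * (?ga e + ?gb e) \<noteq> 0" using wz(3) \<mu>(2) by (simp add: algebra_simps)
    thus "nonzero_upto N (\<lambda>x. ?ga x + ?gb x)" using \<open>e < N\<close> unfolding nonzero_upto_def by auto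
  next
    obtain w z where wz: "nonzero_upto N w" "nonzero_upto N z" "\<forall>c<N. \<forall>e<N.
        1 * (u (?B a) c * v (?B a) e) + 1 * (u (?B b) c * v (?B b) e) = w c * z e"
      using pair[OF kB k(2) l, of 1 1] unfolding sw by auto
    then obtain c e where "c < N" "w c \<noteq> 0" "e < N" "z e \<noteq> 0" unfolding nonzero_upto_def by blast
    hence "(?ha c + ?hb c) * ?v e \<noteq> 0" using wz(3) \<nu>(2) by (simp add: algebra_simps)
    thus "nonzero_upto N (\<lambda>x. ?ha x + ?hb x)" using \<open>c < N\<close> unfolding nonzero_upto_def by auto
  qed
  have C: "parallel_upto N ?u (\<lambda>x. ?ha x + ?hb x) \<or> parallel_upto N (\<lambda>x. ?ga x + ?gb x) ?v"
  proof -
    obtain w z where "\<forall>c<N. \<forall>e<N.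
        u (?A a) c * v (?A a) e + u (?B a) c * v (?B a) e + (u (?A b) c * v (?A b) e + u (?B b) c * v (?B b) e) = w c * z e"
      using square[OF k t'(1,2) l t'(3,4) ab] by blast
    thus ?thesis using nzs nzsum \<mu> \<nu> by (intro rank_one_sum_parallel[of N _ _ _ _ w z]) (auto simp: algebra_simps)
  qed
  have sumc: "(\<lambda>x. ?hb x + ?ha x) = (\<lambda>x. ?ha x + ?hb x)" "(\<lambda>x. ?gb x + ?ga x) = (\<lambda>x. ?ga x + ?gb x)"
    by (auto simp: add.commute)
  have h1: "\<not> (parallel_upto N ?u ?ha \<and> parallel_upto N ?u ?hb)"
    using parh by (metis parallel_upto_sym parallel_upto_trans)
  have g1: "\<not> (parallel_upto N ?ga ?v \<and> parallel_upto N ?gb ?v)"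
    using parg by (metis parallel_upto_sym parallel_upto_trans)
  have h2: "\<not> (parallel_upto N ?u ?ha \<and> parallel_upto N ?u (\<lambda>x. ?ha x + ?hb x))"
    using h1 parallel_upto_add_cancel[of N ?u ?ha ?hb] nzs by blast
  have h3: "\<not> (parallel_upto N ?u ?hb \<and> parallel_upto N ?u (\<lambda>x. ?ha x + ?hb x))"
    using h1 parallel_upto_add_cancel[of N ?u ?hb ?ha] nzs unfolding sumc by blast
  have g2: "\<not> (parallel_upto N ?ga ?v \<and> parallel_upto N (\<lambda>x. ?ga x + ?gb x) ?v)"
    using g1 parallel_upto_add_cancel[of N ?v ?ga ?gb] nzs parallel_upto_sym by blast
  have g3: "\<not> (parallel_upto N ?gb ?v \<and> parallel_upto N (\<lambda>x. ?ga x + ?gb x) ?v)"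
    using g1 parallel_upto_add_cancel[of N ?v ?gb ?ga] nzs parallel_upto_sym unfolding sumc by blast
  show False using A B C h1 h2 h3 g1 g2 g3 by argo
qed

lemma keeps_u_global:
  assumes k: "k \<in> K" "k' \<in> K" "t \<in> T" and l: "a < dm t" "b < dm t" "a \<noteq> b" and u: "keeps_u k t a b"
  shows "keeps_u k' t a b"
proof (rule PiE_change_coordinates[where Q = "\<lambda>k. keeps_u k t a b" and S = T and k = k])
  fix x t' c assume x: "x \<in> K" "t' \<in> T" "c \<in> {..<dm t'}" "keeps_u x t a b"
  show "keeps_u (x(t' := c)) t a b"
  proof (cases "t = t'")
    case True
    thus ?thesis using x by (simp add: keeps_u_def)
  next
    case False
    have "x t' < dm t'" using x by (auto dest: PiE_mem)
    thus ?thesis using keeps_u_step[OF x(1) k(3) l x(2) False, of "x t'" c] x by simp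
  qed
qed (use k u finite_T in auto)

lemma direction_types:
  shows "\<exists>\<tau>. (\<forall>k\<in>K. \<forall>k'\<in>K. (\<forall>t\<in>T. k t \<noteq> k' t \<longrightarrow> \<tau> t) \<longrightarrow> parallel_upto N (u k) (u k')) \<and>
    (\<forall>k\<in>K. \<forall>k'\<in>K. (\<forall>t\<in>T. k t \<noteq> k' t \<longrightarrow> \<not> \<tau> t) \<longrightarrow> parallel_upto N (v k) (v k'))"
proof -
  \<comment> \<open>One move in direction \<open>t\<close> decides about all of them. A direction
    with a single value admits no move and gets \<open>False\<close>, which claims nothing since two
    indices cannot differ there.\<close>
  define \<tau> where "\<tau> t \<longleftrightarrow> (\<exists>k\<in>K. \<exists>a<dm t. \<exists>b<dm t. a \<noteq> b \<and> keeps_u k t a b)" for t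
  have u: "keeps_u k t (k t) a" if \<tau>: "\<tau> t" and k: "k \<in> K" "t \<in> T" and a: "a < dm t" for k t a
  proof (cases "a = k t")
    case False
    obtain k0 a0 b0 where "k0 \<in> K" "a0 < dm t" "b0 < dm t" "a0 \<noteq> b0" "keeps_u k0 t a0 b0"
      using \<tau> unfolding \<tau>_def by blast
    hence "keeps_u k t a0 b0" "a0 < dm t" "b0 < dm t" "a0 \<noteq> b0" using keeps_u_global k by blast+
    thus ?thesis using keeps_u_all_pairs[OF k, of a0 b0 "k t" a] k a False by (auto dest: PiE_mem)
  qed (simp add: keeps_u_def)
  have v: "keeps_v k t (k t) a" if \<tau>: "\<not> \<tau> t" and k: "k \<in> K" "t \<in> T" and a: "a < dm t" for k t a
  proof (cases "a = k t")
    case False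
    have "k t < dm t" using k by (auto dest: PiE_mem)
    moreover from this have "\<not> keeps_u k t (k t) a" using \<tau> k a False unfolding \<tau>_def by metis
    ultimately show ?thesis using keeps_u_or_v[OF k, of "k t" a] a False by simp
  qed (simp add: keeps_v_def)
  have "parallel_upto N (u k) (u k')" if k: "k \<in> K" "k' \<in> K" and d: "\<forall>t\<in>T. k t \<noteq> k' t \<longrightarrow> \<tau> t" for k k'
  proof (rule PiE_change_coordinates[where Q = "\<lambda>l. parallel_upto N (u k) (u l)" and S = "{t \<in> T. \<tau> t}" and k = k])
    fix l t a assume l: "l \<in> K" "t \<in> {t \<in> T. \<tau> t}" "a \<in> {..<dm t}" "parallel_upto N (u k) (u l)"
    thus "parallel_upto N (u k) (u (l(t := a)))"
      using u[of t l a] unfolding keeps_u_def by (auto intro: parallel_upto_trans)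
  qed (use k d finite_T in auto)
  moreover have "parallel_upto N (v k) (v k')" if k: "k \<in> K" "k' \<in> K" and d: "\<forall>t\<in>T. k t \<noteq> k' t \<longrightarrow> \<not> \<tau> t" for k k'
  proof (rule PiE_change_coordinates[where Q = "\<lambda>l. parallel_upto N (v k) (v l)" and S = "{t \<in> T. \<not> \<tau> t}" and k = k])
    fix l t a assume l: "l \<in> K" "t \<in> {t \<in> T. \<not> \<tau> t}" "a \<in> {..<dm t}" "parallel_upto N (v k) (v l)"
    thus "parallel_upto N (v k) (v (l(t := a)))"
      using v[of t l a] unfolding keeps_v_def by (auto intro: parallel_upto_trans)
  qed (use k d finite_T in auto)
  ultimately show ?thesis by blast
qed

end

subsection \<open>Isometries on product tensors\<close>

text \<open>Complete \<open>x\<close> to a basis, orthogonalise with \<open>x\<close> staying first,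
  and normalise. With such unitaries any nonzero rank one matrix is a multiple of the matrix unit at
  \<open>(0, 0)\<close> between two unitaries.\<close>

lemma unitary_first_column:
  fixes x :: "nat \<Rightarrow> complex"
  assumes "nonzero_upto n x"
  shows "\<exists>W. unitary_mat n W \<and> (\<forall>a<n. x a = complex_of_real (sqrt (\<Sum>a<n. (cmod (x a))\<^sup>2)) * W $$ (a, 0))"
proof -
  interpret cof_vec_space n "TYPE(complex)" .
  define v where "v = vec n x"
  obtain a0 where a0: "a0 < n" "x a0 \<noteq> 0" using assms unfolding nonzero_upto_def by auto
  have v: "v \<in> carrier_vec n" and v0: "v \<noteq> 0\<^sub>v n"
    using a0 unfolding v_def by (auto dest: arg_cong[of _ _ "\<lambda>w. w $ a0"])
  note bc = basis_completion[OF v v0]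
  define ws where "ws = gram_schmidt n (basis_completion v)"
  note gs = gram_schmidt_result[OF bc(2,4,5) ws_def]
  have n0: "0 < n" using a0 by simp
  have "basis_completion v = v # tl (basis_completion v)"
    using bc(6,7) n0 by (cases "basis_completion v") auto
  hence "hd ws = v" unfolding ws_def using gram_schmidt_hd[OF v] by metis
  hence ws0: "ws ! 0 = v" using gs(4) bc(6) n0 by (cases ws) auto
  have len: "length ws = n" using gs(4) bc(6) by simp
  have wsC: "ws ! k \<in> carrier_vec n" if "k < n" for k using gs(3) len that by auto
  define r where "r k = (\<Sum>a<n. (cmod (ws ! k $ a))\<^sup>2)" for k
  have ip: "ws ! j \<bullet>c ws ! i = (\<Sum>a<n. cnj (ws ! i $ a) * ws ! j $ a)" if "i < n" "j < n" for i j
    using wsC[OF that(1)] wsC[OF that(2)]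
    by (auto simp: scalar_prod_def atLeast0LessThan mult.commute intro!: sum.cong)
  have ii: "(\<Sum>a<n. cnj (ws ! i $ a) * ws ! i $ a) = complex_of_real (r i)" for i
    unfolding r_def by (simp add: complex_norm_square mult.commute del: of_real_power)
  have rp: "r i > 0" if "i < n" for i
  proof -
    have "ws ! i \<bullet>c ws ! i \<noteq> 0" using corthogonalD[OF gs(2), of i i] len that by auto
    hence "r i \<noteq> 0" using ip[OF that that] ii by auto
    moreover have "r i \<ge> 0" unfolding r_def by (intro sum_nonneg) auto
    ultimately show ?thesis by simp
  qed
  define W where "W = mat n n (\<lambda>(a, k). ws ! k $ a / complex_of_real (sqrt (r k)))"
  have "unitary_mat n W"
  proof (rule unitary_matI)
    show "W \<in> carrier_mat n n" unfolding W_def by simp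
    fix i j assume ij: "i < n" "j < n"
    have "(\<Sum>c<n. cnj (W $$ (c, i)) * W $$ (c, j))
        = (\<Sum>a<n. cnj (ws ! i $ a) * ws ! j $ a / (complex_of_real (sqrt (r i)) * complex_of_real (sqrt (r j))))"
      using ij by (intro sum.cong refl) (simp add: W_def)
    also have "\<dots> = (\<Sum>a<n. cnj (ws ! i $ a) * ws ! j $ a) / (complex_of_real (sqrt (r i)) * complex_of_real (sqrt (r j)))"
      by (simp add: sum_divide_distrib)
    also have "\<dots> = (if i = j then 1 else 0)"
    proof (cases "i = j")
      case True
      have "complex_of_real (sqrt (r i)) * complex_of_real (sqrt (r i)) = complex_of_real (r i)"
        unfolding of_real_mult[symmetric] using rp[OF ij(1)] by simp
      thus ?thesis using True ii rp[OF ij(1)] by simp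
    next
      case False
      thus ?thesis using corthogonalD[OF gs(2), of j i] len ij ip[OF ij] by simp
    qed
    finally show "(\<Sum>c<n. cnj (W $$ (c, i)) * W $$ (c, j)) = (if i = j then 1 else 0)" .
  qed
  moreover have "x a = complex_of_real (sqrt (\<Sum>a<n. (cmod (x a))\<^sup>2)) * W $$ (a, 0)" if "a < n" for a
  proof -
    have "r 0 = (\<Sum>a<n. (cmod (x a))\<^sup>2)" unfolding r_def ws0 v_def by simp
    thus ?thesis using that n0 rp[OF n0] by (simp add: W_def ws0 v_def)
  qed
  ultimately show ?thesis by blast
qed

lemma parallel_upto_orthogonal:
  assumes "parallel_upto N f g" "(\<Sum>c<N. cnj (f c) * f c) = 1"
  shows "(\<Sum>c<N. cnj (f c) * g c) \<noteq> 0"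
proof -
  obtain k where k: "k \<noteq> 0" "\<forall>a<N. g a = k * f a" using assms unfolding parallel_upto_def by auto
  have "(\<Sum>c<N. cnj (f c) * g c) = k * (\<Sum>c<N. cnj (f c) * f c)"
    using k unfolding sum_distrib_left by (intro sum.cong) auto
  thus ?thesis using k assms(2) by simp
qed

lemma parallel_upto_unit:
  assumes "parallel_upto N f g" "(\<Sum>c<N. cnj (f c) * f c) = 1" "(\<Sum>c<N. cnj (g c) * g c) = 1"
  shows "\<exists>k. cmod k = 1 \<and> (\<forall>a<N. g a = k * f a)"
proof -
  obtain k where k: "k \<noteq> 0" "\<forall>a<N. g a = k * f a" using assms unfolding parallel_upto_def by auto
  have "(\<Sum>c<N. cnj (g c) * g c) = (cnj k * k) * (\<Sum>c<N. cnj (f c) * f c)"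
    using k unfolding sum_distrib_left by (intro sum.cong) auto
  hence "cnj k * k = 1" using assms by simp
  hence "complex_of_real ((cmod k)\<^sup>2) = 1" by (simp add: complex_norm_square mult.commute del: of_real_power)
  hence "(cmod k)\<^sup>2 = 1" by (metis of_real_eq_1_iff)
  hence "cmod k = 1 \<or> cmod k = - 1" by (simp add: power2_eq_1_iff)
  hence "cmod k = 1" using norm_ge_zero[of k] by linarith
  thus ?thesis using k by blast
qed

lemma unit_nonzero_upto: "(\<Sum>c<N. cnj (f c) * f c) = 1 \<Longrightarrow> nonzero_upto N f"
  unfolding nonzero_upto_def by (rule ccontr) auto

lemma rank_one_unique:
  assumes nz: "nonzero_upto N u" "nonzero_upto N v" "nonzero_upto N u'" "nonzero_upto N v'"
    and eq: "\<And>c e. c < N \<Longrightarrow> e < N \<Longrightarrow> u c * v e = u' c * v' e"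
  shows "parallel_upto N u u'" "parallel_upto N v v'"
proof -
  obtain c0 e0 where ce: "c0 < N" "e0 < N" "u' c0 \<noteq> 0" "v' e0 \<noteq> 0" using nz unfolding nonzero_upto_def by auto
  have nz0: "u c0 \<noteq> 0" "v e0 \<noteq> 0" using eq[of c0 e0] ce by auto
  have "u' c = (v e0 / v' e0) * u c" if "c < N" for c using eq[OF that ce(2)] ce by (simp add: field_simps)
  thus "parallel_upto N u u'" unfolding parallel_upto_def using nz0 ce
    by (intro exI[of _ "v e0 / v' e0"]) auto
  have "v' e = (u c0 / u' c0) * v e" if "e < N" for e using eq[OF ce(1) that] ce by (simp add: field_simps)
  thus "parallel_upto N v v'" unfolding parallel_upto_def using nz0 ce
    by (intro exI[of _ "u c0 / u' c0"]) auto
qed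

locale product_tensor_isometry =
  fixes n :: "nat \<Rightarrow> nat" and m :: nat and p :: real and \<phi> :: "complex mat \<Rightarrow> complex mat"
  assumes pos: "\<And>s. s \<in> {1..m} \<Longrightarrow> n s > 0" and p: "1 \<le> p" "p \<noteq> 2"
    and lin: "linear_on_mats (\<Prod>s=1..m. n s) \<phi>"
    and iso: "\<And>A. (\<And>s. s \<in> {1..m} \<Longrightarrow> A s \<in> carrier_mat (n s) (n s)) \<Longrightarrow>
        schatten_norm p (\<phi> (kronecker_fam A m)) = schatten_norm p (kronecker_fam A m)"
begin

abbreviation N where "N \<equiv> \<Prod>s=1..m. n s"
abbreviation T where "T \<equiv> {1..m} \<times> (UNIV :: bool set)"
abbreviation dm where "dm \<equiv> \<lambda>t::nat \<times> bool. n (fst t)"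
abbreviation Idx where "Idx \<equiv> PiE T (\<lambda>t. {..<dm t})"

text \<open>The product tensor of the rank one matrices \<open>x s (y s)\<^sup>t\<close>; direction \<open>(s, True)\<close> holds \<open>x s\<close>
  and direction \<open>(s, False)\<close> holds \<open>y s\<close>.\<close>

definition outer_factor :: "(nat \<times> bool \<Rightarrow> nat \<Rightarrow> complex) \<Rightarrow> nat \<Rightarrow> complex mat" where
  "outer_factor z s = mat (n s) (n s) (\<lambda>(a, b). z (s, True) a * z (s, False) b)"

definition outer :: "(nat \<times> bool \<Rightarrow> nat \<Rightarrow> complex) \<Rightarrow> complex mat" where
  "outer z = kronecker_fam (outer_factor z) m"

abbreviation G where "G i j \<equiv> \<phi> (unit_mat N (enc n m i) (enc n m j))"

lemma phi_outer:
  assumes "c < N" "d < N"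
  shows "\<phi> (outer z) $$ (c, d) = (\<Sum>i\<in>midx n m. \<Sum>j\<in>midx n m.
    (\<Prod>s=1..m. z (s, True) (i s) * z (s, False) (j s)) * G i j $$ (c, d))"
proof -
  have "\<phi> (outer z) $$ (c, d) = (\<Sum>i\<in>midx n m. \<Sum>j\<in>midx n m.
      (\<Prod>s=1..m. outer_factor z s $$ (i s, j s)) * G i j $$ (c, d))"
    unfolding outer_def by (rule phi_kronecker_entry[OF lin _ assms]) (simp add: outer_factor_def)
  also have "\<dots> = (\<Sum>i\<in>midx n m. \<Sum>j\<in>midx n m.
      (\<Prod>s=1..m. z (s, True) (i s) * z (s, False) (j s)) * G i j $$ (c, d))"
    by (intro sum.cong refl arg_cong2[of _ _ _ _ "(*)"] prod.cong) (simp add: outer_factor_def midx_less)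
  finally show ?thesis .
qed

lemma phi_outer_linear:
  assumes t: "t \<in> T" and cd: "c < N" "d < N"
  shows "\<phi> (outer (z(t := (\<lambda>x. \<alpha> * f x + \<beta> * g x)))) $$ (c, d)
    = \<alpha> * \<phi> (outer (z(t := f))) $$ (c, d) + \<beta> * \<phi> (outer (z(t := g))) $$ (c, d)"
proof -
  obtain s0 b where sb: "t = (s0, b)" "s0 \<in> {1..m}" using t by auto
  \<comment> \<open>Each summand of \<open>phi_outer\<close> contains the vector of direction
    \<open>t\<close> exactly once, evaluated at \<open>x i j\<close>; \<open>q i j\<close> collects
    the remaining vectors.\<close>
  define R where "R i j = (\<Prod>s\<in>{1..m} - {s0}. z (s, True) (i s) * z (s, False) (j s))" for i j
  define q where "q i j = (if b then z (s0, False) (j s0) else z (s0, True) (i s0)) * R i j" for i j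
  define x where "x i j = (if b then i s0 else j s0)" for i j :: "nat \<Rightarrow> nat"
  have qx: "(\<Prod>s=1..m. (z(t := f)) (s, True) (i s) * (z(t := f)) (s, False) (j s)) = f (x i j) * q i j" for f i j
  proof -
    have "(\<Prod>s=1..m. (z(t := f)) (s, True) (i s) * (z(t := f)) (s, False) (j s))
        = (z(t := f)) (s0, True) (i s0) * (z(t := f)) (s0, False) (j s0) * R i j"
      unfolding R_def using sb by (subst prod.remove[of _ s0]) (auto intro!: prod.cong)
    also have "\<dots> = f (x i j) * q i j"
      unfolding q_def x_def by (cases b) (simp_all add: sb)
    finally show ?thesis .
  qed
  show ?thesis
    unfolding phi_outer[OF cd] qx sum_distrib_left sum.distrib[symmetric]
    by (intro sum.cong refl) (simp add: algebra_simps)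
qed

text \<open>Choosing unitaries adapted to the vectors makes \<open>outer z\<close> a scalar multiple
  of one member of a frame as in \<open>tensor_frame_image\<close>. The scalar \<open>r\<close>, the
  product of all lengths, is recorded so that unit vectors give \<open>r = 1\<close>.\<close>

lemma phi_outer_rank_one:
  assumes z: "\<And>t. t \<in> T \<Longrightarrow> nonzero_upto (dm t) (z t)"
  shows "\<exists>u v r. r \<noteq> 0 \<and> (\<forall>c<N. \<forall>d<N. \<phi> (outer z) $$ (c, d) = r * (u c * v d)) \<and>
    (\<Sum>c<N. cnj (u c) * u c) = 1 \<and> (\<Sum>c<N. cnj (v c) * v c) = 1 \<and>
    r = (\<Prod>s=1..m. complex_of_real (sqrt (\<Sum>a<n s. (cmod (z (s, True) a))\<^sup>2)) * complex_of_real (sqrt (\<Sum>a<n s. (cmod (z (s, False) a))\<^sup>2)))"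
proof -
  define rx where "rx s = complex_of_real (sqrt (\<Sum>a<n s. (cmod (z (s, True) a))\<^sup>2))" for s
  define ry where "ry s = complex_of_real (sqrt (\<Sum>a<n s. (cmod (z (s, False) a))\<^sup>2))" for s
  have nzc: "nonzero_upto k (\<lambda>a. cnj (f a))" if "nonzero_upto k f" for k f
    using that unfolding nonzero_upto_def by simp
  have "\<exists>W. s \<in> {1..m} \<longrightarrow> unitary_mat (n s) W \<and> (\<forall>a<n s. z (s, True) a = rx s * W $$ (a, 0))" for s
    using unitary_first_column[OF z[of "(s, True)"]] unfolding rx_def by auto
  then obtain W where W: "\<And>s. s \<in> {1..m} \<Longrightarrow> unitary_mat (n s) (W s)"
    "\<And>s a. s \<in> {1..m} \<Longrightarrow> a < n s \<Longrightarrow> z (s, True) a = rx s * W s $$ (a, 0)" by metis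
  \<comment> \<open>The second vector enters as a row without conjugation. Its conjugate is made the
    first column, so that the adjoint has the vector itself, up to its length, as first row.\<close>
  have "\<exists>W. s \<in> {1..m} \<longrightarrow> unitary_mat (n s) W \<and> (\<forall>a<n s. cnj (z (s, False) a) = ry s * W $$ (a, 0))" for s
    using unitary_first_column[OF nzc[OF z[of "(s, False)"]]] unfolding ry_def by auto
  then obtain W0 where W0: "\<And>s. s \<in> {1..m} \<Longrightarrow> unitary_mat (n s) (W0 s)"
    "\<And>s a. s \<in> {1..m} \<Longrightarrow> a < n s \<Longrightarrow> cnj (z (s, False) a) = ry s * W0 s $$ (a, 0)" by metis
  define W' where "W' s = mat_adjoint (W0 s)" for s
  have W'u: "unitary_mat (n s) (W' s)" if "s \<in> {1..m}" for s
    unfolding W'_def by (rule unitary_mat_adjoint[OF W0(1)[OF that]])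
  have W'e: "z (s, False) a = ry s * W' s $$ (0, a)" if s: "s \<in> {1..m}" and a: "a < n s" for s a
  proof -
    have "W0 s \<in> carrier_mat (n s) (n s)" using W0(1)[OF s] by (simp add: unitary_mat_def)
    hence "W' s $$ (0, a) = cnj (W0 s $$ (a, 0))"
      unfolding W'_def using a by (intro mat_adjoint_entry) auto
    thus ?thesis using arg_cong[OF W0(2)[OF s a], of cnj] by (simp add: ry_def)
  qed
  have C: "W s \<in> carrier_mat (n s) (n s)" "W' s \<in> carrier_mat (n s) (n s)" if "s \<in> {1..m}" for s
    using W(1)[OF that] W'u[OF that] by (auto simp: unitary_mat_def)
  define e0 :: "nat \<Rightarrow> nat" where "e0 = restrict (\<lambda>_. 0) {1..m}"
  have i0: "e0 \<in> midx n m" unfolding e0_def using pos by (intro restrict_PiE_iff[THEN iffD2]) auto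
  have e0: "e0 s = 0" if "s \<in> {1..m}" for s using that by (simp add: e0_def)
  define B where "B s = W s * unit_mat (n s) (e0 s) (e0 s) * W' s" for s
  have E: "unit_mat (n s) (e0 s) (e0 s) \<in> carrier_mat (n s) (n s)" for s by (simp add: unit_mat_def)
  have BC: "B s \<in> carrier_mat (n s) (n s)" if "s \<in> {1..m}" for s
    unfolding B_def by (rule mult_carrier_mat[OF mult_carrier_mat[OF C(1)[OF that] E] C(2)[OF that]])
  have Be: "B s $$ (a, b) = W s $$ (a, 0) * W' s $$ (0, b)" if s: "s \<in> {1..m}" and ab: "a < n s" "b < n s" for s a b
  proof -
    have WE: "(W s * unit_mat (n s) (e0 s) (e0 s)) $$ (a, l) = (if l = 0 then W s $$ (a, 0) else 0)" if "l < n s" for l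
    proof -
      have "(W s * unit_mat (n s) (e0 s) (e0 s)) $$ (a, l) = (\<Sum>k<n s. W s $$ (a, k) * unit_mat (n s) (e0 s) (e0 s) $$ (k, l))"
        by (rule mult_mat_entry[OF C(1)[OF s] E ab(1) that])
      also have "\<dots> = (\<Sum>k<n s. if k = 0 then (if l = 0 then W s $$ (a, 0) else 0) else 0)"
        using that by (intro sum.cong refl) (auto simp: unit_mat_def e0[OF s])
      finally show ?thesis using pos[OF s] by simp
    qed
    have "B s $$ (a, b) = (\<Sum>l<n s. (W s * unit_mat (n s) (e0 s) (e0 s)) $$ (a, l) * W' s $$ (l, b))"
      unfolding B_def by (rule mult_mat_entry[OF mult_carrier_mat[OF C(1)[OF s] E] C(2)[OF s] ab])
    also have "\<dots> = (\<Sum>l<n s. if l = 0 then W s $$ (a, 0) * W' s $$ (0, b) else 0)"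
      by (intro sum.cong refl) (simp add: WE del: index_mult_mat)
    finally show ?thesis using pos[OF s] by simp
  qed
  have "\<exists>u v. (\<forall>i\<in>midx n m. \<forall>c<N. \<forall>d<N.
      \<phi> (kronecker_fam (\<lambda>s. W s * unit_mat (n s) (i s) (i s) * W' s) m) $$ (c, d) = u (enc n m i) c * v (enc n m i) d) \<and>
    (\<forall>b<N. \<forall>b'<N. (\<Sum>c<N. cnj (u b c) * u b' c) = (if b = b' then 1 else 0)) \<and>
    (\<forall>b<N. \<forall>b'<N. (\<Sum>c<N. cnj (v b c) * v b' c) = (if b = b' then 1 else 0))"
    by (rule tensor_frame_image[OF pos p lin iso W(1) W'u]; assumption)
  then obtain u v where uv0: "\<forall>i\<in>midx n m. \<forall>c<N. \<forall>d<N.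
      \<phi> (kronecker_fam (\<lambda>s. W s * unit_mat (n s) (i s) (i s) * W' s) m) $$ (c, d) = u (enc n m i) c * v (enc n m i) d"
    "\<forall>b<N. \<forall>b'<N. (\<Sum>c<N. cnj (u b c) * u b' c) = (if b = b' then 1 else 0)"
    "\<forall>b<N. \<forall>b'<N. (\<Sum>c<N. cnj (v b c) * v b' c) = (if b = b' then 1 else 0)"
    by (elim exE conjE)
  have uv: "\<phi> (kronecker_fam B m) $$ (c, d) = u (enc n m e0) c * v (enc n m e0) d" if "c < N" "d < N" for c d
    using uv0(1) i0 that unfolding B_def by simp
  have uvn: "(\<Sum>c<N. cnj (u b c) * u b c) = 1" "(\<Sum>c<N. cnj (v b c) * v b c) = 1" if "b < N" for b
    using uv0(2,3) that by simp_all
  have "\<phi> (outer z) $$ (c, d) = (\<Prod>s=1..m. rx s * ry s) * \<phi> (kronecker_fam B m) $$ (c, d)" if cd: "c < N" "d < N" for c d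
  proof -
    have "(\<Prod>s=1..m. z (s, True) (i s) * z (s, False) (j s)) = (\<Prod>s=1..m. rx s * ry s) * (\<Prod>s=1..m. B s $$ (i s, j s))"
      if ij: "i \<in> midx n m" "j \<in> midx n m" for i j
      unfolding prod.distrib[symmetric]
      by (intro prod.cong refl) (simp add: W(2) W'e Be midx_less[OF ij(1)] midx_less[OF ij(2)])
    moreover have "\<phi> (kronecker_fam B m) $$ (c, d)
        = (\<Sum>i\<in>midx n m. \<Sum>j\<in>midx n m. (\<Prod>s=1..m. B s $$ (i s, j s)) * G i j $$ (c, d))"
      by (rule phi_kronecker_entry[OF lin BC cd])
    ultimately show ?thesis
      unfolding phi_outer[OF cd] sum_distrib_left
      by (simp only: sum_distrib_left) (intro sum.cong refl, simp only: mult.assoc)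
  qed
  moreover have "(\<Prod>s=1..m. rx s * ry s) \<noteq> 0"
  proof -
    have q: "complex_of_real (sqrt (\<Sum>a<k. (cmod (f a))\<^sup>2)) \<noteq> 0" if nzf: "nonzero_upto k f" for k and f :: "nat \<Rightarrow> complex"
    proof -
      have "(\<Sum>a<k. (cmod (f a))\<^sup>2) > 0" using nzf unfolding nonzero_upto_def by (auto intro!: sum_pos2)
      thus ?thesis by simp
    qed
    have "rx s * ry s \<noteq> 0" if "s \<in> {1..m}" for s
      unfolding rx_def ry_def using q[OF z[of "(s, True)"]] q[OF z[of "(s, False)"]] that by simp
    thus ?thesis by (simp only: prod_zero_iff finite_atLeastAtMost) blast
  qed
  ultimately show ?thesis using uv uvn[OF enc_lt[OF i0]] unfolding rx_def ry_def
    by (intro exI[of _ "u (enc n m e0)"] exI[of _ "v (enc n m e0)"] exI) (auto simp: mult.assoc)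
qed

section \<open>Images of basis tensors\<close>

definition basis_fun :: "nat \<Rightarrow> nat \<Rightarrow> complex" where
  "basis_fun a = (\<lambda>x. if x = a then 1 else 0)"

definition basis_family :: "(nat \<times> bool \<Rightarrow> nat) \<Rightarrow> nat \<times> bool \<Rightarrow> nat \<Rightarrow> complex" where
  "basis_family k = (\<lambda>t. basis_fun (k t))"

lemma basis_family_upd: "basis_family (k(t := a)) = (basis_family k)(t := basis_fun a)"
  unfolding basis_family_def by auto

definition pair_idx :: "(nat \<Rightarrow> nat) \<Rightarrow> (nat \<Rightarrow> nat) \<Rightarrow> nat \<times> bool \<Rightarrow> nat" where
  "pair_idx i j = restrict (\<lambda>t. if snd t then i (fst t) else j (fst t)) T"

lemma pair_idx_mem: "i \<in> midx n m \<Longrightarrow> j \<in> midx n m \<Longrightarrow> pair_idx i j \<in> Idx"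
  unfolding pair_idx_def by (rule restrict_PiE_iff[THEN iffD2]) (simp add: midx_less mem_Times_iff)

lemma outer_pair_idx:
  assumes ij: "i \<in> midx n m" "j \<in> midx n m"
  shows "outer (basis_family (pair_idx i j)) = unit_mat N (enc n m i) (enc n m j)"
proof -
  have "outer (basis_family (pair_idx i j)) = kronecker_fam (\<lambda>s. unit_mat (n s) (i s) (j s)) m"
    unfolding outer_def
    by (rule kronecker_fam_cong)
      (auto simp: outer_factor_def unit_mat_def basis_family_def basis_fun_def pair_idx_def intro!: cong_mat)
  thus ?thesis by (simp only: kronecker_fam_unit_mat[OF ij])
qed

lemma basis_fun_nonzero: "a < l \<Longrightarrow> nonzero_upto l (basis_fun a)"
  unfolding nonzero_upto_def basis_fun_def by auto

lemma Idx_less: "k \<in> Idx \<Longrightarrow> t \<in> T \<Longrightarrow> k t < dm t"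
  using PiE_mem[of k T "\<lambda>t. {..<dm t}" t] by simp

lemma basis_family_nonzero: "k \<in> Idx \<Longrightarrow> t \<in> T \<Longrightarrow> nonzero_upto (dm t) (basis_family k t)"
  unfolding basis_family_def by (rule basis_fun_nonzero, rule Idx_less)

lemma basis_family_image:
  assumes k: "k \<in> Idx"
  shows "\<exists>u v. (\<forall>c<N. \<forall>d<N. \<phi> (outer (basis_family k)) $$ (c, d) = u c * v d) \<and>
    (\<Sum>c<N. cnj (u c) * u c) = 1 \<and> (\<Sum>c<N. cnj (v c) * v c) = 1"
proof -
  have "(\<Sum>a<n s. (cmod (basis_family k (s, b) a))\<^sup>2) = 1" if s: "s \<in> {1..m}" for s b
  proof -
    have "(\<Sum>a<n s. (cmod (basis_family k (s, b) a))\<^sup>2) = (\<Sum>a<n s. if a = k (s, b) then 1 else 0)"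
      unfolding basis_family_def basis_fun_def by (intro sum.cong refl) auto
    thus ?thesis using Idx_less[OF k, of "(s, b)"] s by simp
  qed
  hence r: "(\<Prod>s=1..m. complex_of_real (sqrt (\<Sum>a<n s. (cmod (basis_family k (s, True) a))\<^sup>2)) *
      complex_of_real (sqrt (\<Sum>a<n s. (cmod (basis_family k (s, False) a))\<^sup>2))) = 1"
    by (intro prod.neutral) auto
  show ?thesis using phi_outer_rank_one[OF basis_family_nonzero[OF k]] unfolding r by auto
qed

lemma rank_one_witness:
  assumes "\<And>t. t \<in> T \<Longrightarrow> nonzero_upto (dm t) (z t)"
  shows "\<exists>w y. nonzero_upto N w \<and> nonzero_upto N y \<and> (\<forall>c<N. \<forall>d<N. \<phi> (outer z) $$ (c, d) = w c * y d)"
proof -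
  obtain u v r where r: "r \<noteq> 0" and uv: "\<forall>c<N. \<forall>d<N. \<phi> (outer z) $$ (c, d) = r * (u c * v d)"
    and nu: "(\<Sum>c<N. cnj (u c) * u c) = 1" and nv: "(\<Sum>c<N. cnj (v c) * v c) = 1"
    by (rule exE[OF phi_outer_rank_one[of z]], erule assms, elim exE conjE, rule that; assumption)
  have "nonzero_upto N (\<lambda>c. r * u c)" using unit_nonzero_upto[OF nu] r unfolding nonzero_upto_def by auto
  moreover have "nonzero_upto N v" by (rule unit_nonzero_upto[OF nv])
  ultimately show ?thesis using uv by (intro exI[of _ "\<lambda>c. r * u c"] exI[of _ v]) (auto simp: mult.assoc)
qed

text \<open>The conditions \<open>pair\<close> and \<open>square\<close> are instances of
  \<open>rank_one_witness\<close> in which one or two basis vectors are replaced by combinations of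
  two, expanded by linearity in those directions.\<close>

lemma rank_one_family_basis:
  assumes F: "\<And>k c d. k \<in> Idx \<Longrightarrow> c < N \<Longrightarrow> d < N \<Longrightarrow> \<phi> (outer (basis_family k)) $$ (c, d) = u k c * v k d"
    and nu: "\<And>k. k \<in> Idx \<Longrightarrow> (\<Sum>c<N. cnj (u k c) * u k c) = 1"
    and nv: "\<And>k. k \<in> Idx \<Longrightarrow> (\<Sum>c<N. cnj (v k c) * v k c) = 1"
  shows "rank_one_family T dm N u v"
proof
  show "finite T" by simp
  show "nonzero_upto N (u k) \<and> nonzero_upto N (v k)" if "k \<in> Idx" for k
    using unit_nonzero_upto[OF nu[OF that]] unit_nonzero_upto[OF nv[OF that]] by simp
  have upd: "k(t := a) \<in> Idx" if "k \<in> Idx" "t \<in> T" "a < dm t" for k t a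
    using that by (intro PiE_fun_upd_mem) auto
  {
    fix k t a b and \<alpha> \<beta> :: complex
    assume k: "k \<in> Idx" and t: "t \<in> T" and ab: "a < dm t" "b < dm t" "a \<noteq> b" and nz: "\<alpha> \<noteq> 0 \<or> \<beta> \<noteq> 0"
    let ?z = "(basis_family k)(t := (\<lambda>x. \<alpha> * basis_fun a x + \<beta> * basis_fun b x))"
    have "nonzero_upto (dm t) (\<lambda>x. \<alpha> * basis_fun a x + \<beta> * basis_fun b x)"
    proof (cases "\<alpha> = 0")
      case True
      thus ?thesis using ab nz unfolding nonzero_upto_def basis_fun_def by (intro exI[of _ b]) auto
    next
      case False
      thus ?thesis using ab unfolding nonzero_upto_def basis_fun_def by (intro exI[of _ a]) auto
    qed
    hence "nonzero_upto (dm t') (?z t')" if "t' \<in> T" for t'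
      using basis_family_nonzero[OF k that] by (cases "t' = t") simp_all
    then obtain w y where wy: "nonzero_upto N w" "nonzero_upto N y" "\<forall>c<N. \<forall>d<N. \<phi> (outer ?z) $$ (c, d) = w c * y d"
      using rank_one_witness[of ?z] by blast
    have "\<alpha> * (u (k(t := a)) c * v (k(t := a)) e) + \<beta> * (u (k(t := b)) c * v (k(t := b)) e) = w c * y e"
      if "c < N" "e < N" for c e
      using wy(3) that phi_outer_linear[OF t that, of "basis_family k" \<alpha> "basis_fun a" \<beta> "basis_fun b"]
      unfolding basis_family_upd[symmetric] by (simp add: F[OF upd[OF k t ab(1)]] F[OF upd[OF k t ab(2)]])
    thus "\<exists>w z. nonzero_upto N w \<and> nonzero_upto N z \<and> (\<forall>c<N. \<forall>e<N.
        \<alpha> * (u (k(t := a)) c * v (k(t := a)) e) + \<beta> * (u (k(t := b)) c * v (k(t := b)) e) = w c * z e)"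
      using wy(1,2) by blast
  }
  fix k t t' a b a' b'
  assume k: "k \<in> Idx" and t: "t \<in> T" "t' \<in> T" "t \<noteq> t'" and ab: "a < dm t" "b < dm t" "a \<noteq> b"
    and ab': "a' < dm t'" "b' < dm t'" "a' \<noteq> b'"
  let ?f = "\<lambda>a b x. 1 * basis_fun a x + 1 * basis_fun b x"
  let ?z = "(basis_family k)(t := ?f a b, t' := ?f a' b')"
  have fn: "nonzero_upto l (?f a b)" if "a < l" "a \<noteq> b" for a b l
    unfolding nonzero_upto_def basis_fun_def using that by (intro exI[of _ a]) auto
  have "nonzero_upto (dm x) (?z x)" if "x \<in> T" for x
    using basis_family_nonzero[OF k that] fn[OF ab(1,3)] fn[OF ab'(1,3)] t by (cases "x = t'"; cases "x = t") simp_all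
  then obtain w y where wy: "\<forall>c<N. \<forall>d<N. \<phi> (outer ?z) $$ (c, d) = w c * y d"
    using rank_one_witness[of ?z] by blast
  have F2: "\<phi> (outer ((basis_family k)(t := basis_fun x, t' := basis_fun x'))) $$ (c, e)
      = u (k(t := x, t' := x')) c * v (k(t := x, t' := x')) e"
    if "x < dm t" "x' < dm t'" "c < N" "e < N" for x x' c e
    using F[OF upd[OF upd[OF k t(1) that(1)] t(2) that(2)] that(3,4)] unfolding basis_family_upd .
  have half: "\<phi> (outer ((basis_family k)(t := ?f a b, t' := basis_fun x'))) $$ (c, e)
      = u (k(t := a, t' := x')) c * v (k(t := a, t' := x')) e + u (k(t := b, t' := x')) c * v (k(t := b, t' := x')) e"
    if x': "x' < dm t'" and ce: "c < N" "e < N" for x' c e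
  proof -
    have tw: "(basis_family k)(t := f, t' := basis_fun x') = ((basis_family k)(t' := basis_fun x'))(t := f)" for f
      using t(3) by (simp add: fun_upd_twist)
    show ?thesis
      using phi_outer_linear[OF t(1) ce, of "(basis_family k)(t' := basis_fun x')" 1 "basis_fun a" 1 "basis_fun b"]
      unfolding tw[symmetric] F2[OF ab(1) x' ce] F2[OF ab(2) x' ce] by simp
  qed
  have "u (k(t := a, t' := a')) c * v (k(t := a, t' := a')) e + u (k(t := a, t' := b')) c * v (k(t := a, t' := b')) e +
      (u (k(t := b, t' := a')) c * v (k(t := b, t' := a')) e + u (k(t := b, t' := b')) c * v (k(t := b, t' := b')) e)
      = w c * y e" if ce: "c < N" "e < N" for c e
  proof -
    have "\<phi> (outer ?z) $$ (c, e)
        = 1 * \<phi> (outer ((basis_family k)(t := ?f a b, t' := basis_fun a'))) $$ (c, e)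
        + 1 * \<phi> (outer ((basis_family k)(t := ?f a b, t' := basis_fun b'))) $$ (c, e)"
      by (rule phi_outer_linear[OF t(2) ce])
    thus ?thesis using wy ce unfolding half[OF ab'(1) ce] half[OF ab'(2) ce] by (simp add: add_ac)
  qed
  thus "\<exists>w z. \<forall>c<N. \<forall>e<N.
        u (k(t := a, t' := a')) c * v (k(t := a, t' := a')) e + u (k(t := a, t' := b')) c * v (k(t := a, t' := b')) e +
        (u (k(t := b, t' := a')) c * v (k(t := b, t' := a')) e + u (k(t := b, t' := b')) c * v (k(t := b, t' := b')) e)
        = w c * z e"
    by blast
qed

text \<open>The frame for identity unitaries. It supplies the orthogonality between different
  indices that the separately chosen factors of the images of basis tensors do not show.\<close>

lemma diagonal_frame:
  "\<exists>u v. (\<forall>i\<in>midx n m. \<forall>c<N. \<forall>d<N. G i i $$ (c, d) = u (enc n m i) c * v (enc n m i) d) \<and>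
    (\<forall>b<N. \<forall>b'<N. (\<Sum>c<N. cnj (u b c) * u b' c) = (if b = b' then 1 else 0)) \<and>
    (\<forall>b<N. \<forall>b'<N. (\<Sum>c<N. cnj (v b c) * v b' c) = (if b = b' then 1 else 0))"
proof -
  have one: "unitary_mat (n s) (1\<^sub>m (n s))" for s
    by (rule unitary_matI) (auto simp: if_distrib cong: if_cong)
  have "kronecker_fam (\<lambda>s. 1\<^sub>m (n s) * unit_mat (n s) (i s) (i s) * 1\<^sub>m (n s)) m = unit_mat N (enc n m i) (enc n m i)"
    if "i \<in> midx n m" for i
  proof -
    have "1\<^sub>m (n s) * unit_mat (n s) (i s) (i s) * 1\<^sub>m (n s) = unit_mat (n s) (i s) (i s)" for s
      by (simp add: unit_mat_def)
    thus ?thesis using kronecker_fam_unit_mat[OF that that] by simp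
  qed
  moreover have "\<exists>u v. (\<forall>i\<in>midx n m. \<forall>c<N. \<forall>d<N.
      \<phi> (kronecker_fam (\<lambda>s. 1\<^sub>m (n s) * unit_mat (n s) (i s) (i s) * 1\<^sub>m (n s)) m) $$ (c, d) = u (enc n m i) c * v (enc n m i) d) \<and>
    (\<forall>b<N. \<forall>b'<N. (\<Sum>c<N. cnj (u b c) * u b' c) = (if b = b' then 1 else 0)) \<and>
    (\<forall>b<N. \<forall>b'<N. (\<Sum>c<N. cnj (v b c) * v b' c) = (if b = b' then 1 else 0))"
    by (rule tensor_frame_image[OF pos p lin iso one one]; assumption)
  ultimately show ?thesis by (simp cong: ball_cong)
qed

text \<open>Once row and column indices are interchanged in the transposing factors, each matrix
  unit is sent to a phase times a left vector determined by \<open>i\<close> and a right vector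
  determined by \<open>j\<close>. These come from the diagonal frame, hence are orthonormal;
  rescaled, they form the columns of \<open>U\<close> and the rows of \<open>V\<close>.\<close>

lemma factorization:
  "\<exists>U V \<psi>. unitary_mat N U \<and> unitary_mat N V \<and>
    (\<forall>s\<in>{1..m}. (\<forall>X\<in>carrier_mat (n s) (n s). \<psi> s X = X) \<or>
                 (\<forall>X\<in>carrier_mat (n s) (n s). \<psi> s X = transpose_mat X)) \<and>
    (\<forall>A. (\<forall>i\<in>{1..m}. A i \<in> carrier_mat (n i) (n i)) \<longrightarrow>
       \<phi> (kronecker_fam A m) = U * kronecker_fam (\<lambda>s. \<psi> s (A s)) m * V)"
proof -
  let ?rk1 = "\<lambda>k u v. (\<forall>c<N. \<forall>d<N. \<phi> (outer (basis_family k)) $$ (c, d) = u c * v d) \<and>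
    (\<Sum>c<N. cnj (u c) * u c) = 1 \<and> (\<Sum>c<N. cnj (v c) * v c) = 1"
  have "\<forall>k\<in>Idx. \<exists>u v. ?rk1 k u v" by (intro ballI basis_family_image)
  from bchoice[OF this] obtain u where "\<forall>k\<in>Idx. \<exists>v. ?rk1 k (u k) v" by (elim exE)
  from bchoice[OF this] obtain v where "\<forall>k\<in>Idx. ?rk1 k (u k) (v k)" by (elim exE)
  hence F: "\<And>k c d. k \<in> Idx \<Longrightarrow> c < N \<Longrightarrow> d < N \<Longrightarrow> \<phi> (outer (basis_family k)) $$ (c, d) = u k c * v k d"
    and nu: "\<And>k. k \<in> Idx \<Longrightarrow> (\<Sum>c<N. cnj (u k c) * u k c) = 1"
    and nv: "\<And>k. k \<in> Idx \<Longrightarrow> (\<Sum>c<N. cnj (v k c) * v k c) = 1"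
    by simp_all
  interpret R: rank_one_family T dm N u v by (rule rank_one_family_basis[OF F nu nv])
  obtain \<tau> where \<tau>: "\<forall>k\<in>Idx. \<forall>k'\<in>Idx. (\<forall>t\<in>T. k t \<noteq> k' t \<longrightarrow> \<tau> t) \<longrightarrow> parallel_upto N (u k) (u k')"
    "\<forall>k\<in>Idx. \<forall>k'\<in>Idx. (\<forall>t\<in>T. k t \<noteq> k' t \<longrightarrow> \<not> \<tau> t) \<longrightarrow> parallel_upto N (v k) (v k')"
    by (rule exE[OF R.direction_types]) (elim conjE, rule that; assumption)
  have \<tau>u: "parallel_upto N (u k) (u k')" if "k \<in> Idx" "k' \<in> Idx" "\<And>t. t \<in> T \<Longrightarrow> k t \<noteq> k' t \<Longrightarrow> \<tau> t" for k k'
    using \<tau>(1)[rule_format, OF that] by simp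
  have \<tau>v: "parallel_upto N (v k) (v k')" if "k \<in> Idx" "k' \<in> Idx" "\<And>t. t \<in> T \<Longrightarrow> k t \<noteq> k' t \<Longrightarrow> \<not> \<tau> t" for k k'
    using \<tau>(2)[rule_format, OF that] by simp
  obtain u0 v0 where G0: "\<forall>i\<in>midx n m. \<forall>c<N. \<forall>d<N. G i i $$ (c, d) = u0 (enc n m i) c * v0 (enc n m i) d"
    and ou: "\<forall>b<N. \<forall>b'<N. (\<Sum>c<N. cnj (u0 b c) * u0 b' c) = (if b = b' then 1 else 0)"
    and ov: "\<forall>b<N. \<forall>b'<N. (\<Sum>c<N. cnj (v0 b c) * v0 b' c) = (if b = b' then 1 else 0)"
    by (rule exE[OF diagonal_frame]) (elim exE conjE, rule that; assumption)
  have u01: "(\<Sum>c<N. cnj (u0 (enc n m i) c) * u0 (enc n m i) c) = 1"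
    and v01: "(\<Sum>c<N. cnj (v0 (enc n m i) c) * v0 (enc n m i) c) = 1" if "i \<in> midx n m" for i
    using ou ov enc_lt[OF that] by simp_all
  have diag: "parallel_upto N (u0 (enc n m i)) (u (pair_idx i i))" "parallel_upto N (v0 (enc n m i)) (v (pair_idx i i))"
    if i: "i \<in> midx n m" for i
  proof -
    note K = pair_idx_mem[OF i i]
    have eq: "u0 (enc n m i) c * v0 (enc n m i) d = u (pair_idx i i) c * v (pair_idx i i) d" if "c < N" "d < N" for c d
      using F[OF K that] G0 i that by (simp add: outer_pair_idx[OF i i])
    note nzs = unit_nonzero_upto[OF u01[OF i]] unit_nonzero_upto[OF v01[OF i]]
      unit_nonzero_upto[OF nu[OF K]] unit_nonzero_upto[OF nv[OF K]]
    show "parallel_upto N (u0 (enc n m i)) (u (pair_idx i i))" "parallel_upto N (v0 (enc n m i)) (v (pair_idx i i))"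
      using rank_one_unique[OF nzs eq] by auto
  qed
  text \<open>Rows and columns of a factor cannot both keep \<open>u\<close>, nor both keep \<open>v\<close>, since the images of two
    diagonal matrix units are orthogonal.\<close>
  have opposite: "\<tau> (s, True) \<longleftrightarrow> \<not> \<tau> (s, False)" if s: "s \<in> {1..m}" "n s \<ge> 2" for s
  proof -
    define i where "i = restrict (\<lambda>_. 0::nat) {1..m}"
    define j where "j = i(s := 1)"
    have i: "i \<in> midx n m" unfolding i_def using pos by (intro restrict_PiE_iff[THEN iffD2]) auto
    have j: "j \<in> midx n m" unfolding j_def using i s by (intro PiE_fun_upd_mem) auto
    have ijs: "i s \<noteq> j s" using s by (simp add: i_def j_def)
    hence e: "enc n m i \<noteq> enc n m j" using enc_eq_iff[OF i j] by auto
    have only: "t = (s, True) \<or> t = (s, False)" if "t \<in> T" "pair_idx i i t \<noteq> pair_idx j j t" for t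
      using that by (cases t) (auto simp: pair_idx_def j_def split: if_splits)
    have Ki: "pair_idx i i \<in> Idx" and Kj: "pair_idx j j \<in> Idx" using pair_idx_mem i j by auto
    have "\<not> (\<tau> (s, True) \<and> \<tau> (s, False))"
    proof
      assume a: "\<tau> (s, True) \<and> \<tau> (s, False)"
      have "parallel_upto N (u (pair_idx i i)) (u (pair_idx j j))"
        by (rule \<tau>u[OF Ki Kj], drule (1) only) (use a in auto)
      hence "parallel_upto N (u0 (enc n m i)) (u0 (enc n m j))"
        using diag(1)[OF i] diag(1)[OF j] by (metis parallel_upto_sym parallel_upto_trans)
      from parallel_upto_orthogonal[OF this u01[OF i]] show False
        using ou enc_lt[OF i] enc_lt[OF j] e by simp
    qed
    moreover have "\<not> (\<not> \<tau> (s, True) \<and> \<not> \<tau> (s, False))"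
    proof
      assume a: "\<not> \<tau> (s, True) \<and> \<not> \<tau> (s, False)"
      have "parallel_upto N (v (pair_idx i i)) (v (pair_idx j j))"
        by (rule \<tau>v[OF Ki Kj], drule (1) only) (use a in auto)
      hence "parallel_upto N (v0 (enc n m i)) (v0 (enc n m j))"
        using diag(2)[OF i] diag(2)[OF j] by (metis parallel_upto_sym parallel_upto_trans)
      from parallel_upto_orthogonal[OF this v01[OF i]] show False
        using ov enc_lt[OF i] enc_lt[OF j] e by simp
    qed
    ultimately show ?thesis by blast
  qed
  \<comment> \<open>If moving the column index of factor \<open>s\<close> keeps \<open>u\<close>,
    then \<open>u\<close> follows the row index and nothing is changed; otherwise the roles are
    exchanged. In \<open>sw i j\<close> all directions holding a component of \<open>i\<close> are
    thus those that influence \<open>u\<close>.\<close>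
  define fst_idx where "fst_idx i j = restrict (\<lambda>s. if \<tau> (s, False) then i s else j s) {1..m}" for i j :: "nat \<Rightarrow> nat"
  have fst_mem: "fst_idx i j \<in> midx n m" if "i \<in> midx n m" "j \<in> midx n m" for i j
    unfolding fst_idx_def by (rule restrict_PiE_iff[THEN iffD2]) (use midx_less[OF that(1)] midx_less[OF that(2)] in auto)
  have fst_s: "fst_idx i j s = (if \<tau> (s, False) then i s else j s)" if "s \<in> {1..m}" for i j s
    using that by (simp add: fst_idx_def)
  have fst_same: "fst_idx i i = i" if "i \<in> midx n m" for i
    by (rule PiE_ext[OF fst_mem[OF that that] that]) (simp add: fst_s)
  have fst_inv: "fst_idx (fst_idx i j) (fst_idx j i) = i" if "i \<in> midx n m" "j \<in> midx n m" for i j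
    by (rule PiE_ext[OF fst_mem[OF fst_mem[OF that] fst_mem[OF that(2,1)]] that(1)]) (simp add: fst_s)
  define sw where "sw i j = pair_idx (fst_idx i j) (fst_idx j i)" for i j
  have sw_mem: "sw i j \<in> Idx" if "i \<in> midx n m" "j \<in> midx n m" for i j
    unfolding sw_def by (intro pair_idx_mem fst_mem that)
  have sw_True: "sw i j (s, True) = (if \<tau> (s, False) then i s else j s)"
    and sw_False: "sw i j (s, False) = (if \<tau> (s, False) then j s else i s)" if "s \<in> {1..m}" for i j s
    using that by (simp_all add: sw_def pair_idx_def fst_s)
  have ge2: "n s \<ge> 2" if "i \<in> midx n m" "j \<in> midx n m" "s \<in> {1..m}" "i s \<noteq> j s" for i j s
    using midx_less[OF that(1,3)] midx_less[OF that(2,3)] that(4) by linarith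
  \<comment> \<open>The two indices differ only in directions holding a component of
    \<open>j\<close>. In a factor where they do differ the size is at least 2, so
    \<open>opposite\<close> applies and shows that these directions keep \<open>u\<close>.\<close>
  have sw_u: "parallel_upto N (u (sw i i)) (u (sw i j))" if ij: "i \<in> midx n m" "j \<in> midx n m" for i j
  proof (rule \<tau>u[OF sw_mem[OF ij(1,1)] sw_mem[OF ij]])
    fix t assume t: "t \<in> T" "sw i i t \<noteq> sw i j t"
    obtain s b where sb: "t = (s, b)" "s \<in> {1..m}" using t(1) by auto
    show "\<tau> t" using t(2) opposite[OF sb(2) ge2[OF ij sb(2)]] unfolding sb(1)
      by (cases b) (auto simp: sw_True[OF sb(2)] sw_False[OF sb(2)] split: if_splits)
  qed
  have sw_v: "parallel_upto N (v (sw j j)) (v (sw i j))" if ij: "i \<in> midx n m" "j \<in> midx n m" for i j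
  proof (rule \<tau>v[OF sw_mem[OF ij(2,2)] sw_mem[OF ij]])
    fix t assume t: "t \<in> T" "sw j j t \<noteq> sw i j t"
    obtain s b where sb: "t = (s, b)" "s \<in> {1..m}" using t(1) by auto
    show "\<not> \<tau> t" using t(2) opposite[OF sb(2) ge2[OF ij sb(2)]] unfolding sb(1)
      by (cases b) (auto simp: sw_True[OF sb(2)] sw_False[OF sb(2)] split: if_splits)
  qed
  have gex: "\<exists>g. cmod g = 1 \<and> (\<forall>c<N. \<forall>d<N. \<phi> (outer (basis_family (sw i j))) $$ (c, d) = g * (u0 (enc n m i) c * v0 (enc n m j) d))"
    if ij: "i \<in> midx n m" "j \<in> midx n m" for i j
  proof -
    have "parallel_upto N (u0 (enc n m i)) (u (sw i j))"
      using parallel_upto_trans[OF diag(1)[OF ij(1)] sw_u[OF ij, unfolded sw_def[of i i] fst_same[OF ij(1)]]] .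
    then obtain g1 where g1: "cmod g1 = 1" "\<forall>c<N. u (sw i j) c = g1 * u0 (enc n m i) c"
      using parallel_upto_unit u01[OF ij(1)] nu[OF sw_mem[OF ij]] by blast
    have "parallel_upto N (v0 (enc n m j)) (v (sw i j))"
      using parallel_upto_trans[OF diag(2)[OF ij(2)] sw_v[OF ij, unfolded sw_def[of j j] fst_same[OF ij(2)]]] .
    then obtain g2 where g2: "cmod g2 = 1" "\<forall>c<N. v (sw i j) c = g2 * v0 (enc n m j) c"
      using parallel_upto_unit v01[OF ij(2)] nv[OF sw_mem[OF ij]] by blast
    show ?thesis
      using g1 g2 by (intro exI[of _ "g1 * g2"]) (simp add: F[OF sw_mem[OF ij]] norm_mult)
  qed
  define g where "g i j = (SOME g. cmod g = 1 \<and> (\<forall>c<N. \<forall>d<N.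
    \<phi> (outer (basis_family (sw i j))) $$ (c, d) = g * (u0 (enc n m i) c * v0 (enc n m j) d)))" for i j
  have g1: "cmod (g i j) = 1"
    and g: "\<And>c d. c < N \<Longrightarrow> d < N \<Longrightarrow>
      \<phi> (outer (basis_family (sw i j))) $$ (c, d) = g i j * (u0 (enc n m i) c * v0 (enc n m j) d)"
    if "i \<in> midx n m" "j \<in> midx n m" for i j
    using someI_ex[OF gex[OF that], folded g_def] by simp_all
  \<comment> \<open>The relabelling of pairs is an involution by \<open>fst_inv\<close>.\<close>
  have swap_sum: "(\<Sum>i\<in>midx n m. \<Sum>j\<in>midx n m. h i j) = (\<Sum>i\<in>midx n m. \<Sum>j\<in>midx n m. h (fst_idx i j) (fst_idx j i))"
    for h :: "(nat \<Rightarrow> nat) \<Rightarrow> (nat \<Rightarrow> nat) \<Rightarrow> complex"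
  proof -
    let ?s = "\<lambda>(i, j). (fst_idx i j, fst_idx j i)"
    have "bij_betw ?s (midx n m \<times> midx n m) (midx n m \<times> midx n m)"
      by (rule bij_betw_byWitness[where f' = ?s]) (clarify, simp add: fst_inv fst_mem)+
    from sum.reindex_bij_betw[OF this, of "\<lambda>(i, j). h i j"] show ?thesis
      by (simp add: sum.cartesian_product case_prod_unfold)
  qed
  have Gsw: "G (fst_idx i j) (fst_idx j i) $$ (c, d) = g i j * (u0 (enc n m i) c * v0 (enc n m j) d)"
    if "i \<in> midx n m" "j \<in> midx n m" "c < N" "d < N" for i j c d
    using g[OF that] unfolding sw_def outer_pair_idx[OF fst_mem[OF that(1,2)] fst_mem[OF that(2,1)]] .
  text \<open>The image of the rank one product tensor with all entries \<open>1\<close> shows that \<open>g\<close> has rank one.\<close>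
  have "nonzero_upto (dm t) (\<lambda>_. 1)" if "t \<in> T" for t
    using pos that unfolding nonzero_upto_def by (auto simp: mem_Times_iff)
  hence "\<exists>w y. nonzero_upto N w \<and> nonzero_upto N y \<and> (\<forall>c<N. \<forall>d<N. \<phi> (outer (\<lambda>_ _. 1)) $$ (c, d) = w c * y d)"
    by (rule rank_one_witness)
  then obtain w y where wy: "\<forall>c<N. \<forall>d<N. \<phi> (outer (\<lambda>_ _. 1)) $$ (c, d) = w c * y d"
    by (elim exE conjE)
  \<comment> \<open>Pairing the image \<open>w c * y d\<close> with the orthonormal vectors
    \<open>u0\<close> and \<open>v0\<close> isolates the single coefficient \<open>g i j\<close>,
    and the pairing of a product is a product.\<close>
  define \<alpha> where "\<alpha> i = (\<Sum>c<N. cnj (u0 (enc n m i) c) * w c)" for i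
  define \<beta> where "\<beta> j = (\<Sum>d<N. cnj (v0 (enc n m j) d) * y d)" for j
  have sums: "w c * y d = (\<Sum>i\<in>midx n m. \<Sum>j\<in>midx n m. g i j * (u0 (enc n m i) c * v0 (enc n m j) d))" if cd: "c < N" "d < N" for c d
  proof -
    have "w c * y d = (\<Sum>i\<in>midx n m. \<Sum>j\<in>midx n m. G i j $$ (c, d))"
      using wy cd phi_outer[OF cd, of "\<lambda>_ _. 1"] by simp
    also have "\<dots> = (\<Sum>i\<in>midx n m. \<Sum>j\<in>midx n m. G (fst_idx i j) (fst_idx j i) $$ (c, d))" by (rule swap_sum)
    finally show ?thesis using cd by (simp add: Gsw)
  qed
  have g_prod: "g i j = \<alpha> i * \<beta> j" if ij: "i \<in> midx n m" "j \<in> midx n m" for i j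
  proof -
    have "\<alpha> i * \<beta> j = (\<Sum>c<N. \<Sum>d<N. cnj (u0 (enc n m i) c) * cnj (v0 (enc n m j) d) * (w c * y d))"
      unfolding \<alpha>_def \<beta>_def sum_product by (simp add: mult_ac)
    also have "\<dots> = (\<Sum>c<N. \<Sum>d<N. \<Sum>k\<in>midx n m. \<Sum>l\<in>midx n m. g k l *
        ((cnj (u0 (enc n m i) c) * u0 (enc n m k) c) * (cnj (v0 (enc n m j) d) * v0 (enc n m l) d)))"
      by (intro sum.cong refl) (simp add: sums sum_distrib_left mult_ac)
    also have "\<dots> = (\<Sum>c<N. \<Sum>k\<in>midx n m. \<Sum>d<N. \<Sum>l\<in>midx n m. g k l *
        ((cnj (u0 (enc n m i) c) * u0 (enc n m k) c) * (cnj (v0 (enc n m j) d) * v0 (enc n m l) d)))"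
      by (rule sum.cong[OF refl], rule sum.swap)
    also have "\<dots> = (\<Sum>k\<in>midx n m. \<Sum>c<N. \<Sum>l\<in>midx n m. \<Sum>d<N. g k l *
        ((cnj (u0 (enc n m i) c) * u0 (enc n m k) c) * (cnj (v0 (enc n m j) d) * v0 (enc n m l) d)))"
      by (subst sum.swap, rule sum.cong[OF refl], rule sum.cong[OF refl], rule sum.swap)
    also have "\<dots> = (\<Sum>k\<in>midx n m. \<Sum>l\<in>midx n m. \<Sum>c<N. \<Sum>d<N. g k l *
        ((cnj (u0 (enc n m i) c) * u0 (enc n m k) c) * (cnj (v0 (enc n m j) d) * v0 (enc n m l) d)))"
      by (rule sum.cong[OF refl], rule sum.swap)
    also have "\<dots> = (\<Sum>k\<in>midx n m. \<Sum>l\<in>midx n m. g k l *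
        ((\<Sum>c<N. cnj (u0 (enc n m i) c) * u0 (enc n m k) c) * (\<Sum>d<N. cnj (v0 (enc n m j) d) * v0 (enc n m l) d)))"
      unfolding sum_product by (simp only: sum_distrib_left)
    also have "\<dots> = (\<Sum>k\<in>midx n m. \<Sum>l\<in>midx n m. if l = j then if k = i then g i j else 0 else 0)"
      using ou ov ij by (intro sum.cong refl) (auto simp: enc_lt enc_eq_iff)
    also have "\<dots> = g i j" using ij by (simp add: sum.delta finite_PiE)
    finally show ?thesis ..
  qed
  define e0 where "e0 = restrict (\<lambda>_. 0::nat) {1..m}"
  have e0: "e0 \<in> midx n m" unfolding e0_def using pos by (intro restrict_PiE_iff[THEN iffD2]) auto
  \<comment> \<open>From \<open>cmod (g i j) = 1\<close> one gets only that the moduli of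
    \<open>\<alpha> i\<close> and \<open>\<beta> j\<close> have product 1. So the former is
    constant, and dividing one family by it and multiplying the other yields phases.\<close>
  define \<rho> where "\<rho> = complex_of_real (cmod (\<alpha> e0))"
  have \<rho>: "\<rho> \<noteq> 0" using g1[OF e0 e0] g_prod[OF e0 e0] unfolding \<rho>_def by auto
  have a1: "cmod (\<alpha> i / \<rho>) = 1" if i: "i \<in> midx n m" for i
  proof -
    have "cmod (\<alpha> i) * cmod (\<beta> e0) = cmod (\<alpha> e0) * cmod (\<beta> e0)" "cmod (\<beta> e0) \<noteq> 0"
      using g1[OF i e0] g1[OF e0 e0] g_prod[OF i e0] g_prod[OF e0 e0] by (auto simp: norm_mult)
    hence "cmod (\<alpha> i) = cmod (\<alpha> e0)" by simp
    thus ?thesis using \<rho> by (simp add: norm_divide \<rho>_def)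
  qed
  have b1: "cmod (\<rho> * \<beta> j) = 1" if j: "j \<in> midx n m" for j
    using g1[OF e0 j] g_prod[OF e0 j] by (simp add: norm_mult \<rho>_def)
  have un: "cnj z * z = 1" if "cmod z = 1" for z
    using that complex_norm_square[of z] by (simp add: mult.commute)
  have enc_inv: "enc n m (inv_into (midx n m) (enc n m) b) = b" "inv_into (midx n m) (enc n m) b \<in> midx n m" if "b < N" for b
    using that bij_betw_imp_surj_on[OF bij_betw_enc, of n m] by (simp_all add: f_inv_into_f inv_into_into)
  have inv_enc: "inv_into (midx n m) (enc n m) (enc n m i) = i" if "i \<in> midx n m" for i
    by (rule inv_into_f_f[OF bij_betw_imp_inj_on[OF bij_betw_enc] that])
  define a where "a k = \<alpha> (inv_into (midx n m) (enc n m) k) / \<rho>" for k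
  define b where "b k = \<rho> * \<beta> (inv_into (midx n m) (enc n m) k)" for k
  define U where "U = mat N N (\<lambda>(c, k). a k * u0 k c)"
  define V where "V = mat N N (\<lambda>(k, d). b k * v0 k d)"
  have UC: "U \<in> carrier_mat N N" and VC: "V \<in> carrier_mat N N" unfolding U_def V_def by auto
  have an: "cnj (a k) * a k = 1" and bn: "cnj (b k) * b k = 1" if "k < N" for k
    using un[OF a1[OF enc_inv(2)[OF that]]] un[OF b1[OF enc_inv(2)[OF that]]] unfolding a_def b_def by auto
  have uU: "unitary_mat N U"
  proof (rule unitary_matI[OF UC])
    fix k l assume kl: "k < N" "l < N"
    have "(\<Sum>c<N. cnj (U $$ (c, k)) * U $$ (c, l)) = (cnj (a k) * a l) * (\<Sum>c<N. cnj (u0 k c) * u0 l c)"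
      unfolding sum_distrib_left using kl by (intro sum.cong refl) (simp add: U_def mult_ac)
    thus "(\<Sum>c<N. cnj (U $$ (c, k)) * U $$ (c, l)) = (if k = l then 1 else 0)"
      using ou kl an by simp
  qed
  have uVt: "unitary_mat N (transpose_mat V)"
  proof (rule unitary_matI)
    show "transpose_mat V \<in> carrier_mat N N" using VC by simp
    fix k l assume kl: "k < N" "l < N"
    have "(\<Sum>c<N. cnj (transpose_mat V $$ (c, k)) * transpose_mat V $$ (c, l)) = (cnj (b k) * b l) * (\<Sum>c<N. cnj (v0 k c) * v0 l c)"
      unfolding sum_distrib_left using kl by (intro sum.cong refl) (simp add: V_def mult_ac)
    thus "(\<Sum>c<N. cnj (transpose_mat V $$ (c, k)) * transpose_mat V $$ (c, l)) = (if k = l then 1 else 0)"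
      using ov kl bn by simp
  qed
  have uV: "unitary_mat N V"
  proof (rule unitary_matI[OF VC])
    fix k l assume kl: "k < N" "l < N"
    show "(\<Sum>c<N. cnj (V $$ (c, k)) * V $$ (c, l)) = (if k = l then 1 else 0)"
      using unitary_mat_rows[OF uVt kl(2,1)] kl VC by (auto simp: mult.commute)
  qed
  \<comment> \<open>For a factor of size 1 either branch is correct, since both maps agree
    there.\<close>
  define \<psi> where "\<psi> s X = (if \<tau> (s, False) then X else transpose_mat X)" for s and X :: "complex mat"
  have "\<phi> (kronecker_fam A m) = U * kronecker_fam (\<lambda>s. \<psi> s (A s)) m * V"
    if A: "\<forall>i\<in>{1..m}. A i \<in> carrier_mat (n i) (n i)" for A
  proof (rule eq_matI)
    let ?K = "kronecker_fam (\<lambda>s. \<psi> s (A s)) m"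
    have AC: "A s \<in> carrier_mat (n s) (n s)" "\<psi> s (A s) \<in> carrier_mat (n s) (n s)" if "s \<in> {1..m}" for s
      using A that by (auto simp: \<psi>_def)
    have KC: "?K \<in> carrier_mat N N" by (rule kronecker_fam_carrier[OF AC(2)])
    have UK: "U * ?K \<in> carrier_mat N N" using UC KC by simp
    have "kronecker_fam A m \<in> carrier_mat N N" by (rule kronecker_fam_carrier[OF AC(1)])
    hence "\<phi> (kronecker_fam A m) \<in> carrier_mat N N" using lin unfolding linear_on_mats_def by blast
    thus "dim_row (\<phi> (kronecker_fam A m)) = dim_row (U * ?K * V)" "dim_col (\<phi> (kronecker_fam A m)) = dim_col (U * ?K * V)"
      using UC VC by auto
    fix c d assume "c < dim_row (U * ?K * V)" "d < dim_col (U * ?K * V)"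
    hence cd: "c < N" "d < N" using UC VC by auto
    have "\<phi> (kronecker_fam A m) $$ (c, d) = (\<Sum>i\<in>midx n m. \<Sum>j\<in>midx n m. (\<Prod>s=1..m. A s $$ (i s, j s)) * G i j $$ (c, d))"
      by (rule phi_kronecker_entry[OF lin AC(1) cd])
    also have "\<dots> = (\<Sum>i\<in>midx n m. \<Sum>j\<in>midx n m. (\<Prod>s=1..m. A s $$ (fst_idx i j s, fst_idx j i s)) * G (fst_idx i j) (fst_idx j i) $$ (c, d))"
      by (rule swap_sum)
    also have "\<dots> = (\<Sum>i\<in>midx n m. \<Sum>j\<in>midx n m. U $$ (c, enc n m i) * ?K $$ (enc n m i, enc n m j) * V $$ (enc n m j, d))"
    proof (intro sum.cong refl)
      fix i j assume ij: "i \<in> midx n m" "j \<in> midx n m"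
      have "(\<Prod>s=1..m. A s $$ (fst_idx i j s, fst_idx j i s)) = (\<Prod>s=1..m. \<psi> s (A s) $$ (i s, j s))"
      proof (intro prod.cong refl)
        fix s assume s: "s \<in> {1..m}"
        show "A s $$ (fst_idx i j s, fst_idx j i s) = \<psi> s (A s) $$ (i s, j s)"
          using AC(1)[OF s] midx_less[OF ij(1) s] midx_less[OF ij(2) s] by (auto simp: \<psi>_def fst_s[OF s])
      qed
      also have "\<dots> = ?K $$ (enc n m i, enc n m j)" by (rule kronecker_fam_entry_midx[OF AC(2) ij, symmetric])
      finally have "(\<Prod>s=1..m. A s $$ (fst_idx i j s, fst_idx j i s)) = ?K $$ (enc n m i, enc n m j)" .
      moreover have "G (fst_idx i j) (fst_idx j i) $$ (c, d) = U $$ (c, enc n m i) * V $$ (enc n m j, d)"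
        unfolding Gsw[OF ij cd] g_prod[OF ij] using cd enc_lt[OF ij(1)] enc_lt[OF ij(2)] \<rho>
        by (simp add: U_def V_def a_def b_def inv_enc ij)
      ultimately show "(\<Prod>s=1..m. A s $$ (fst_idx i j s, fst_idx j i s)) * G (fst_idx i j) (fst_idx j i) $$ (c, d)
        = U $$ (c, enc n m i) * ?K $$ (enc n m i, enc n m j) * V $$ (enc n m j, d)" by (simp add: mult_ac)
    qed
    also have "\<dots> = (\<Sum>k<N. \<Sum>l<N. U $$ (c, k) * ?K $$ (k, l) * V $$ (l, d))"
      by (simp only: sum_over_enc)
    also have "\<dots> = (\<Sum>l<N. (\<Sum>k<N. U $$ (c, k) * ?K $$ (k, l)) * V $$ (l, d))"
      by (subst sum.swap) (simp add: sum_distrib_right)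
    also have "\<dots> = (\<Sum>l<N. (U * ?K) $$ (c, l) * V $$ (l, d))"
      by (intro sum.cong refl) (simp add: mult_mat_entry[OF UC KC cd(1)] del: index_mult_mat)
    also have "\<dots> = (U * ?K * V) $$ (c, d)" by (rule mult_mat_entry[OF UK VC cd, symmetric])
    finally show "\<phi> (kronecker_fam A m) $$ (c, d) = (U * ?K * V) $$ (c, d)" .
  qed
  moreover have "\<forall>s\<in>{1..m}. (\<forall>X\<in>carrier_mat (n s) (n s). \<psi> s X = X) \<or>
      (\<forall>X\<in>carrier_mat (n s) (n s). \<psi> s X = transpose_mat X)"
    by (simp add: \<psi>_def)
  ultimately show ?thesis using uU uV by blast
qed

end

subsection \<open>Partial transposition preserves singular values\<close>

text \<open>Both products appear as diagonal blocks of the similar block triangular matrices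
  \<open>(AB, 0; B, 0)\<close> and \<open>(0, 0; B, BA)\<close>.\<close>

lemma char_poly_mult_commute:
  fixes A B :: "complex mat"
  assumes A: "A \<in> carrier_mat n n" and B: "B \<in> carrier_mat n n"
  shows "char_poly (A * B) = char_poly (B * A)"
proof -
  let ?Z = "0\<^sub>m n n" and ?I = "1\<^sub>m n"
  let ?L = "four_block_mat (A * B) ?Z B ?Z" and ?R = "four_block_mat ?Z ?Z B (B * A)"
  \<comment> \<open>\<open>?P\<close> adds \<open>A\<close> times the lower block row to the upper
    one, and \<open>?Q\<close> is its inverse; conjugating \<open>?R\<close> with them gives
    \<open>?L\<close>.\<close>
  let ?P = "four_block_mat ?I A ?Z ?I" and ?Q = "four_block_mat ?I (- A) ?Z ?I"
  note mb = mult_four_block_mat[of _ n n _ n _ n _ _ n _ n]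
  have "?P * ?Q = four_block_mat (?I * ?I + A * ?Z) (?I * (- A) + A * ?I) (?Z * ?I + ?I * ?Z) (?Z * (- A) + ?I * ?I)"
    by (rule mb) (use A in auto)
  also have "\<dots> = four_block_mat ?I ?Z ?Z ?I"
    using A by (intro cong_four_block_mat) (auto simp: uminus_l_inv_mat)
  finally have PQ: "?P * ?Q = 1\<^sub>m (n + n)" by simp
  have "?Q * ?P = four_block_mat (?I * ?I + (- A) * ?Z) (?I * A + (- A) * ?I) (?Z * ?I + ?I * ?Z) (?Z * A + ?I * ?I)"
    by (rule mb) (use A in auto)
  also have "\<dots> = four_block_mat ?I ?Z ?Z ?I"
    using A by (intro cong_four_block_mat) auto
  finally have QP: "?Q * ?P = 1\<^sub>m (n + n)" by simp
  have "?P * ?R = four_block_mat (?I * ?Z + A * B) (?I * ?Z + A * (B * A)) (?Z * ?Z + ?I * B) (?Z * ?Z + ?I * (B * A))"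
    by (rule mb) (use A B in auto)
  also have "\<dots> = four_block_mat (A * B) (A * (B * A)) B (B * A)"
    using A B by (intro cong_four_block_mat) auto
  finally have PR: "?P * ?R = four_block_mat (A * B) (A * (B * A)) B (B * A)" .
  have "four_block_mat (A * B) (A * (B * A)) B (B * A) * ?Q
      = four_block_mat ((A * B) * ?I + (A * (B * A)) * ?Z) ((A * B) * (- A) + (A * (B * A)) * ?I)
          (B * ?I + (B * A) * ?Z) (B * (- A) + (B * A) * ?I)"
    by (rule mb) (use A B in auto)
  also have "\<dots> = ?L"
    using A B by (intro cong_four_block_mat) (auto simp: assoc_mult_mat[of _ n n _ n _ n])
  finally have "?L = ?P * ?R * ?Q" unfolding PR by simp
  hence "similar_mat ?L ?R" using A B PQ QP by (intro similar_matI[of _ _ ?P ?Q "n + n"]) auto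
  hence e: "char_poly ?L = char_poly ?R" by (rule char_poly_similar)
  have lin: "\<exists>es. char_poly X = (\<Prod>a\<leftarrow>es. [:- a, 1:])" if "X \<in> carrier_mat n n" for X :: "complex mat"
    using char_poly_factorized[OF that] by blast
  have AB: "A * B \<in> carrier_mat n n" "B * A \<in> carrier_mat n n" using A B by auto
  have L: "char_poly ?L = char_poly (A * B) * char_poly ?Z"
    by (rule char_poly_0_block'[OF refl lin[OF AB(1)] lin AB(1) B]) auto
  have R: "char_poly ?R = char_poly ?Z * char_poly (B * A)"
    by (rule char_poly_0_block'[OF refl lin lin[OF AB(2)] _ B AB(2)]) auto
  \<comment> \<open>The factor contributed by the zero block is monic and can be cancelled, so that
    singular \<open>A\<close> and \<open>B\<close> are covered.\<close>
  have "char_poly ?Z \<noteq> 0" using degree_monic_char_poly[of ?Z n] by (metis leading_coeff_0_iff zero_carrier_mat zero_neq_one)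
  moreover have "char_poly ?Z * char_poly (A * B) = char_poly ?Z * char_poly (B * A)"
    using e unfolding L R by (simp only: mult.commute)
  ultimately show ?thesis by (metis mult_left_cancel)
qed

text \<open>The Gram matrix of the transpose is the transpose of \<open>A * mat_adjoint A\<close>.
  Transposition and exchanging the two factors both preserve the characteristic polynomial.\<close>

lemma char_poly_gram_transpose:
  fixes A :: "complex mat"
  assumes A: "A \<in> carrier_mat n n"
  shows "char_poly (mat_adjoint (transpose_mat A) * transpose_mat A) = char_poly (mat_adjoint A * A)"
proof -
  have A': "mat_adjoint A \<in> carrier_mat n n" using A by simp
  have t: "mat_adjoint (transpose_mat A) = transpose_mat (mat_adjoint A)"
    using A by (intro eq_matI) (auto simp: mat_adjoint_entry[of _ n n])
  have "mat_adjoint (transpose_mat A) * transpose_mat A = transpose_mat (A * mat_adjoint A)"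
    unfolding t by (rule transpose_mult[OF A A', symmetric])
  moreover have "A * mat_adjoint A \<in> carrier_mat n n" using A A' by simp
  ultimately show ?thesis using char_poly_mult_commute[OF A A'] by simp
qed

section \<open>Characteristic polynomials of tensor products\<close>

lemma enc_mono:
  assumes "\<And>s. s \<in> {1..m} \<Longrightarrow> i s \<le> j s"
  shows "enc n m i \<le> enc n m j"
  using assms
proof (induction m)
  case (Suc m)
  have "enc n m i \<le> enc n m j" using Suc.prems by (intro Suc.IH) auto
  moreover have "i (Suc m) \<le> j (Suc m)" using Suc.prems by simp
  ultimately show ?case by (simp add: add_mono)
qed simp

text \<open>Below the diagonal the row code exceeds the column code, so by monotonicity of
  \<open>enc\<close> some row component exceeds its column component, and that factor of the entry
  is zero.\<close>

lemma upper_triangular_kronecker_fam: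
  fixes B :: "nat \<Rightarrow> 'a::comm_semiring_1 mat"
  assumes B: "\<And>s. s \<in> {1..m} \<Longrightarrow> B s \<in> carrier_mat (n s) (n s)" and ut: "\<And>s. s \<in> {1..m} \<Longrightarrow> upper_triangular (B s)"
  shows "upper_triangular (kronecker_fam B m)"
proof (rule upper_triangularI)
  have K: "kronecker_fam B m \<in> carrier_mat (\<Prod>s=1..m. n s) (\<Prod>s=1..m. n s)" by (rule kronecker_fam_carrier[OF B])
  fix a b assume ab: "b < a" "a < dim_row (kronecker_fam B m)"
  have ab': "a < (\<Prod>s=1..m. n s)" "b < (\<Prod>s=1..m. n s)" using ab K by auto
  obtain i where i: "i \<in> midx n m" "a = enc n m i" by (rule enc_cases[OF ab'(1)])
  obtain j where j: "j \<in> midx n m" "b = enc n m j" by (rule enc_cases[OF ab'(2)])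
  have "\<exists>s\<in>{1..m}. j s < i s"
  proof (rule ccontr)
    assume "\<not> ?thesis"
    hence "enc n m i \<le> enc n m j" by (intro enc_mono) (auto simp: not_less)
    thus False using ab(1) i j by simp
  qed
  then obtain s where s: "s \<in> {1..m}" "j s < i s" by blast
  have "B s $$ (i s, j s) = 0"
    using upper_triangularD[OF ut[OF s(1)] s(2)] midx_less[OF i(1) s(1)] B[OF s(1)] by simp
  hence "(\<Prod>s=1..m. B s $$ (i s, j s)) = 0" using s(1) by (intro prod_zero) auto
  moreover have "kronecker_fam B m $$ (enc n m i, enc n m j) = (\<Prod>s=1..m. B s $$ (i s, j s))"
    by (rule kronecker_fam_entry_midx[OF B i(1) j(1)])
  ultimately show "kronecker_fam B m $$ (a, b) = 0" unfolding i(2) j(2) by simp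
qed

text \<open>The factors are triangularised separately and the tensor products of the transition
  matrices conjugate the whole. The order \<open>es s\<close> of the eigenvalues is prescribed so
  that two families with equal characteristic polynomials receive equal diagonals.\<close>

lemma kronecker_fam_schur:
  fixes X :: "nat \<Rightarrow> complex mat"
  assumes X: "\<And>s. s \<in> {1..m} \<Longrightarrow> X s \<in> carrier_mat (n s) (n s)"
    and cX: "\<And>s. s \<in> {1..m} \<Longrightarrow> char_poly (X s) = (\<Prod>e\<leftarrow>es s. [:- e, 1:])"
  shows "\<exists>B. (\<forall>s\<in>{1..m}. B s \<in> carrier_mat (n s) (n s) \<and> upper_triangular (B s) \<and> diag_mat (B s) = es s) \<and>
    similar_mat (kronecker_fam X m) (kronecker_fam B m)"
proof -
  let ?N = "\<Prod>s=1..m. n s"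
  define D where "D s = schur_decomposition (X s) (es s)" for s
  define B where "B s = fst (D s)" for s
  define P where "P s = fst (snd (D s))" for s
  define Q where "Q s = snd (snd (D s))" for s
  have BPQ: "similar_mat_wit (X s) (B s) (P s) (Q s) \<and> upper_triangular (B s) \<and> diag_mat (B s) = es s" if "s \<in> {1..m}" for s
    by (rule schur_decomposition[OF X[OF that] cX[OF that]]) (simp add: B_def P_def Q_def D_def)
  have w: "B s \<in> carrier_mat (n s) (n s)" "P s \<in> carrier_mat (n s) (n s)" "Q s \<in> carrier_mat (n s) (n s)"
    "X s = P s * B s * Q s" "P s * Q s = 1\<^sub>m (n s)" "Q s * P s = 1\<^sub>m (n s)" if "s \<in> {1..m}" for s
    using similar_mat_witD2[OF X[OF that]] BPQ[OF that] by auto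
  have PB: "P s * B s \<in> carrier_mat (n s) (n s)" if "s \<in> {1..m}" for s
    using mult_carrier_mat[OF w(2)[OF that] w(1)[OF that]] .
  have "kronecker_fam X m = kronecker_fam (\<lambda>s. P s * B s * Q s) m" by (rule kronecker_fam_cong[OF w(4)])
  also have "\<dots> = kronecker_fam (\<lambda>s. P s * B s) m * kronecker_fam Q m" by (rule kronecker_fam_mult[OF PB w(3)])
  also have "kronecker_fam (\<lambda>s. P s * B s) m = kronecker_fam P m * kronecker_fam B m" by (rule kronecker_fam_mult[OF w(2,1)])
  finally have X': "kronecker_fam X m = kronecker_fam P m * kronecker_fam B m * kronecker_fam Q m" .
  have "kronecker_fam P m * kronecker_fam Q m = kronecker_fam (\<lambda>s. P s * Q s) m" by (rule kronecker_fam_mult[OF w(2,3), symmetric])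
  also have "\<dots> = kronecker_fam (\<lambda>s. 1\<^sub>m (n s)) m" by (rule kronecker_fam_cong[OF w(5)])
  finally have PQ: "kronecker_fam P m * kronecker_fam Q m = 1\<^sub>m ?N" by (simp only: kronecker_fam_one)
  have "kronecker_fam Q m * kronecker_fam P m = kronecker_fam (\<lambda>s. Q s * P s) m" by (rule kronecker_fam_mult[OF w(3,2), symmetric])
  also have "\<dots> = kronecker_fam (\<lambda>s. 1\<^sub>m (n s)) m" by (rule kronecker_fam_cong[OF w(6)])
  finally have QP: "kronecker_fam Q m * kronecker_fam P m = 1\<^sub>m ?N" by (simp only: kronecker_fam_one)
  have "kronecker_fam X m \<in> carrier_mat ?N ?N" by (rule kronecker_fam_carrier[OF X])
  moreover have "kronecker_fam B m \<in> carrier_mat ?N ?N" by (rule kronecker_fam_carrier[OF w(1)])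
  moreover have "kronecker_fam P m \<in> carrier_mat ?N ?N" by (rule kronecker_fam_carrier[OF w(2)])
  moreover have "kronecker_fam Q m \<in> carrier_mat ?N ?N" by (rule kronecker_fam_carrier[OF w(3)])
  ultimately have "similar_mat (kronecker_fam X m) (kronecker_fam B m)"
    using X' PQ QP by (intro similar_matI[of _ _ "kronecker_fam P m" "kronecker_fam Q m" ?N]) simp_all
  thus ?thesis using BPQ w(1) by (intro exI[of _ B]) simp
qed

text \<open>Both products are similar to triangular ones, and the diagonal of a tensor product
  depends only on the diagonals of its factors.\<close>

lemma char_poly_kronecker_fam_cong:
  fixes A A' :: "nat \<Rightarrow> complex mat"
  assumes A: "\<And>s. s \<in> {1..m} \<Longrightarrow> A s \<in> carrier_mat (n s) (n s)" and A': "\<And>s. s \<in> {1..m} \<Longrightarrow> A' s \<in> carrier_mat (n s) (n s)"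
    and c: "\<And>s. s \<in> {1..m} \<Longrightarrow> char_poly (A s) = char_poly (A' s)"
  shows "char_poly (kronecker_fam A m) = char_poly (kronecker_fam A' m)"
proof -
  let ?N = "\<Prod>s=1..m. n s"
  have "\<forall>s\<in>{1..m}. \<exists>es. char_poly (A s) = (\<Prod>e\<leftarrow>es. [:- e, 1:])"
    using char_poly_factorized[OF A] by blast
  from bchoice[OF this] obtain es where es: "\<forall>s\<in>{1..m}. char_poly (A s) = (\<Prod>e\<leftarrow>es s. [:- e, 1:])" by (elim exE)
  have esA: "char_poly (A s) = (\<Prod>e\<leftarrow>es s. [:- e, 1:])" "char_poly (A' s) = (\<Prod>e\<leftarrow>es s. [:- e, 1:])" if "s \<in> {1..m}" for s
    using es c[OF that] that by auto
  obtain B where B: "\<forall>s\<in>{1..m}. B s \<in> carrier_mat (n s) (n s) \<and> upper_triangular (B s) \<and> diag_mat (B s) = es s"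
    and simB: "similar_mat (kronecker_fam A m) (kronecker_fam B m)"
    by (rule exE[OF kronecker_fam_schur[OF A esA(1)]]) auto
  obtain B' where B': "\<forall>s\<in>{1..m}. B' s \<in> carrier_mat (n s) (n s) \<and> upper_triangular (B' s) \<and> diag_mat (B' s) = es s"
    and simB': "similar_mat (kronecker_fam A' m) (kronecker_fam B' m)"
    by (rule exE[OF kronecker_fam_schur[OF A' esA(2)]]) auto
  have BC: "B s \<in> carrier_mat (n s) (n s)" "B' s \<in> carrier_mat (n s) (n s)"
    and ut: "upper_triangular (B s)" "upper_triangular (B' s)"
    and dg: "diag_mat (B s) = diag_mat (B' s)" if "s \<in> {1..m}" for s
    using B B' that by auto
  have K: "kronecker_fam B m \<in> carrier_mat ?N ?N" "kronecker_fam B' m \<in> carrier_mat ?N ?N"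
    by (rule kronecker_fam_carrier[OF BC(1)], assumption, rule kronecker_fam_carrier[OF BC(2)])
  have U: "upper_triangular (kronecker_fam B m)" "upper_triangular (kronecker_fam B' m)"
    by (rule upper_triangular_kronecker_fam[OF BC(1) ut(1)], assumption+,
        rule upper_triangular_kronecker_fam[OF BC(2) ut(2)])
  have "kronecker_fam B m $$ (a, a) = kronecker_fam B' m $$ (a, a)" if a: "a < ?N" for a
  proof -
    obtain i where i: "i \<in> midx n m" "a = enc n m i" by (rule enc_cases[OF a])
    have e: "B s $$ (i s, i s) = B' s $$ (i s, i s)" if s: "s \<in> {1..m}" for s
      using arg_cong[OF dg[OF s], of "\<lambda>l. l ! i s"] BC[OF s] midx_less[OF i(1) s] by (simp add: diag_mat_def)
    have "kronecker_fam B m $$ (a, a) = (\<Prod>s=1..m. B s $$ (i s, i s))"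
      unfolding i(2) by (rule kronecker_fam_entry_midx[OF BC(1) i(1) i(1)])
    also have "\<dots> = (\<Prod>s=1..m. B' s $$ (i s, i s))" by (intro prod.cong refl e)
    also have "\<dots> = kronecker_fam B' m $$ (a, a)"
      unfolding i(2) by (rule kronecker_fam_entry_midx[OF BC(2) i(1) i(1), symmetric])
    finally show ?thesis .
  qed
  hence "diag_mat (kronecker_fam B m) = diag_mat (kronecker_fam B' m)"
    using K unfolding diag_mat_def by simp
  hence "char_poly (kronecker_fam B m) = char_poly (kronecker_fam B' m)"
    using char_poly_upper_triangular[OF K(1) U(1)] char_poly_upper_triangular[OF K(2) U(2)] by simp
  thus ?thesis using char_poly_similar[OF simB] char_poly_similar[OF simB'] by simp
qed

text \<open>The Gram matrix of a product tensor is the product of the Gram matrices, so the effect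
  of each transposition can be examined within its own factor.\<close>

lemma singular_values_kronecker_transpose:
  fixes A A' :: "nat \<Rightarrow> complex mat"
  assumes A: "\<And>s. s \<in> {1..m} \<Longrightarrow> A s \<in> carrier_mat (n s) (n s)"
    and A': "\<And>s. s \<in> {1..m} \<Longrightarrow> A' s = A s \<or> A' s = transpose_mat (A s)"
  shows "singular_values (kronecker_fam A' m) = singular_values (kronecker_fam A m)"
proof -
  have AC: "A' s \<in> carrier_mat (n s) (n s)" if "s \<in> {1..m}" for s using A[OF that] A'[OF that] by auto
  have gram: "mat_adjoint (kronecker_fam X m) * kronecker_fam X m = kronecker_fam (\<lambda>s. mat_adjoint (X s) * X s) m"
    if X: "\<And>s. s \<in> {1..m} \<Longrightarrow> X s \<in> carrier_mat (n s) (n s)" for X :: "nat \<Rightarrow> complex mat"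
  proof -
    have "mat_adjoint (kronecker_fam X m) = kronecker_fam (\<lambda>s. mat_adjoint (X s)) m"
      by (rule kronecker_fam_adjoint[OF X, symmetric])
    thus ?thesis using kronecker_fam_mult[of m "\<lambda>s. mat_adjoint (X s)" n X] X by simp
  qed
  have "char_poly (kronecker_fam (\<lambda>s. mat_adjoint (A' s) * A' s) m) = char_poly (kronecker_fam (\<lambda>s. mat_adjoint (A s) * A s) m)"
  proof (rule char_poly_kronecker_fam_cong[where n = n])
    fix s assume s: "s \<in> {1..m}"
    show "mat_adjoint (A' s) * A' s \<in> carrier_mat (n s) (n s)" "mat_adjoint (A s) * A s \<in> carrier_mat (n s) (n s)"
      by (rule gram_carrier[OF AC[OF s]], rule gram_carrier[OF A[OF s]])
    show "char_poly (mat_adjoint (A' s) * A' s) = char_poly (mat_adjoint (A s) * A s)"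
      using A'[OF s] char_poly_gram_transpose[OF A[OF s]] by auto
  qed
  moreover have "mat_adjoint (kronecker_fam A' m) * kronecker_fam A' m = kronecker_fam (\<lambda>s. mat_adjoint (A' s) * A' s) m"
    by (rule gram) (rule AC)
  moreover have "mat_adjoint (kronecker_fam A m) * kronecker_fam A m = kronecker_fam (\<lambda>s. mat_adjoint (A s) * A s) m"
    by (rule gram) (rule A)
  ultimately show ?thesis unfolding singular_values_def by simp
qed

theorem theorem3p2:
  fixes m N :: nat and n :: "nat \<Rightarrow> nat" and p :: real
    and \<phi> :: "complex mat \<Rightarrow> complex mat"
  assumes "m \<ge> 2"
    and "\<forall>i\<in>{1..m}. n i > 0"
    and "N = (\<Prod>i=1..m. n i)"
    and "1 \<le> p" and "p \<noteq> 2"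
    and "linear_on_mats N \<phi>"
  shows
    "(\<forall>A. (\<forall>i\<in>{1..m}. A i \<in> carrier_mat (n i) (n i)) \<longrightarrow>
        schatten_norm p (\<phi> (kronecker_fam A m)) = schatten_norm p (kronecker_fam A m))
     \<longleftrightarrow>
     (\<exists>U V. \<exists>\<psi> :: nat \<Rightarrow> complex mat \<Rightarrow> complex mat.
        unitary_mat N U \<and> unitary_mat N V \<and>
        (\<forall>s\<in>{1..m}. (\<forall>X\<in>carrier_mat (n s) (n s). \<psi> s X = X) \<or>
                     (\<forall>X\<in>carrier_mat (n s) (n s). \<psi> s X = transpose_mat X)) \<and>
        (\<forall>A. (\<forall>i\<in>{1..m}. A i \<in> carrier_mat (n i) (n i)) \<longrightarrow>
           \<phi> (kronecker_fam A m) = U * kronecker_fam (\<lambda>s. \<psi> s (A s)) m * V))"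
    (is "?iso \<longleftrightarrow> ?form")
proof
  assume iso: ?iso
  interpret product_tensor_isometry n m p \<phi>
  proof
    show "n s > 0" if "s \<in> {1..m}" for s using assms(2) that by blast
    show "linear_on_mats (\<Prod>s=1..m. n s) \<phi>" using assms(3,6) by simp
    show "schatten_norm p (\<phi> (kronecker_fam A m)) = schatten_norm p (kronecker_fam A m)"
      if "\<And>s. s \<in> {1..m} \<Longrightarrow> A s \<in> carrier_mat (n s) (n s)" for A
      using iso that by blast
  qed (use assms in auto)
  show ?form unfolding assms(3) by (rule factorization)
next
  assume ?form
  then obtain U V \<psi> where U: "unitary_mat N U" and V: "unitary_mat N V"
    and \<psi>: "\<forall>s\<in>{1..m}. (\<forall>X\<in>carrier_mat (n s) (n s). \<psi> s X = X) \<or>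
                     (\<forall>X\<in>carrier_mat (n s) (n s). \<psi> s X = transpose_mat X)"
    and \<phi>: "\<forall>A. (\<forall>i\<in>{1..m}. A i \<in> carrier_mat (n i) (n i)) \<longrightarrow>
           \<phi> (kronecker_fam A m) = U * kronecker_fam (\<lambda>s. \<psi> s (A s)) m * V"
    by (elim exE conjE)
  show ?iso
  proof (intro allI impI)
    fix A :: "nat \<Rightarrow> complex mat"
    assume A: "\<forall>i\<in>{1..m}. A i \<in> carrier_mat (n i) (n i)"
    have alt: "\<psi> s (A s) = A s \<or> \<psi> s (A s) = transpose_mat (A s)" if "s \<in> {1..m}" for s
      using \<psi> A that by blast
    have "\<psi> s (A s) \<in> carrier_mat (n s) (n s)" if "s \<in> {1..m}" for s
      using alt[OF that] A that by auto
    hence K: "kronecker_fam (\<lambda>s. \<psi> s (A s)) m \<in> carrier_mat N N"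
      unfolding assms(3) by (rule kronecker_fam_carrier)
    have "singular_values (\<phi> (kronecker_fam A m)) = singular_values (kronecker_fam (\<lambda>s. \<psi> s (A s)) m)"
      using \<phi> A singular_values_unitary[OF U V K] by simp
    also have "\<dots> = singular_values (kronecker_fam A m)"
      by (rule singular_values_kronecker_transpose[of m A n]) (use A alt in auto)
    finally show "schatten_norm p (\<phi> (kronecker_fam A m)) = schatten_norm p (kronecker_fam A m)"
      unfolding schatten_norm_def by simp
  qed
qed

end
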